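(* Let $n\ge 1$, let $S$ be a real-analytic function, not identically zero, on a neighborhood $U$ of the origin in $\mathbb{R}^n$ with $S(0)=0$ and $\nabla S(0)=0$. Let the variables $t_1,\dots,t_n$ be split into groups $\mathbf{t}=(\mathbf{t}_1,\dots,\mathbf{t}_m)$ with $\mathbf{t}_i=(t_{i1},\dots,t_{il_i})$ (so $l_i\ge1$ and $l_1+\dots+l_m=n$). Let $K$ be a function with compact support contained in $U$ that is $C^1$ on $\{\mathbf{t}\in U:t_i\ne0\text{ for all }i\}$ and satisfies there, for some $C>0$, $$|K(\mathbf{t})|\le C,\qquad|\partial_{t_{ij}}K(\mathbf{t})|\le \frac{C}{|t_{ij}|}\quad\text{for all }i,j$$ (that is, all the exponents $\alpha_i$ in the size and derivative bounds on $K$ are $0$), and let $$Tf(\mathbf{x},x_{n+1})=\int_{\mathbb{R}^n}f(\mathbf{x}-\mathbf{t},x_{n+1}-S(\mathbf{t}))\,K(\mathbf{t})\,d\mathbf{t}.$$ Let $o(S)$ and $a_0$ be as defined in the context, let $g=\min(a_0,l_1,\dots,l_m)$, and suppose $g\le\frac1{\max(o(S),2)}$. Suppose further that there are $C_1>0$ and a neighborhood $N_0$ of the origin such that $K(\mathbf{t})>C_1$ on $N_0$. Let $P\subset\mathbb{R}^3$ be the plane with equation $(g+1)(x-y)+z=g$. Then for any $1<p,q<\infty$, if $\left(\frac1p,\frac1q,s\right)$ is such that there is a $t<s$ with $\left(\frac1p,\frac1q,t\right)$ on the plane $P$, then $T$ is not bounded from $L^p(\mathbb{R}^{n+1})$ to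 $L^q_s(\mathbb{R}^{n+1})$.
   Context: Let $f$ be real-analytic near the origin of $\mathbb{R}^n$ with Taylor expansion $f(\mathbf{t})=\sum_\alpha f_\alpha\mathbf{t}^\alpha$ at the origin. Newton polyhedron: for $\alpha$ with $f_\alpha\ne0$ let $Q_\alpha=\{\mathbf{t}\in\mathbb{R}^n:t_i\ge\alpha_i\text{ for all }i\}$; $N(f)$ is the convex hull of all such $Q_\alpha$. $f^*$: $f^*(\mathbf{t})=\sum_{(v_1,\dots,v_n)\text{ a vertex of }N(f)}|t_1|^{v_1}\cdots|t_n|^{v_n}$. $o(f)$: for a compact face $F$ of $N(f)$ (of any dimension) put $f_F(\mathbf{t})=\sum_{\alpha\in F}f_\alpha\mathbf{t}^\alpha$. Then $o(f)$ is the maximum order of any zero of any $f_F$ on $(\mathbb{R}-\{0\})^n$, with $o(f)=0$ if there are no such zeroes. $a_0$ (in the present case, where all exponents $\alpha_i$ are $0$): with $\mu$ denoting Lebesgue measure on $\mathbb{R}^n$, it is known that there are $r_0>0$, $a_0>0$ and an integer $0\le d_0\le n-1$ such that for each $0<r<r_0$ there are positive constants $b_r,B_r$ with $$b_r\,\epsilon^{a_0}|\ln\epsilon|^{d_0}<\mu(\{\mathbf{t}\in(0,r)^n:S^*(\mathbf{t})<\epsilon\})<B_r\,\epsilon^{a_0}|\ln\epsilon|^{d_0}\qquad\text{for }0<\epsilon<\tfrac12;$$ this determines $a_0$ (and $d_0$). Sobolev spaces: for $1<q<\infty$, $s\in\mathbb{R}$, $L^q_s(\mathbb{R}^{n+1})$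 has norm $\|f\|_{L^q_s}=\|(I-\Delta)^{s/2}f\|_{L^q}$, with $(I-\Delta)^{s/2}$ the Fourier multiplier operator with multiplier $(1+|\xi|^2)^{s/2}$. "$T$ is bounded from $L^p$ to $L^q_s$" means $\|Tf\|_{L^q_s}\le C'\|f\|_{L^p}$ for all Schwartz $f$ and some constant $C'$. *)

theory Defs
  imports "HOL-Analysis.Analysis"
begin

section \<open>Power series in several variables\<close>

definition multi_power :: "real ^ 'n \<Rightarrow> ('n \<Rightarrow> nat) \<Rightarrow> real" where
  "multi_power t \<alpha> = (\<Prod>i\<in>UNIV. (t $ i) ^ \<alpha> i)"

text \<open>Over \<^typ>\<open>real\<close>, \<open>has_sum\<close> over the countable set of all multi-indices is absolute
  convergence, so no ordering of the multi-indices is involved.\<close>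

definition has_power_series_at ::
  "(real ^ 'n \<Rightarrow> real) \<Rightarrow> real ^ 'n \<Rightarrow> (('n \<Rightarrow> nat) \<Rightarrow> real) \<Rightarrow> bool" where
  "has_power_series_at f u c \<longleftrightarrow>
     (\<exists>r>0. \<forall>t\<in>ball u r. ((\<lambda>\<alpha>. c \<alpha> * multi_power (t - u) \<alpha>) has_sum f t) UNIV)"

text \<open>Meant for open \<open>U\<close>; then \<open>f\<close> outside \<open>U\<close> is irrelevant, because the radius can be shrunk.\<close>

definition real_analytic_on :: "(real ^ 'n \<Rightarrow> real) \<Rightarrow> (real ^ 'n) set \<Rightarrow> bool" where
  "real_analytic_on f U \<longleftrightarrow> (\<forall>u\<in>U. \<exists>c. has_power_series_at f u c)"

text \<open>The coefficients \<open>f\<^sub>\<alpha>\<close> of the (unique) expansion at the origin.\<close>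

definition taylor_coeff :: "(real ^ 'n \<Rightarrow> real) \<Rightarrow> ('n \<Rightarrow> nat) \<Rightarrow> real" where
  "taylor_coeff f = (THE c. has_power_series_at f 0 c)"


section \<open>Partial derivatives\<close>

definition partial_deriv ::
  "'a::euclidean_space \<Rightarrow> ('a \<Rightarrow> 'b::real_normed_vector) \<Rightarrow> 'a \<Rightarrow> 'b" where
  "partial_deriv b f x = frechet_derivative f (at x) b"

primrec iter_partial ::
  "'a::euclidean_space list \<Rightarrow> ('a \<Rightarrow> 'b::real_normed_vector) \<Rightarrow> 'a \<Rightarrow> 'b" where
  "iter_partial [] f = f"
| "iter_partial (b # bs) f = partial_deriv b (iter_partial bs f)"

definition C1_on :: "('a::euclidean_space \<Rightarrow> 'b::real_normed_vector) \<Rightarrow> 'a set \<Rightarrow> bool" where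
  "C1_on f V \<longleftrightarrow>
     (\<forall>x\<in>V. f differentiable (at x)) \<and> (\<forall>b\<in>Basis. continuous_on V (partial_deriv b f))"

text \<open>The order of a zero \<open>x\<close> of \<open>f\<close>: the least order of a partial derivative of \<open>f\<close> that does not
  vanish at \<open>x\<close>.\<close>

definition zero_order :: "('a::euclidean_space \<Rightarrow> real) \<Rightarrow> 'a \<Rightarrow> nat" where
  "zero_order f x = (LEAST k. \<exists>bs\<in>lists Basis. length bs = k \<and> iter_partial bs f x \<noteq> 0)"


section \<open>The Newton polyhedron and its invariants\<close>

definition real_index :: "('n \<Rightarrow> nat) \<Rightarrow> real ^ 'n" where
  "real_index \<alpha> = (\<chi> i. real (\<alpha> i))"

definition newton_polyhedron :: "(real ^ 'n \<Rightarrow> real) \<Rightarrow> (real ^ 'n) set" where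
  "newton_polyhedron f =
     convex hull (\<Union>\<alpha>\<in>{\<alpha>. taylor_coeff f \<alpha> \<noteq> 0}. {t. \<forall>i. real (\<alpha> i) \<le> t $ i})"

text \<open>\<open>f\<^sup>*\<close>. Every vertex of the Newton polyhedron is a multi-index, so the sum ranges over the
  multi-indices that are vertices; this allows natural-number exponents, with \<open>0 ^ 0 = 1\<close>
  (whereas \<open>0 powr 0 = 0\<close>).\<close>

definition newton_star :: "(real ^ 'n \<Rightarrow> real) \<Rightarrow> real ^ 'n \<Rightarrow> real" where
  "newton_star f t =
     (\<Sum>v | real_index v extreme_point_of newton_polyhedron f. \<Prod>i\<in>UNIV. \<bar>t $ i\<bar> ^ v i)"

text \<open>Meant for compact \<open>F\<close>, where only finitely many multi-indices lie in \<open>F\<close>.\<close>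

definition face_polynomial :: "(real ^ 'n \<Rightarrow> real) \<Rightarrow> (real ^ 'n) set \<Rightarrow> real ^ 'n \<Rightarrow> real" where
  "face_polynomial f F t = (\<Sum>\<alpha> | real_index \<alpha> \<in> F. taylor_coeff f \<alpha> * multi_power t \<alpha>)"

text \<open>\<open>o(f)\<close>. On \<^typ>\<open>nat\<close>, \<open>Sup\<close> is the maximum of a nonempty finite set, and \<open>Sup {} = 0\<close>.\<close>

definition newton_order :: "(real ^ 'n \<Rightarrow> real) \<Rightarrow> nat" where
  "newton_order f =
     Sup {zero_order (face_polynomial f F) t | F t.
            F face_of newton_polyhedron f \<and> F \<noteq> {} \<and> compact F \<and>
            (\<forall>i. t $ i \<noteq> 0) \<and> face_polynomial f F t = 0}"

text \<open>\<open>a\<close> and \<open>d\<close> are the exponents \<open>a\<^sub>0\<close>, \<open>d\<^sub>0\<close> of \<open>f\<close>; they are uniquely determined by this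
  property.\<close>

definition sublevel_growth :: "(real ^ 'n \<Rightarrow> real) \<Rightarrow> real \<Rightarrow> nat \<Rightarrow> bool" where
  "sublevel_growth f a d \<longleftrightarrow>
     0 < a \<and> d \<le> CARD('n) - 1 \<and>
     (\<exists>r0>0. \<forall>r. 0 < r \<and> r < r0 \<longrightarrow>
        (\<exists>b B. 0 < b \<and> 0 < B \<and>
           (\<forall>\<epsilon>. 0 < \<epsilon> \<and> \<epsilon> < 1/2 \<longrightarrow>
              (let \<mu> = measure lebesgue
                         {t. (\<forall>i. 0 < t $ i \<and> t $ i < r) \<and> newton_star f t < \<epsilon>}
               in b * \<epsilon> powr a * \<bar>ln \<epsilon>\<bar> ^ d < \<mu> \<and> \<mu> < B * \<epsilon> powr a * \<bar>ln \<epsilon>\<bar> ^ d))))"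


section \<open>Schwartz functions, Lebesgue and Sobolev norms\<close>

definition schwartz :: "('a::euclidean_space \<Rightarrow> complex) \<Rightarrow> bool" where
  "schwartz f \<longleftrightarrow>
     (\<forall>bs\<in>lists Basis.
        (\<forall>x. iter_partial bs f differentiable (at x)) \<and>
        (\<forall>k. \<exists>B. \<forall>x. norm x ^ k * norm (iter_partial bs f x) \<le> B))"

definition Lp_norm :: "real \<Rightarrow> ('a::euclidean_space \<Rightarrow> complex) \<Rightarrow> ennreal" where
  "Lp_norm p f =
     (let I = (\<integral>\<^sup>+x. ennreal (norm (f x) powr p) \<partial>lebesgue)
      in if I = \<infinity> then \<infinity> else ennreal (enn2real I powr (1 / p)))"

definition fourier :: "('a::euclidean_space \<Rightarrow> complex) \<Rightarrow> 'a \<Rightarrow> complex" where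
  "fourier f \<xi> = (LINT x|lebesgue. exp (- \<i> * of_real (x \<bullet> \<xi>)) * f x)"

definition inv_fourier :: "('a::euclidean_space \<Rightarrow> complex) \<Rightarrow> 'a \<Rightarrow> complex" where
  "inv_fourier h x =
     (LINT \<xi>|lebesgue. exp (\<i> * of_real (x \<bullet> \<xi>)) * h \<xi>) / of_real ((2 * pi) ^ DIM('a))"

text \<open>\<open>(I - \<Delta>)\<^bsup>s/2\<^esup>\<close> on Schwartz functions, where all integrals converge absolutely. In the
  normalization of \<^const>\<open>fourier\<close>, \<open>I - \<Delta>\<close> has the symbol \<open>1 + |\<xi>|\<^sup>2\<close>.\<close>

definition bessel_op :: "real \<Rightarrow> ('a::euclidean_space \<Rightarrow> complex) \<Rightarrow> 'a \<Rightarrow> complex" where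
  "bessel_op s f =
     inv_fourier (\<lambda>\<xi>. of_real ((1 + (norm \<xi>)\<^sup>2) powr (s / 2)) * fourier f \<xi>)"

definition sobolev_norm :: "real \<Rightarrow> real \<Rightarrow> ('a::euclidean_space \<Rightarrow> complex) \<Rightarrow> ennreal" where
  "sobolev_norm q s f = Lp_norm q (bessel_op s f)"

text \<open>Boundedness from \<open>L\<^sup>p\<close> to \<open>L\<^sup>q\<^sub>s\<close>, for operators that map Schwartz functions to Schwartz
  functions. Convolution with a compactly supported finite measure, such as \<open>averaging_op\<close> below,
  is of this kind.\<close>

definition bounded_Lp_Sobolev ::
  "(('a::euclidean_space \<Rightarrow> complex) \<Rightarrow> 'a \<Rightarrow> complex) \<Rightarrow> real \<Rightarrow> real \<Rightarrow> real \<Rightarrow> bool" where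
  "bounded_Lp_Sobolev T p q s \<longleftrightarrow>
     (\<exists>C::real. \<forall>f. schwartz f \<longrightarrow> sobolev_norm q s (T f) \<le> ennreal C * Lp_norm p f)"


section \<open>The operator\<close>

text \<open>\<open>\<real>\<^bsup>n+1\<^esup>\<close> is represented as \<open>\<real>\<^sup>n \<times> \<real>\<close>. The measure has to be \<^term>\<open>lebesgue\<close> and not
  \<^term>\<open>lborel\<close>: a kernel that is only controlled off the coordinate hyperplanes need not be Borel
  measurable.\<close>

definition averaging_op ::
  "(real ^ 'n \<Rightarrow> real) \<Rightarrow> (real ^ 'n \<Rightarrow> real) \<Rightarrow> ((real ^ 'n) \<times> real \<Rightarrow> complex)
    \<Rightarrow> (real ^ 'n) \<times> real \<Rightarrow> complex" where
  "averaging_op S K f = (\<lambda>(x, y). LINT t|lebesgue. f (x - t, y - S t) * of_real (K t))"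

end

theory Submission
  imports Defs "HOL-Probability.Characteristic_Functions" "HOL-Real_Asymp.Real_Asymp"
begin

text \<open>The operator is convolution with the measure \<open>K(t) dt\<close> on the graph of \<open>S\<close>, so it is tested
on a box adapted to \<open>S\<close>. Suppose that \<open>\<bar>S\<bar> \<le> \<epsilon>\<close> on the box \<open>E = {t. \<bar>t\<^sub>i\<bar> \<le> \<beta>\<^sub>i}\<close> and let \<open>f\<close> be a bump
adapted to \<open>E \<times> [-\<epsilon>, \<epsilon>]\<close>. Near the origin \<open>K\<close> is bounded below, so the average of \<open>f\<close> is at
least of the order \<open>\<bar>E\<bar>\<close> on a set of measure about \<open>\<epsilon> \<bar>E\<bar>\<close>, and it varies on the
scale \<open>\<epsilon>\<close> in the last variable. An \<open>L\<^sup>p\<close> to \<open>L\<^sup>q\<^sub>s\<close> bound therefore forces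
\<open>\<epsilon>\<^bsup>-s\<^esup> \<bar>E\<bar> (\<epsilon> \<bar>E\<bar>)\<^bsup>1/q\<^esup> \<le> C (\<epsilon> \<bar>E\<bar>)\<^bsup>1/p\<^esup>\<close>. If \<open>\<bar>E\<bar>\<close> can be taken to be about \<open>\<epsilon>\<^bsup>a\<^esup>\<close>, letting
\<open>\<epsilon> \<rightarrow> 0\<close> gives \<open>s \<le> a - (a + 1) (1/p - 1/q)\<close>, which says that \<open>(1/p, 1/q, s)\<close> is not above the
plane \<open>P\<close> when \<open>a = g\<close>.

\<^bold>\<open>Boxes.\<close> In a small cube in the positive orthant, the set where \<open>S\<^sup>* < \<epsilon>\<close> has measure at least
\<open>c \<epsilon>\<^bsup>a\<^sub>0\<^esup>\<close>, whereas the set where \<open>\<Prod>t\<^sub>i < \<epsilon>\<^bsup>a\<^sub>0 + \<delta>\<^esup>\<close> is smaller by a power of \<open>\<epsilon>\<close>. So some corner \<open>\<beta>\<close> has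
\<open>S\<^sup>*(\<beta>) < \<epsilon>\<close> and \<open>\<Prod>\<beta>\<^sub>i \<ge> \<epsilon>\<^bsup>a\<^sub>0 + \<delta>\<^esup>\<close> (\<open>sublevel_growth_box\<close>). On the box with this corner
\<open>\<bar>S\<bar> \<le> C S\<^sup>*(\<beta>)\<close> (\<open>abs_le_newton_star\<close>), because every monomial of the Taylor series is dominated by the
monomial of some vertex of the Newton polyhedron. The group sizes are at least \<open>1\<close> and \<open>g \<le> 1/2\<close>,
so \<open>g = a\<^sub>0 \<le> 1/2\<close>; hence every side of the box is at least \<open>\<epsilon>\<^bsup>a\<^sub>0 + \<delta>\<^esup>\<close>, much longer than \<open>\<epsilon>\<close>,
and the last variable carries the highest frequency.

\<^bold>\<open>Sobolev norms.\<close> They are bounded below by duality. Take \<open>f\<close> to be an anisotropic Gaussian \<open>bump\<close>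
and pair \<open>(I - \<Delta>)\<^bsup>s/2\<^esup> T f\<close> with \<open>\<Phi>\<^sub>u\<close>, the heat flow for time \<open>u\<close> of the fourth derivative in the
last variable of such a Gaussian (\<open>wave\<close>). All Fourier transforms are explicit, and
\<open>\<Phi>\<^sub>u\<close> decays like \<open>(\<epsilon>\<^sup>2 + 2u)\<^bsup>-2\<^esup>\<close> in \<open>L\<^bsup>q'\<^esup>\<close>, so Hoelder's inequality bounds the pairing
(\<open>heat_pairing_bound\<close>). Integrating these bounds against \<open>u\<^bsup>s/2\<^esup> du\<close>, a Mellin transform,
removes the weight \<open>(1 + \<bar>\<xi>\<bar>\<^sup>2)\<^bsup>s/2\<^esup>\<close> (\<open>pairing_lower_bound_le\<close>), and what remains is the integral of \<open>K\<close>
against an explicit Gaussian on the graph of \<open>S\<close>. It is bounded below because the Gaussian is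
concentrated on the box, where its last factor is positive (\<open>integral_wave_lower_bound\<close>).
Comparing the two bounds as \<open>\<epsilon> \<rightarrow> 0\<close> yields \<open>averaging_graph_bound_implies_order_le\<close>.\<close>

section \<open>Gaussians of one variable and their Fourier transforms\<close>

definition gauss_pow :: "nat \<Rightarrow> real \<Rightarrow> real \<Rightarrow> complex" where
  "gauss_pow k \<zeta> x = iexp (\<zeta> * x) * of_real (x ^ k * exp (- x\<^sup>2 / 2))"

lemma integrable_power_gauss: "integrable lborel (\<lambda>x::real. x ^ k * exp (- x\<^sup>2 / 2))"
proof -
  have "integrable lborel (\<lambda>x. sqrt (2 * pi) * (std_normal_density x * x ^ k))"
    using integrable_std_normal_moment by (rule integrable_mult_right)
  then show ?thesis
    by (rule Bochner_Integration.integrable_cong[THEN iffD1, rotated -1])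
       (auto simp: std_normal_density_def field_simps)
qed

lemma integrable_gauss_pow: "integrable lborel (gauss_pow k \<zeta>)"
proof (rule Bochner_Integration.integrable_bound[OF integrable_power_gauss[of k]])
  show "gauss_pow k \<zeta> \<in> borel_measurable lborel"
    unfolding gauss_pow_def by (auto intro!: borel_measurable_continuous_onI continuous_intros)
  show "AE x in lborel. norm (gauss_pow k \<zeta> x) \<le> norm (x ^ k * exp (- x\<^sup>2 / 2))"
    by (simp add: gauss_pow_def norm_mult norm_power abs_mult power_abs)
qed

lemma integral_gauss_pow_0:
  "(LINT x|lborel. gauss_pow 0 \<zeta> x) = of_real (sqrt (2 * pi) * exp (- \<zeta>\<^sup>2 / 2))"
proof -
  have "char std_normal_distribution \<zeta> =
      (LINT x|density lborel std_normal_density. iexp (\<zeta> * x))"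
    by (simp add: char_def)
  also have "\<dots> = (LINT x|lborel. std_normal_density x *\<^sub>R iexp (\<zeta> * x))"
    by (intro integral_density) (auto intro!: borel_measurable_continuous_onI continuous_intros)
  also have "\<dots> = (LINT x|lborel. of_real (1 / sqrt (2 * pi)) * gauss_pow 0 \<zeta> x)"
    by (intro Bochner_Integration.integral_cong)
      (auto simp: gauss_pow_def std_normal_density_def scaleR_conv_of_real)
  finally have "of_real (1 / sqrt (2 * pi)) * (LINT x|lborel. gauss_pow 0 \<zeta> x)
      = complex_of_real (exp (- \<zeta>\<^sup>2 / 2))"
    by (simp add: char_std_normal_distribution)
  then show ?thesis by (simp add: field_simps)
qed

text \<open>Integrating the derivative of \<open>gauss_pow k \<zeta>\<close> over the line gives a recursion for the Gaussian
moments \<open>\<integral> x\<^sup>k e\<^bsup>i\<zeta>x\<^esup> e\<^bsup>-x\<^sup>2/2\<^esup> dx\<close>. For \<open>k = 0\<close> the last term vanishes, whatever \<open>k - 1\<close> is.\<close>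

lemma integral_gauss_pow_Suc:
  "(LINT x|lborel. gauss_pow (Suc k) \<zeta> x) =
     \<i> * of_real \<zeta> * (LINT x|lborel. gauss_pow k \<zeta> x)
     + of_nat k * (LINT x|lborel. gauss_pow (k - 1) \<zeta> x)"
proof -
  let ?F = "gauss_pow k \<zeta>"
  let ?f = "\<lambda>x. \<i> * of_real \<zeta> * gauss_pow k \<zeta> x + of_nat k * gauss_pow (k - 1) \<zeta> x
              - gauss_pow (Suc k) \<zeta> x"
  have der: "(?F has_vector_derivative ?f x) (at x)" for x
  proof -
    have "((\<lambda>z. exp (\<i> * (of_real \<zeta> * z))) has_field_derivative
            \<i> * of_real \<zeta> * iexp (\<zeta> * x)) (at (complex_of_real x))"
      by (auto intro!: derivative_eq_intros simp: mult_ac)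
    from has_vector_derivative_real_field[OF this, of UNIV]
    have "((\<lambda>x. iexp (\<zeta> * x)) has_vector_derivative
            \<i> * of_real \<zeta> * iexp (\<zeta> * x)) (at x)"
      by (simp add: o_def)
    moreover have "((\<lambda>x::real. x ^ k * exp (- x\<^sup>2 / 2)) has_real_derivative
            (of_nat k * x ^ (k - 1) * exp (- x\<^sup>2 / 2) - x ^ Suc k * exp (- x\<^sup>2 / 2))) (at x)"
      by (auto intro!: derivative_eq_intros simp: field_simps)
    then have "((\<lambda>x. complex_of_real (x ^ k * exp (- x\<^sup>2 / 2))) has_vector_derivative
        of_real (of_nat k * x ^ (k - 1) * exp (- x\<^sup>2 / 2) - x ^ Suc k * exp (- x\<^sup>2 / 2))) (at x)"
      by (rule has_vector_derivative_of_real[OF _])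
    ultimately have "((\<lambda>x. iexp (\<zeta> * x) * complex_of_real (x ^ k * exp (- x\<^sup>2 / 2)))
       has_vector_derivative 
          iexp (\<zeta> * x) * of_real (of_nat k * x ^ (k - 1) * exp (- x\<^sup>2 / 2) - x ^ Suc k * exp (- x\<^sup>2 / 2))
          + \<i> * of_real \<zeta> * iexp (\<zeta> * x) * complex_of_real (x ^ k * exp (- x\<^sup>2 / 2))) (at x)"
      by (rule has_vector_derivative_mult)
    then show ?thesis
      unfolding gauss_pow_def by (rule has_vector_derivative_eq_rhs) (simp add: algebra_simps)
  qed
  have int: "integrable lborel ?f"
    by (intro Bochner_Integration.integrable_diff Bochner_Integration.integrable_add
        integrable_mult_right integrable_gauss_pow)
  have lim: "(?F \<longlongrightarrow> 0) F" if "((\<lambda>x::real. x ^ k * exp (- x\<^sup>2 / 2)) \<longlongrightarrow> 0) F" for F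
  proof (rule tendsto_norm_zero_cancel)
    have "(\<lambda>x. norm (?F x)) = (\<lambda>x. \<bar>x ^ k * exp (- x\<^sup>2 / 2)\<bar>)"
      by (simp add: gauss_pow_def norm_mult fun_eq_iff abs_mult norm_power power_abs)
    then show "((\<lambda>x. norm (?F x)) \<longlongrightarrow> 0) F" using tendsto_rabs_zero[OF that] by simp
  qed
  have 1: "((\<lambda>x::real. x ^ k * exp (- x\<^sup>2 / 2)) \<longlongrightarrow> 0) at_top" 
    by real_asymp
  have 2: "((\<lambda>x::real. x ^ k * exp (- x\<^sup>2 / 2)) \<longlongrightarrow> 0) at_bot" 
  proof -
    have "((\<lambda>x::real. (- 1) ^ k * (x ^ k * exp (- x\<^sup>2 / 2))) \<longlongrightarrow> 0) at_top"
      using tendsto_mult_right_zero[OF 1] .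
    moreover have "(- x) ^ k * exp (- (- x)\<^sup>2 / 2) = (- 1) ^ k * (x ^ k * exp (- x\<^sup>2 / 2))" for x :: real
      using power_mult_distrib[of "-1" x k] by simp
    ultimately show ?thesis unfolding filterlim_at_bot_mirror by (simp only:)
  qed
  have "(LBINT x=-\<infinity>..\<infinity>. ?f x) = 0 - 0"
  proof (rule interval_integral_FTC_integrable)
    show "(?F has_vector_derivative ?f x) (at x)" for x by (rule der)
    show "isCont ?f x" for x
      unfolding gauss_pow_def by (intro continuous_intros) auto
    show "set_integrable lborel (einterval (-\<infinity>) \<infinity>) ?f"
      using int by (simp add: set_integrable_def)
    show "((?F \<circ> real_of_ereal) \<longlongrightarrow> 0) (at_right (-\<infinity>))"
      using lim[OF 2] by (simp add: ereal_tendsto_simps)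
    show "((?F \<circ> real_of_ereal) \<longlongrightarrow> 0) (at_left \<infinity>)"
      using lim[OF 1] by (simp add: ereal_tendsto_simps)
  qed auto
  then have "(LINT x|lborel. ?f x) = 0"
    by (simp add: interval_lebesgue_integral_def set_lebesgue_integral_def)
  then show ?thesis
    by (simp add: integrable_gauss_pow)
qed

lemma integral_gauss_pow_4:
  "(LINT x|lborel. gauss_pow 4 \<zeta> x) =
     of_real (sqrt (2 * pi) * ((\<zeta>^4 - 6 * \<zeta>\<^sup>2 + 3) * exp (- \<zeta>\<^sup>2 / 2)))"
  and integral_gauss_pow_2:
  "(LINT x|lborel. gauss_pow 2 \<zeta> x) =
     of_real (sqrt (2 * pi) * ((1 - \<zeta>\<^sup>2) * exp (- \<zeta>\<^sup>2 / 2)))"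
proof -
  let ?M = "\<lambda>k. (LINT x|lborel. gauss_pow k \<zeta> x)"
  have 1: "?M (Suc 0) = \<i> * of_real \<zeta> * ?M 0"
    using integral_gauss_pow_Suc[of 0 \<zeta>] by simp
  have 2: "?M 2 = \<i> * of_real \<zeta> * ?M (Suc 0) + ?M 0"
    using integral_gauss_pow_Suc[of "Suc 0" \<zeta>] by (simp add: numeral_2_eq_2)
  have 3: "?M 3 = \<i> * of_real \<zeta> * ?M 2 + 2 * ?M (Suc 0)"
    using integral_gauss_pow_Suc[of 2 \<zeta>] by (simp add: numeral_3_eq_3 numeral_2_eq_2)
  have 4: "?M 4 = \<i> * of_real \<zeta> * ?M 3 + 3 * ?M 2"
    using integral_gauss_pow_Suc[of 3 \<zeta>] by (simp add: eval_nat_numeral)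
  have i2: "\<i> * x * (\<i> * x * c) = - (x^2 * c)" for x c :: complex
    by (simp add: power2_eq_square) (metis complex_i_mult_minus mult.assoc mult.left_commute)
  have M2: "?M 2 = (1 - of_real \<zeta>^2) * ?M 0"
    unfolding 2 1 i2 by (simp add: algebra_simps)
  have "?M 4 = (of_real \<zeta>^4 - 6 * of_real \<zeta>^2 + 3) * ?M 0"
    unfolding 4 3 M2 1
    by (simp add: algebra_simps power2_eq_square eval_nat_numeral)
  then show "?M 4 = of_real (sqrt (2 * pi) * ((\<zeta>^4 - 6 * \<zeta>\<^sup>2 + 3) * exp (- \<zeta>\<^sup>2 / 2)))"
    by (simp add: integral_gauss_pow_0 mult_ac)
  show "?M 2 = of_real (sqrt (2 * pi) * ((1 - \<zeta>\<^sup>2) * exp (- \<zeta>\<^sup>2 / 2)))"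
    unfolding M2 by (simp add: integral_gauss_pow_0 mult_ac)
qed

text \<open>The parameter \<open>w\<close> is the variance. Leaving out the factor \<open>1 / sqrt (2 * pi)\<close> of the normal density
makes the formulas for the transform and for its inverse symmetric.\<close>

definition gauss :: "real \<Rightarrow> real \<Rightarrow> real" where
  "gauss w x = exp (- x\<^sup>2 / (2 * w)) / sqrt w"

text \<open>The fourth derivative of \<open>gauss w\<close>, that is, \<open>gauss w\<close> times the Hermite polynomial of degree \<open>4\<close> in
\<open>x / sqrt w\<close>, divided by \<open>w\<^sup>2\<close>. Order four is the least even order that suffices below: the
heat flow has to decay like \<open>u\<^bsup>-\<kappa>\<^esup>\<close> with \<open>\<kappa>\<close> close to \<open>s/2 + 1\<close> for \<open>s\<close> near its critical
value, and this value may be close to \<open>2\<close>. An even derivative is not zero at the origin, and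
the fourth one is positive there.\<close>

definition herm :: "real \<Rightarrow> real \<Rightarrow> real" where
  "herm w x = (x^4 / w\<^sup>2 - 6 * x\<^sup>2 / w + 3) * gauss w x / w\<^sup>2"

lemma gauss_measurable [measurable]: "gauss w \<in> borel_measurable borel"
  unfolding gauss_def by measurable

lemma herm_measurable [measurable]: "herm w \<in> borel_measurable borel"
  unfolding herm_def by measurable

lemma gauss_pos: "w > 0 \<Longrightarrow> gauss w x > 0"
  by (simp add: gauss_def)

lemma lborel_rescale:
  fixes f :: "real \<Rightarrow> 'a :: {banach, second_countable_topology}"
  assumes "integrable lborel f" and "c > 0"
  shows "integrable lborel (\<lambda>x. f (x / c))"
    and "(LINT x|lborel. f (x / c)) = c *\<^sub>R (LINT x|lborel. f x)"
proof -
  show "integrable lborel (\<lambda>x. f (x / c))"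
    using lborel_integrable_real_affine[OF assms(1), of "1/c" 0] assms(2) by simp
  show "(LINT x|lborel. f (x / c)) = c *\<^sub>R (LINT x|lborel. f x)"
    using lborel_integral_real_affine[of "1/c" f 0] assms(2)
    by (simp add: divide_inverse mult_ac)
qed

lemma herm_rescaled:
  assumes "r > 0"
  shows "herm (r\<^sup>2) x = 1 / r^5 * (((x/r)^4 - 6 * (x/r)\<^sup>2 + 3) * exp (- (x/r)\<^sup>2 / 2))"
proof -
  have 1: "x^4 / (r\<^sup>2)\<^sup>2 = (x/r)^4" "6 * x\<^sup>2 / r\<^sup>2 = 6 * (x/r)\<^sup>2" 
      "- x\<^sup>2 / (2 * r\<^sup>2) = - (x/r)\<^sup>2 / 2"
    by (simp_all add: power_divide)
  have 2: "sqrt (r\<^sup>2) = r" "r^5 = r * (r\<^sup>2)\<^sup>2"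
    using assms by (simp_all flip: power_mult power_Suc)
  show ?thesis
    unfolding herm_def gauss_def 1 2 by simp
qed

lemma
  assumes w: "w > 0"
  shows integrable_fourier_gauss: "integrable lborel (\<lambda>x. iexp (\<zeta> * x) * of_real (gauss w x))"
    and fourier_gauss: "(LINT x|lborel. iexp (\<zeta> * x) * of_real (gauss w x)) =
      of_real (sqrt (2 * pi) * exp (- (w * \<zeta>\<^sup>2 / 2)))"
    and integrable_fourier_herm: "integrable lborel (\<lambda>x. iexp (\<zeta> * x) * of_real (herm w x))"
    and fourier_herm: "(LINT x|lborel. iexp (\<zeta> * x) * of_real (herm w x)) =
      of_real (sqrt (2 * pi) * (\<zeta>^4 * exp (- (w * \<zeta>\<^sup>2 / 2))))"
proof -
  define r where "r = sqrt w"
  have r: "r > 0" "w = r\<^sup>2" using w by (simp_all add: r_def)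
  have 1: "iexp (\<zeta> * x) * of_real (gauss w x) = of_real (1 / r) * gauss_pow 0 (r * \<zeta>) (x / r)" for x
    using r by (simp add: gauss_def gauss_pow_def real_sqrt_mult power_divide)
  show "integrable lborel (\<lambda>x. iexp (\<zeta> * x) * of_real (gauss w x))"
    unfolding 1 using r 
    by (intro integrable_mult_right lborel_rescale(1) integrable_gauss_pow)
  show "(LINT x|lborel. iexp (\<zeta> * x) * of_real (gauss w x)) =
      of_real (sqrt (2 * pi) * exp (- (w * \<zeta>\<^sup>2 / 2)))"
    unfolding 1 using r 
    by (simp add: lborel_rescale(2)[OF integrable_gauss_pow] integral_gauss_pow_0
        scaleR_conv_of_real power_mult_distrib)
  let ?h = "\<lambda>x. of_real (1 / r^5) * (gauss_pow 4 (r * \<zeta>) x - 6 * gauss_pow 2 (r * \<zeta>) x + 3 * gauss_pow 0 (r * \<zeta>) x)"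
  have 2: "iexp (\<zeta> * x) * of_real (herm w x) = ?h (x / r)" for x
  proof -
    have "herm w x = 1 / r^5 * (((x/r)^4 - 6 * (x/r)\<^sup>2 + 3) * exp (- (x/r)\<^sup>2 / 2))"
      using herm_rescaled[of r x] r by simp
    then show ?thesis
      unfolding gauss_pow_def using r by (simp only:) (simp add: algebra_simps)
  qed
  have h: "integrable lborel ?h"
    by (intro integrable_mult_right Bochner_Integration.integrable_add Bochner_Integration.integrable_diff integrable_gauss_pow)
  show "integrable lborel (\<lambda>x. iexp (\<zeta> * x) * of_real (herm w x))"
    unfolding 2 using r by (intro lborel_rescale(1)[OF h])
  have "(LINT x|lborel. ?h x) = of_real (1 / r^5) * ((LINT x|lborel. gauss_pow 4 (r * \<zeta>) x)
      - 6 * (LINT x|lborel. gauss_pow 2 (r * \<zeta>) x) + 3 * (LINT x|lborel. gauss_pow 0 (r * \<zeta>) x))"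
    by (simp add: integrable_gauss_pow)
  also have "\<dots> = of_real (1 / r^5 * (sqrt (2 * pi) * (((r * \<zeta>)^4 - 6 * (r * \<zeta>)\<^sup>2 + 3) * exp (- (r * \<zeta>)\<^sup>2 / 2))
      - 6 * (sqrt (2 * pi) * ((1 - (r * \<zeta>)\<^sup>2) * exp (- (r * \<zeta>)\<^sup>2 / 2)))
      + 3 * (sqrt (2 * pi) * exp (- (r * \<zeta>)\<^sup>2 / 2))))"
    unfolding integral_gauss_pow_0 integral_gauss_pow_2 integral_gauss_pow_4
    by (simp only: of_real_mult of_real_diff of_real_add of_real_numeral of_real_1)
  also have "1 / r^5 * (sqrt (2 * pi) * (((r * \<zeta>)^4 - 6 * (r * \<zeta>)\<^sup>2 + 3) * exp (- (r * \<zeta>)\<^sup>2 / 2))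
      - 6 * (sqrt (2 * pi) * ((1 - (r * \<zeta>)\<^sup>2) * exp (- (r * \<zeta>)\<^sup>2 / 2)))
      + 3 * (sqrt (2 * pi) * exp (- (r * \<zeta>)\<^sup>2 / 2)))
      = 1 / r^5 * (sqrt (2 * pi) * ((r * \<zeta>)^4 * exp (- (r * \<zeta>)\<^sup>2 / 2)))"
  proof -
    have "a * ((z4 - 6 * z2 + 3) * e) - 6 * (a * ((1 - z2) * e)) + 3 * (a * e) = a * (z4 * e)"
      for a e z2 z4 :: real by (simp add: algebra_simps)
    then show ?thesis by (rule arg_cong)
  qed
  also have "1 / r^5 * (sqrt (2 * pi) * ((r * \<zeta>)^4 * exp (- (r * \<zeta>)\<^sup>2 / 2)))
     = 1 / r * (sqrt (2 * pi) * (\<zeta>^4 * exp (- (w * \<zeta>\<^sup>2 / 2))))"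
    using r by (simp add: power_mult_distrib eval_nat_numeral)
  finally show "(LINT x|lborel. iexp (\<zeta> * x) * of_real (herm w x)) =
      of_real (sqrt (2 * pi) * (\<zeta>^4 * exp (- (w * \<zeta>\<^sup>2 / 2))))"
    unfolding 2 using r
    by (subst lborel_rescale(2)[OF h]) (simp_all add: scaleR_conv_of_real)
qed

lemma
  assumes w: "w > 0"
  shows integrable_inv_fourier_gauss: 
      "integrable lborel (\<lambda>x. iexp (\<zeta> * x) * of_real (exp (- (w * x\<^sup>2 / 2))))"
    and inv_fourier_gauss: 
      "(LINT x|lborel. iexp (\<zeta> * x) * of_real (exp (- (w * x\<^sup>2 / 2)))) =
        of_real (sqrt (2 * pi) * gauss w \<zeta>)"
    and integrable_inv_fourier_herm: 
      "integrable lborel (\<lambda>x. iexp (\<zeta> * x) * of_real (x^4 * exp (- (w * x\<^sup>2 / 2))))"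
    and inv_fourier_herm: 
      "(LINT x|lborel. iexp (\<zeta> * x) * of_real (x^4 * exp (- (w * x\<^sup>2 / 2)))) =
        of_real (sqrt (2 * pi) * herm w \<zeta>)"
proof -
  define r where "r = sqrt w"
  have r: "r > 0" "w = r\<^sup>2" using w by (simp_all add: r_def)
  have 1: "iexp (\<zeta> * x) * of_real (exp (- (w * x\<^sup>2 / 2))) = gauss_pow 0 (\<zeta> / r) (x / (1 / r))" for x
    using r by (simp add: gauss_pow_def power_mult_distrib mult_ac)
  show "integrable lborel (\<lambda>x. iexp (\<zeta> * x) * of_real (exp (- (w * x\<^sup>2 / 2))))"
    unfolding 1 using r 
    by (intro lborel_rescale(1) integrable_gauss_pow) auto
  show "(LINT x|lborel. iexp (\<zeta> * x) * of_real (exp (- (w * x\<^sup>2 / 2)))) =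
        of_real (sqrt (2 * pi) * gauss w \<zeta>)"
    unfolding 1 using r 
    by (subst lborel_rescale(2)[OF integrable_gauss_pow])
       (simp_all add: integral_gauss_pow_0 scaleR_conv_of_real gauss_def power_divide)
  have 2: "iexp (\<zeta> * x) * of_real (x^4 * exp (- (w * x\<^sup>2 / 2))) 
      = of_real (1 / r^4) * gauss_pow 4 (\<zeta> / r) (x / (1 / r))" for x
    using r by (simp add: gauss_pow_def power_mult_distrib mult_ac)
  show "integrable lborel (\<lambda>x. iexp (\<zeta> * x) * of_real (x^4 * exp (- (w * x\<^sup>2 / 2))))"
    unfolding 2 using r 
    by (intro integrable_mult_right lborel_rescale(1) integrable_gauss_pow) auto
  have 3: "herm w \<zeta> = 1 / r^4 * (1 / r * (((\<zeta>/r)^4 - 6 * (\<zeta>/r)\<^sup>2 + 3) * exp (- (\<zeta>/r)\<^sup>2 / 2)))"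
    unfolding r(2) herm_rescaled[OF r(1)] by (simp add: eval_nat_numeral)
  have "(LINT x|lborel. gauss_pow 4 (\<zeta> / r) (x / (1 / r))) 
      = of_real (1 / r * (sqrt (2 * pi) * (((\<zeta>/r)^4 - 6 * (\<zeta>/r)\<^sup>2 + 3) * exp (- (\<zeta>/r)\<^sup>2 / 2))))"
    using r by (subst lborel_rescale(2)[OF integrable_gauss_pow])
       (simp_all add: integral_gauss_pow_4 scaleR_conv_of_real)
  then have "(LINT x|lborel. of_real (1 / r^4) * gauss_pow 4 (\<zeta> / r) (x / (1 / r)))
      = of_real (1 / r^4) * of_real (1 / r * (sqrt (2 * pi) * (((\<zeta>/r)^4 - 6 * (\<zeta>/r)\<^sup>2 + 3) * exp (- (\<zeta>/r)\<^sup>2 / 2))))"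
    by (subst integral_mult_right_zero) simp
  also have "\<dots> = of_real (sqrt (2 * pi) * herm w \<zeta>)"
    unfolding 3 of_real_mult[symmetric] by (rule arg_cong[where f=of_real]) (simp only: mult_ac)
  finally show "(LINT x|lborel. iexp (\<zeta> * x) * of_real (x^4 * exp (- (w * x\<^sup>2 / 2)))) =
        of_real (sqrt (2 * pi) * herm w \<zeta>)"
    unfolding 2 .
qed

section \<open>Tensor products\<close>

lemma borel_measurable_tensor [measurable]:
  fixes f :: "'a::euclidean_space \<Rightarrow> real \<Rightarrow> 'b::{real_normed_field,second_countable_topology}"
  assumes "\<And>b. b \<in> Basis \<Longrightarrow> f b \<in> borel_measurable borel"
  shows "(\<lambda>x. \<Prod>b\<in>Basis. f b (x \<bullet> b)) \<in> borel_measurable borel"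
  using assms by (intro borel_measurable_prod measurable_compose[OF _ assms]) auto

lemma
  fixes f :: "'a::euclidean_space \<Rightarrow> real \<Rightarrow> complex"
  assumes int: "\<And>b. b \<in> Basis \<Longrightarrow> integrable lborel (f b)"
  shows integrable_tensor: "integrable lborel (\<lambda>x. \<Prod>b\<in>Basis. f b (x \<bullet> b))"
    and integral_tensor: "(LINT x|lborel. (\<Prod>b\<in>Basis. f b (x \<bullet> b))) = (\<Prod>b\<in>Basis. (LINT t|lborel. f b t))"
proof -
  interpret product_sigma_finite "\<lambda>b::'a. lborel :: real measure" ..
  have meas: "(\<lambda>x. \<Prod>b\<in>Basis. f b (x \<bullet> b)) \<in> borel_measurable borel"
    using int by (intro borel_measurable_tensor) auto
  have T: "(\<lambda>f. \<Sum>b\<in>Basis. f b *\<^sub>R b) \<in> measurable (\<Pi>\<^sub>M b\<in>Basis. lborel) (borel :: 'a measure)"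
    by measurable
  have eq: "(\<Prod>b\<in>Basis. f b ((\<Sum>b\<in>Basis. g b *\<^sub>R b) \<bullet> b)) = (\<Prod>b\<in>Basis. f b (g b))" for g :: "'a \<Rightarrow> real"
    by (intro prod.cong) (auto simp: inner_sum_left_Basis)
  show "integrable lborel (\<lambda>x. \<Prod>b\<in>Basis. f b (x \<bullet> b))"
    unfolding lborel_eq[where 'a='a]
    by (subst integrable_distr_eq[OF T meas]) (simp add: eq product_integrable_prod int)
  show "(LINT x|lborel. (\<Prod>b\<in>Basis. f b (x \<bullet> b))) = (\<Prod>b\<in>Basis. (LINT t|lborel. f b t))"
    unfolding lborel_eq[where 'a='a]
    by (subst integral_distr[OF T meas]) (simp add: eq product_integral_prod int)
qed

lemma exp_inner_tensor:
  "iexp (x \<bullet> \<xi>) = (\<Prod>b\<in>Basis. iexp ((\<xi> \<bullet> b) * (x \<bullet> b)))"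
  for x \<xi> :: "'a::euclidean_space"
  by (simp add: euclidean_inner[of x \<xi>] sum_distrib_left exp_sum mult.commute)

text \<open>The transform of a tensor product is the tensor product of the transforms.\<close>

lemma
  fixes f :: "'a::euclidean_space \<Rightarrow> real \<Rightarrow> real" and F :: "'a \<Rightarrow> real \<Rightarrow> real"
  assumes int: "\<And>b \<zeta>. b \<in> Basis \<Longrightarrow> integrable lborel (\<lambda>t. iexp (\<zeta> * t) * of_real (f b t))"
    and F: "\<And>b \<zeta>. b \<in> Basis \<Longrightarrow> (LINT t|lborel. iexp (\<zeta> * t) * of_real (f b t)) = of_real (F b \<zeta>)"
  shows integrable_fourier_tensor: 
      "integrable lborel (\<lambda>x. iexp (x \<bullet> \<xi>) * of_real (\<Prod>b\<in>Basis. f b (x \<bullet> b)))"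
    and fourier_tensor: "(LINT x|lborel. iexp (x \<bullet> \<xi>) * of_real (\<Prod>b\<in>Basis. f b (x \<bullet> b))) =
      of_real (\<Prod>b\<in>Basis. F b (\<xi> \<bullet> b))"
proof -
  have eq: "iexp (x \<bullet> \<xi>) * of_real (\<Prod>b\<in>Basis. f b (x \<bullet> b)) =
     (\<Prod>b\<in>Basis. iexp ((\<xi> \<bullet> b) * (x \<bullet> b)) * of_real (f b (x \<bullet> b)))" for x
    unfolding exp_inner_tensor by (simp add: prod.distrib)
  note int' = int[of _ "\<xi> \<bullet> _"]
  show "integrable lborel (\<lambda>x. iexp (x \<bullet> \<xi>) * of_real (\<Prod>b\<in>Basis. f b (x \<bullet> b)))"
    unfolding eq by (rule integrable_tensor[OF int'])
  have "(LINT x|lborel. iexp (x \<bullet> \<xi>) * of_real (\<Prod>b\<in>Basis. f b (x \<bullet> b))) 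
    = (\<Prod>b\<in>Basis. (LINT t|lborel. iexp ((\<xi> \<bullet> b) * t) * of_real (f b t)))"
    unfolding eq by (rule integral_tensor[OF int'])
  also have "\<dots> = of_real (\<Prod>b\<in>Basis. F b (\<xi> \<bullet> b))"
    using F by simp
  finally show "(LINT x|lborel. iexp (x \<bullet> \<xi>) * of_real (\<Prod>b\<in>Basis. f b (x \<bullet> b))) =
      of_real (\<Prod>b\<in>Basis. F b (\<xi> \<bullet> b))" .
qed

section \<open>Anisotropic Gaussians\<close>

lemma powr_le_exp:
  fixes a c :: real
  assumes "c > 0"
  obtains K where "K > 0" "\<And>x. x \<ge> 1 \<Longrightarrow> x powr a \<le> K * exp (c * x)"
proof -
  define n where "n = nat \<lceil>\<bar>a\<bar>\<rceil>"
  have n: "a \<le> real n" by (simp add: n_def) linarith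
  show ?thesis
  proof (rule that[of "fact n / c ^ n"])
    fix x :: real assume x: "x \<ge> 1"
    have "x powr a \<le> x powr real n" using x n by (intro powr_mono) auto
    also have "\<dots> = x ^ n" using x by (simp add: powr_realpow)
    also have "\<dots> = fact n / c ^ n * ((c * x) ^ n / fact n)"
      using assms by (simp add: power_mult_distrib)
    also have "\<dots> \<le> fact n / c ^ n * exp (c * x)"
    proof (intro mult_left_mono)
      have "(c * x) ^ n /\<^sub>R fact n \<le> (\<Sum>k. (c * x) ^ k /\<^sub>R fact k)"
        using assms x sum_le_suminf[OF summable_exp_generic[of "c * x"], of "{n}"]
        by (auto simp: divide_simps)
      then show "(c * x) ^ n / fact n \<le> exp (c * x)" by (simp add: exp_def divide_inverse mult.commute)
    qed (use assms in auto)
    finally show "x powr a \<le> fact n / c ^ n * exp (c * x)" .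
  qed (use assms in auto)
qed

definition quad :: "('a::euclidean_space \<Rightarrow> real) \<Rightarrow> 'a \<Rightarrow> real" where
  "quad w x = (\<Sum>b\<in>Basis. w b * (x \<bullet> b)\<^sup>2)"

lemma quad_measurable [measurable]: "quad w \<in> borel_measurable borel"
  unfolding quad_def by measurable

lemma quad_ge:
  fixes w :: "'a::euclidean_space \<Rightarrow> real"
  assumes "\<And>b. b \<in> Basis \<Longrightarrow> w b > 0"
  obtains c where "c > 0" "\<And>x. c * (norm x)\<^sup>2 \<le> quad w x"
proof
  show "Min (w ` Basis) > 0" using assms by simp
  fix x :: 'a
  have "Min (w ` Basis) * (norm x)\<^sup>2 = (\<Sum>b\<in>Basis. Min (w ` Basis) * (x \<bullet> b)\<^sup>2)"
    unfolding norm_eq_sqrt_inner euclidean_inner[of x x] by (simp add: sum_nonneg sum_distrib_left power2_eq_square)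
  also have "\<dots> \<le> quad w x"
    unfolding quad_def by (intro sum_mono mult_right_mono) auto
  finally show "Min (w ` Basis) * (norm x)\<^sup>2 \<le> quad w x" .
qed

lemma quad_add_const: "quad (\<lambda>b. w b + u) x = quad w x + u * (norm x)\<^sup>2"
  unfolding quad_def norm_eq_sqrt_inner euclidean_inner[of x x]
  by (simp add: sum_nonneg sum_distrib_left power2_eq_square sum.distrib algebra_simps)

lemma quad_scale: "quad (\<lambda>b. c * w b) x = c * quad w x"
  by (simp add: quad_def sum_distrib_left mult.assoc)

lemma weighted_gauss_bound:
  fixes w :: "'a::euclidean_space \<Rightarrow> real"
  assumes w: "\<And>b. b \<in> Basis \<Longrightarrow> w b > 0"
  obtains K where "K > 0" "\<And>x. (1 + (norm x)\<^sup>2) powr a * exp (- quad w x) \<le> K * exp (- quad w x / 2)"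
proof -
  obtain c where c: "c > 0" "\<And>x. c * (norm x)\<^sup>2 \<le> quad w x" using quad_ge[of w] w by blast
  obtain K where K: "K > 0" "\<And>x. x \<ge> 1 \<Longrightarrow> x powr a \<le> K * exp (c / 2 * x)"
    using powr_le_exp[of "c/2" a] c by auto
  show ?thesis
  proof (rule that[of "K * exp (c / 2)"])
    fix x :: 'a
    have "(1 + (norm x)\<^sup>2) powr a * exp (- quad w x) \<le> K * exp (c / 2 * (1 + (norm x)\<^sup>2)) * exp (- quad w x)"
      by (intro mult_right_mono K) auto
    also have "\<dots> = K * exp (c / 2) * exp (c * (norm x)\<^sup>2 / 2 - quad w x)"
      by (simp add: algebra_simps add_divide_distrib flip: exp_add)
    also have "\<dots> \<le> K * exp (c / 2) * exp (- quad w x / 2)"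
      using c(2)[of x] K(1) by (intro mult_left_mono) auto
    finally show "(1 + (norm x)\<^sup>2) powr a * exp (- quad w x) \<le> K * exp (c / 2) * exp (- quad w x / 2)" .
  qed (use K in auto)
qed

text \<open>\<open>bump w\<close> is the Gaussian with variance \<open>w b\<close> in the direction \<open>b\<close>; \<open>wave e w\<close> is its fourth
derivative in the direction \<open>e\<close>, the oscillating test function.\<close>

definition bump :: "('a::euclidean_space \<Rightarrow> real) \<Rightarrow> 'a \<Rightarrow> real" where
  "bump w x = (\<Prod>b\<in>Basis. gauss (w b) (x \<bullet> b))"

definition wave :: "'a \<Rightarrow> ('a::euclidean_space \<Rightarrow> real) \<Rightarrow> 'a \<Rightarrow> real" where
  "wave e w x = (\<Prod>b\<in>Basis. (if b = e then herm else gauss) (w b) (x \<bullet> b))"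

lemma bump_measurable [measurable]: "bump w \<in> borel_measurable borel"
  unfolding bump_def by measurable

lemma wave_measurable [measurable]: "wave e w \<in> borel_measurable borel"
  unfolding wave_def by (intro borel_measurable_prod) auto

lemma bump_pos: "(\<And>b. b \<in> Basis \<Longrightarrow> w b > 0) \<Longrightarrow> bump w x > 0"
  unfolding bump_def by (intro prod_pos) (auto intro: gauss_pos)

lemma bump_alt: "bump w x = exp (- quad (\<lambda>b. 1 / w b) x / 2) / (\<Prod>b\<in>Basis. sqrt (w b))"
  unfolding bump_def gauss_def quad_def
  by (simp add: prod_dividef sum_divide_distrib sum_negf mult.commute flip: exp_sum)

lemma wave_uminus: "wave e w (- x) = wave e w x"
  unfolding wave_def by (intro prod.cong) (auto simp: herm_def gauss_def)

lemma wave_eq: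
  assumes "e \<in> Basis"
  shows "wave e w x = herm (w e) (x \<bullet> e) * (\<Prod>b\<in>Basis - {e}. gauss (w b) (x \<bullet> b))"
  unfolding wave_def by (subst prod.remove[OF _ assms]) (auto intro!: prod.cong)

lemma
  fixes w :: "'a::euclidean_space \<Rightarrow> real"
  assumes w: "\<And>b. b \<in> Basis \<Longrightarrow> w b > 0"
  shows integrable_fourier_bump: "integrable lborel (\<lambda>x. iexp (x \<bullet> \<xi>) * of_real (bump w x))"
    and fourier_bump: "(LINT x|lborel. iexp (x \<bullet> \<xi>) * of_real (bump w x)) =
      of_real (sqrt (2 * pi) ^ DIM('a) * exp (- quad w \<xi> / 2))"
proof -
  show "integrable lborel (\<lambda>x. iexp (x \<bullet> \<xi>) * of_real (bump w x))"
    unfolding bump_def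
    by (rule integrable_fourier_tensor) (use w integrable_fourier_gauss fourier_gauss in blast)+
  have "(LINT x|lborel. iexp (x \<bullet> \<xi>) * of_real (bump w x)) =
      of_real (\<Prod>b\<in>Basis. sqrt (2 * pi) * exp (- (w b * (\<xi> \<bullet> b)\<^sup>2 / 2)))"
    unfolding bump_def
    by (rule fourier_tensor) (use w integrable_fourier_gauss fourier_gauss in blast)+
  also have "(\<Prod>b\<in>Basis. sqrt (2 * pi) * exp (- (w b * (\<xi> \<bullet> b)\<^sup>2 / 2))) = sqrt (2 * pi) ^ DIM('a) * exp (- quad w \<xi> / 2)"
    by (simp add: prod.distrib quad_def sum_divide_distrib sum_negf flip: exp_sum)
  finally show "(LINT x|lborel. iexp (x \<bullet> \<xi>) * of_real (bump w x)) =
      of_real (sqrt (2 * pi) ^ DIM('a) * exp (- quad w \<xi> / 2))" .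
qed

lemma
  fixes w :: "'a::euclidean_space \<Rightarrow> real"
  assumes w: "\<And>b. b \<in> Basis \<Longrightarrow> w b > 0" and e: "e \<in> Basis"
  shows integrable_fourier_wave: "integrable lborel (\<lambda>x. iexp (x \<bullet> \<xi>) * of_real (wave e w x))"
    and fourier_wave: "(LINT x|lborel. iexp (x \<bullet> \<xi>) * of_real (wave e w x)) =
      of_real (sqrt (2 * pi) ^ DIM('a) * ((\<xi> \<bullet> e) ^ 4 * exp (- quad w \<xi> / 2)))"
    and integrable_inv_fourier_wave: 
      "integrable lborel (\<lambda>x. iexp (x \<bullet> \<xi>) * of_real ((x \<bullet> e) ^ 4 * exp (- quad w x / 2)))"
    and inv_fourier_wave: "(LINT x|lborel. iexp (x \<bullet> \<xi>) * of_real ((x \<bullet> e) ^ 4 * exp (- quad w x / 2))) =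
      of_real (sqrt (2 * pi) ^ DIM('a) * wave e w \<xi>)"
proof -
  let ?F = "\<lambda>b \<zeta>. (if b = e then \<zeta> ^ 4 else 1) * exp (- (w b * \<zeta>\<^sup>2 / 2))"
  have e4: "(\<Prod>b\<in>Basis. (if b = e then (x \<bullet> b) ^ 4 else 1)) = (x \<bullet> e) ^ 4" for x
    using e by (simp add: prod.delta)
  have F: "(\<Prod>b\<in>Basis. ?F b (\<xi> \<bullet> b)) = (\<xi> \<bullet> e) ^ 4 * exp (- quad w \<xi> / 2)" for \<xi>
    by (simp add: prod.distrib e4 quad_def sum_divide_distrib sum_negf flip: exp_sum)
  have i1: "integrable lborel (\<lambda>t. iexp (\<zeta> * t) * of_real ((if b = e then herm else gauss) (w b) t))"
    and i2: "(LINT t|lborel. iexp (\<zeta> * t) * of_real ((if b = e then herm else gauss) (w b) t)) 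
        = of_real (sqrt (2 * pi) * ?F b \<zeta>)" if "b \<in> Basis" for b \<zeta>
    using w[OF that] integrable_fourier_gauss fourier_gauss integrable_fourier_herm fourier_herm by auto
  have i3: "integrable lborel (\<lambda>t. iexp (\<zeta> * t) * of_real (?F b t))"
    and i4: "(LINT t|lborel. iexp (\<zeta> * t) * of_real (?F b t)) 
        = of_real (sqrt (2 * pi) * (if b = e then herm else gauss) (w b) \<zeta>)" if "b \<in> Basis" for b \<zeta>
    using integrable_inv_fourier_gauss[OF w[OF that], of \<zeta>] inv_fourier_gauss[OF w[OF that], of \<zeta>] 
      integrable_inv_fourier_herm[OF w[OF that], of \<zeta>] inv_fourier_herm[OF w[OF that], of \<zeta>] by (cases "b = e"; simp)+
  show "integrable lborel (\<lambda>x. iexp (x \<bullet> \<xi>) * of_real (wave e w x))"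
    unfolding wave_def by (rule integrable_fourier_tensor[OF i1 i2])
  have "(LINT x|lborel. iexp (x \<bullet> \<xi>) * of_real (wave e w x)) =
      of_real (\<Prod>b\<in>Basis. sqrt (2 * pi) * ?F b (\<xi> \<bullet> b))"
    unfolding wave_def by (rule fourier_tensor[OF i1 i2])
  also have "(\<Prod>b\<in>Basis. sqrt (2 * pi) * ?F b (\<xi> \<bullet> b)) = sqrt (2 * pi) ^ DIM('a) * ((\<xi> \<bullet> e) ^ 4 * exp (- quad w \<xi> / 2))"
    unfolding prod.distrib[of "\<lambda>_. sqrt (2 * pi)"] F by simp
  finally show "(LINT x|lborel. iexp (x \<bullet> \<xi>) * of_real (wave e w x)) =
      of_real (sqrt (2 * pi) ^ DIM('a) * ((\<xi> \<bullet> e) ^ 4 * exp (- quad w \<xi> / 2)))" .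
  show "integrable lborel (\<lambda>x. iexp (x \<bullet> \<xi>) * of_real ((x \<bullet> e) ^ 4 * exp (- quad w x / 2)))"
    unfolding F[symmetric] by (rule integrable_fourier_tensor[OF i3 i4])
  have "(LINT x|lborel. iexp (x \<bullet> \<xi>) * of_real (\<Prod>b\<in>Basis. ?F b (x \<bullet> b))) =
      of_real (\<Prod>b\<in>Basis. sqrt (2 * pi) * (if b = e then herm else gauss) (w b) (\<xi> \<bullet> b))"
    by (rule fourier_tensor[OF i3 i4])
  then show "(LINT x|lborel. iexp (x \<bullet> \<xi>) * of_real ((x \<bullet> e) ^ 4 * exp (- quad w x / 2))) =
      of_real (sqrt (2 * pi) ^ DIM('a) * wave e w \<xi>)"
    unfolding F wave_def prod.distrib[of "\<lambda>_. sqrt (2 * pi)"] by simp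
qed

lemma integrable_exp_quad:
  fixes w :: "'a::euclidean_space \<Rightarrow> real"
  assumes w: "\<And>b. b \<in> Basis \<Longrightarrow> w b > 0"
  shows "integrable lborel (\<lambda>x. exp (- quad w x))"
proof -
  have "integrable lborel (\<lambda>x::'a. complex_of_real (\<Prod>b\<in>Basis. exp (- (2 * w b * (x \<bullet> b)\<^sup>2 / 2))))"
    using integrable_inv_fourier_gauss[of "2 * w _" 0] w
    unfolding of_real_prod by (intro integrable_tensor) auto
  moreover have "(\<Prod>b\<in>Basis. exp (- (2 * w b * (x \<bullet> b)\<^sup>2 / 2))) = exp (- quad w x)" for x
    by (simp add: quad_def sum_negf flip: exp_sum)
  ultimately have "integrable lborel (\<lambda>x::'a. complex_of_real (exp (- quad w x)))"
    by (simp only:)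
  then show ?thesis by (simp only: complex_of_real_integrable_eq)
qed

lemma integrable_weighted_gauss:
  fixes w :: "'a::euclidean_space \<Rightarrow> real"
  assumes w: "\<And>b. b \<in> Basis \<Longrightarrow> w b > 0"
  shows "integrable lborel (\<lambda>x::'a. (1 + (norm x)\<^sup>2) powr a * exp (- quad w x))"
proof -
  obtain K where K: "K > 0" "\<And>x. (1 + (norm x)\<^sup>2) powr a * exp (- quad w x) \<le> K * exp (- quad w x / 2)"
    using weighted_gauss_bound[of w a] w by blast
  have "integrable lborel (\<lambda>x::'a. K * exp (- quad (\<lambda>b. 1 / 2 * w b) x))"
    using w by (intro integrable_mult_right integrable_exp_quad) auto
  then have "integrable lborel (\<lambda>x::'a. K * exp (- quad w x / 2))" unfolding quad_scale by simp
  then show ?thesis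
    by (rule Bochner_Integration.integrable_bound) (use K in \<open>auto simp: abs_mult\<close>)
qed

section \<open>The test functions are Schwartz functions of known size\<close>

lemma real_polynomial_function_has_derivative:
  fixes P :: "'a::euclidean_space \<Rightarrow> real"
  assumes "real_polynomial_function P"
  obtains D where "\<And>x. (P has_derivative D x) (at x)"
    and "\<And>b. real_polynomial_function (\<lambda>x. D x b)"
proof -
  have "\<exists>D. (\<forall>x. (P has_derivative D x) (at x)) \<and> (\<forall>b. real_polynomial_function (\<lambda>x. D x b))"
    using assms
  proof induction
    case (linear f)
    then show ?case
      by (intro exI[of _ "\<lambda>_. f"]) (auto intro: bounded_linear_imp_has_derivative real_polynomial_function.intros)
  next
    case (const c)
    then show ?case
      by (intro exI[of _ "\<lambda>_ _. 0"]) (auto intro: real_polynomial_function.intros)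
  next
    case (add f g)
    then obtain D E where "\<And>x. (f has_derivative D x) (at x)" "\<And>x. (g has_derivative E x) (at x)"
      "\<And>b. real_polynomial_function (\<lambda>x. D x b)" "\<And>b. real_polynomial_function (\<lambda>x. E x b)" by blast
    then show ?case
      by (intro exI[of _ "\<lambda>x h. D x h + E x h"])
         (auto intro!: derivative_intros real_polynomial_function.intros(3))
  next
    case (mult f g)
    then obtain D E where "\<And>x. (f has_derivative D x) (at x)" "\<And>x. (g has_derivative E x) (at x)"
      "\<And>b. real_polynomial_function (\<lambda>x. D x b)" "\<And>b. real_polynomial_function (\<lambda>x. E x b)" by blast
    with mult.hyps show ?case
      by (intro exI[of _ "\<lambda>x h. f x * E x h + D x h * g x"])
         (auto intro!: has_derivative_mult real_polynomial_function.intros(3,4))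
  qed
  then show ?thesis using that by blast
qed

lemma real_polynomial_function_bound:
  fixes P :: "'a::euclidean_space \<Rightarrow> real"
  assumes "real_polynomial_function P"
  obtains A n where "A \<ge> 0" "\<And>x. \<bar>P x\<bar> \<le> A * (1 + norm x) ^ n"
proof -
  have "\<exists>A n. A \<ge> 0 \<and> (\<forall>x. \<bar>P x\<bar> \<le> A * (1 + norm x) ^ n)"
    using assms
  proof induction
    case (linear f)
    obtain B where B: "B > 0" "\<And>x. \<bar>f x\<bar> \<le> norm x * B" 
      using bounded_linear.pos_bounded[OF linear] unfolding real_norm_def by blast
    have "\<bar>f x\<bar> \<le> B * (1 + norm x) ^ 1" for x
      using B(2)[of x] B(1) by (simp add: algebra_simps)
    then show ?case using B(1) less_imp_le by blast
  next
    case (const c)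
    show ?case by (rule exI[of _ "\<bar>c\<bar>"], rule exI[of _ 0]) simp
  next
    case (add f g)
    then obtain A n B m where A: "A \<ge> 0" "\<And>x. \<bar>f x\<bar> \<le> A * (1 + norm x) ^ n"
      and B: "B \<ge> 0" "\<And>x. \<bar>g x\<bar> \<le> B * (1 + norm x) ^ m" by blast
    have "\<bar>f x + g x\<bar> \<le> (A + B) * (1 + norm x) ^ (n + m)" for x
    proof -
      have "A * (1 + norm x) ^ n \<le> A * (1 + norm x) ^ (n + m)"
           "B * (1 + norm x) ^ m \<le> B * (1 + norm x) ^ (n + m)"
        using A(1) B(1) by (auto intro!: mult_left_mono power_increasing)
      with A(2)[of x] B(2)[of x] show ?thesis by (simp add: algebra_simps)
    qed
    then show ?case using add_nonneg_nonneg[OF A(1) B(1)] by blast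
  next
    case (mult f g)
    then obtain A n B m where A: "A \<ge> 0" "\<And>x. \<bar>f x\<bar> \<le> A * (1 + norm x) ^ n"
      and B: "B \<ge> 0" "\<And>x. \<bar>g x\<bar> \<le> B * (1 + norm x) ^ m" by blast
    have "\<bar>f x * g x\<bar> \<le> (A * B) * (1 + norm x) ^ (n + m)" for x
      using mult_mono[OF A(2)[of x] B(2)[of x]] A(1) by (simp add: abs_mult power_add mult_ac)
    then show ?case using mult_nonneg_nonneg[OF A(1) B(1)] by blast
  qed
  then show ?thesis using that by blast
qed

lemma real_polynomial_function_quad: "real_polynomial_function (quad w)"
  unfolding quad_def power2_eq_square
  by (intro real_polynomial_function_sum real_polynomial_function.intros bounded_linear_inner_left finite_Basis)

text \<open>The iterated partial derivatives of a Gaussian are polynomials times that Gaussian, and a Gaussian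
beats every polynomial.\<close>

lemma schwartz_bump:
  fixes w :: "'a::euclidean_space \<Rightarrow> real"
  assumes w: "\<And>b. b \<in> Basis \<Longrightarrow> w b > 0"
  shows "schwartz (\<lambda>x. complex_of_real (bump w x))"
proof -
  define v where "v = (\<lambda>b. 1 / 2 * (1 / w b))"
  have v: "b \<in> Basis \<Longrightarrow> v b > 0" for b using w by (simp add: v_def)
  define E where "E = (\<lambda>x::'a. exp (- quad v x))"
  have E_alt: "E x = exp (- quad (\<lambda>b. 1 / w b) x / 2)" for x
    unfolding E_def v_def quad_scale by simp
  obtain Dq where Dq: "\<And>x. (quad v has_derivative Dq x) (at x)"
    "\<And>b. real_polynomial_function (\<lambda>x. Dq x b)"
    using real_polynomial_function_has_derivative[OF real_polynomial_function_quad[of v]] by blast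
  have dE: "(E has_derivative (\<lambda>h. - Dq x h * E x)) (at x)" for x
    unfolding E_def by (auto intro!: derivative_eq_intros Dq)
  have step: "((\<lambda>x. complex_of_real (P x * E x)) has_derivative 
      (\<lambda>h. of_real (P x * (- Dq x h * E x) + D x h * E x))) (at x)"
    if "\<And>x. (P has_derivative D x) (at x)" for P D x
    by (intro has_derivative_of_real has_derivative_mult dE that)
  have iter: "\<exists>P. real_polynomial_function P \<and> iter_partial bs (\<lambda>x. complex_of_real (bump w x)) = (\<lambda>x. of_real (P x * E x))" for bs
  proof (induction bs)
    case Nil
    show ?case
      by (intro exI[of _ "\<lambda>_. 1 / (\<Prod>b\<in>Basis. sqrt (w b))"])
         (auto intro!: real_polynomial_function.intros(2) simp: bump_alt E_alt)
  next
    case (Cons b bs)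
    then obtain P where P: "real_polynomial_function P"
      "iter_partial bs (\<lambda>x. complex_of_real (bump w x)) = (\<lambda>x. of_real (P x * E x))" by blast
    obtain D where D: "\<And>x. (P has_derivative D x) (at x)" "\<And>b. real_polynomial_function (\<lambda>x. D x b)"
      using real_polynomial_function_has_derivative[OF P(1)] by blast
    have "partial_deriv b (\<lambda>x. complex_of_real (P x * E x)) = (\<lambda>x. of_real ((P x * (- 1 * Dq x b) + D x b) * E x))"
      unfolding partial_deriv_def frechet_derivative_at[OF step[of P D, OF D(1)], symmetric]
      by (simp add: algebra_simps)
    moreover have "real_polynomial_function (\<lambda>x. P x * (- 1 * Dq x b) + D x b)"
      by (intro real_polynomial_function.intros(3,4) real_polynomial_function.intros(2) P(1) D(2) Dq(2))
    ultimately show ?case using P(2) by (intro exI[of _ "\<lambda>x. P x * (- 1 * Dq x b) + D x b"]) auto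
  qed
  obtain c where c: "c > 0" "\<And>x. c * (norm x)\<^sup>2 \<le> quad v x" using quad_ge[of v] v by blast
  show ?thesis
    unfolding schwartz_def
  proof (intro ballI conjI allI)
    fix bs :: "'a list" and x
    obtain P where P: "real_polynomial_function P"
      "iter_partial bs (\<lambda>x. complex_of_real (bump w x)) = (\<lambda>x. of_real (P x * E x))" using iter by blast
    obtain D where D: "\<And>x. (P has_derivative D x) (at x)" "\<And>b. real_polynomial_function (\<lambda>x. D x b)"
      using real_polynomial_function_has_derivative[OF P(1)] by blast
    show "iter_partial bs (\<lambda>x. complex_of_real (bump w x)) differentiable (at x)"
      unfolding P(2) differentiable_def using step[of P D, OF D(1)] by blast
  next
    fix bs :: "'a list" and k
    obtain P where P: "real_polynomial_function P"
      "iter_partial bs (\<lambda>x. complex_of_real (bump w x)) = (\<lambda>x. of_real (P x * E x))" using iter by blast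
    obtain A n where A: "A \<ge> 0" "\<And>x. \<bar>P x\<bar> \<le> A * (1 + norm x) ^ n"
      using real_polynomial_function_bound[OF P(1)] by blast
    obtain K where K: "K > 0" "\<And>x. (1 + (norm x)\<^sup>2) powr (k + n) * exp (- quad v x) \<le> K * exp (- quad v x / 2)"
      using weighted_gauss_bound[of v "k + n"] v by blast
    have "norm x ^ k * norm (iter_partial bs (\<lambda>x. complex_of_real (bump w x)) x) \<le> A * 2 ^ (k + n) * K" for x
    proof -
      have x: "1 + norm x \<le> 2 * (1 + (norm x)\<^sup>2)"
      proof -
        have "2 * norm x \<le> (norm x)\<^sup>2 + 1"
          using zero_le_power2[of "norm x - 1"] unfolding power2_diff by simp
        moreover have "0 \<le> (norm x)\<^sup>2" by simp
        ultimately show ?thesis using norm_ge_zero[of x] by (smt (verit))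
      qed
      have "quad v x \<ge> 0"
        using c(2)[of x] mult_nonneg_nonneg[OF less_imp_le[OF c(1)] zero_le_power2[of "norm x"]] by linarith
      have "norm x ^ k * norm (iter_partial bs (\<lambda>x. complex_of_real (bump w x)) x) = norm x ^ k * \<bar>P x\<bar> * E x"
        unfolding P(2) by (simp add: E_def norm_mult)
      also have "\<dots> \<le> (1 + norm x) ^ k * (A * (1 + norm x) ^ n) * E x"
        using A by (intro mult_right_mono mult_mono power_mono) (auto simp: E_def)
      also have "\<dots> = A * (1 + norm x) ^ (k + n) * E x" by (simp add: power_add)
      also have "\<dots> \<le> A * (2 * (1 + (norm x)\<^sup>2)) ^ (k + n) * E x"
        using A x by (intro mult_right_mono mult_left_mono power_mono) (auto simp: E_def)
      also have "\<dots> = A * 2 ^ (k + n) * ((1 + (norm x)\<^sup>2) powr (k + n) * exp (- quad v x))"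
        unfolding E_def power_mult_distrib by (subst powr_realpow) (auto intro: add_pos_nonneg)
      also have "\<dots> \<le> A * 2 ^ (k + n) * (K * exp (- quad v x / 2))"
        using A(1) by (intro mult_left_mono K) auto
      also have "\<dots> \<le> A * 2 ^ (k + n) * (K * 1)"
        using A(1) K(1) \<open>quad v x \<ge> 0\<close> by (intro mult_left_mono) auto
      finally show ?thesis by simp
    qed
    then show "\<exists>B. \<forall>x. norm x ^ k * norm (iter_partial bs (\<lambda>x. complex_of_real (bump w x)) x) \<le> B"
      by blast
  qed
qed

lemma gauss_nonneg: "w > 0 \<Longrightarrow> gauss w x \<ge> 0"
  by (simp add: gauss_def)

lemma nn_integral_gauss_powr:
  assumes w: "w > 0" and p: "p > 0"
  shows "(\<integral>\<^sup>+x. ennreal (gauss w x powr p) \<partial>lborel) = ennreal (sqrt (2 * pi / p) * w powr ((1 - p) / 2))"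
proof -
  have i: "integrable lborel (gauss (w / p))" and v: "(LINT x|lborel. gauss (w / p) x) = sqrt (2 * pi)"
  proof -
    have "integrable lborel (\<lambda>x. complex_of_real (gauss (w / p) x))"
      using integrable_fourier_gauss[of "w / p" 0] w p by simp
    then show "integrable lborel (gauss (w / p))" by (simp add: complex_of_real_integrable_eq)
    have "(LINT x|lborel. complex_of_real (gauss (w / p) x)) = of_real (sqrt (2 * pi))"
      using fourier_gauss[of "w / p" 0] w p by simp
    then show "(LINT x|lborel. gauss (w / p) x) = sqrt (2 * pi)"
      unfolding integral_complex_of_real of_real_eq_iff .
  qed
  have s: "sqrt w powr a = w powr (a / 2)" for a
    using w by (simp add: powr_half_sqrt[symmetric] powr_powr)
  have eq: "gauss w x powr p = sqrt (w / p) * w powr (- p / 2) * gauss (w / p) x" for x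
  proof -
    have "gauss w x powr p = exp (- x\<^sup>2 / (2 * w)) powr p / sqrt w powr p"
      unfolding gauss_def by (rule powr_divide)
    also have "exp (- x\<^sup>2 / (2 * w)) powr p = exp (- x\<^sup>2 / (2 * (w / p)))"
      unfolding powr_def using w p by simp
    finally have 1: "gauss w x powr p = exp (- x\<^sup>2 / (2 * (w / p))) / w powr (p / 2)"
      unfolding s .
    have 2: "w powr (- p / 2) = 1 / w powr (p / 2)"
      using powr_minus_divide[of w "p / 2"] by simp
    have 3: "a / c = r * (1 / c) * (a / r)" if "r \<noteq> 0" for a c r :: real using that by simp
    show ?thesis unfolding 1 2 unfolding gauss_def by (rule 3) (use w p in simp)
  qed
  have "(\<integral>\<^sup>+x. ennreal (gauss w x powr p) \<partial>lborel) = ennreal (LINT x|lborel. gauss w x powr p)"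
    unfolding eq using w p
    by (intro nn_integral_eq_integral integrable_mult_right i) (auto intro!: mult_nonneg_nonneg gauss_nonneg)
  also have "(LINT x|lborel. gauss w x powr p) = sqrt (w / p) * w powr (- p / 2) * sqrt (2 * pi)"
    unfolding eq by (simp add: v)
  also have "\<dots> = sqrt (2 * pi / p) * (w powr (1/2) * w powr (- p / 2))"
    using w by (simp add: powr_half_sqrt real_sqrt_divide real_sqrt_mult)
  also have "w powr (1/2) * w powr (- p / 2) = w powr ((1 - p) / 2)"
    by (simp add: diff_divide_distrib flip: powr_add)
  finally show ?thesis .
qed

lemma nn_integral_bump_powr:
  fixes w :: "'a::euclidean_space \<Rightarrow> real"
  assumes w: "\<And>b. b \<in> Basis \<Longrightarrow> w b > 0" and p: "p > 0"
  shows "(\<integral>\<^sup>+x. ennreal (bump w x powr p) \<partial>lborel) = 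
    ennreal (sqrt (2 * pi / p) ^ DIM('a) * (\<Prod>b\<in>Basis. w b) powr ((1 - p) / 2))"
proof -
  have "(\<integral>\<^sup>+x. ennreal (bump w x powr p) \<partial>lborel) = 
      (\<integral>\<^sup>+x. (\<Prod>b\<in>Basis. ennreal (gauss (w b) (x \<bullet> b) powr p)) \<partial>lborel)"
    using w unfolding bump_def
    by (intro nn_integral_cong) 
       (simp add: prod_ennreal prod_powr_distrib less_imp_le gauss_pos)
  also have "\<dots> = (\<Prod>b\<in>Basis. (\<integral>\<^sup>+x. ennreal (gauss (w b) x powr p) \<partial>lborel))"
    by (intro nn_integral_lborel_prod) auto
  also have "\<dots> = (\<Prod>b\<in>Basis. ennreal (sqrt (2 * pi / p) * w b powr ((1 - p) / 2)))"
    by (intro prod.cong refl nn_integral_gauss_powr w p)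
  also have "\<dots> = ennreal (\<Prod>b\<in>Basis. sqrt (2 * pi / p) * w b powr ((1 - p) / 2))"
    using p by (intro prod_ennreal) auto
  also have "(\<Prod>b\<in>Basis. sqrt (2 * pi / p) * w b powr ((1 - p) / 2)) 
      = sqrt (2 * pi / p) ^ DIM('a) * (\<Prod>b\<in>Basis. w b) powr ((1 - p) / 2)"
    using w by (simp add: prod.distrib prod_powr_distrib less_imp_le)
  finally show ?thesis .
qed

text \<open>Doubling the variance absorbs the polynomial factor, so that the size of \<open>wave\<close> is controlled by
that of a \<open>bump\<close>. The factor \<open>1 / w\<^sup>2\<close> is the gain from the four derivatives.\<close>

lemma abs_herm_le:
  assumes w: "w > 0"
  shows "\<bar>herm w x\<bar> \<le> 100 * gauss (2 * w) x / w\<^sup>2"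
proof -
  define y where "y = x\<^sup>2 / (4 * w)"
  have y: "y \<ge> 0" "x^4 / w\<^sup>2 = 16 * y\<^sup>2" "x\<^sup>2 / w = 4 * y"
    using w by (auto simp: y_def power_divide field_simps eval_nat_numeral)
  have e: "1 + y + y\<^sup>2 / 2 \<le> exp y" using exp_lower_Taylor_quadratic[OF y(1)] .
  have "\<bar>x^4 / w\<^sup>2 - 6 * x\<^sup>2 / w + 3\<bar> \<le> 16 * y\<^sup>2 + 24 * y + 3"
  proof -
    have "x^4 / w\<^sup>2 - 6 * x\<^sup>2 / w + 3 = 16 * y\<^sup>2 - 24 * y + 3" using y(2,3) by simp
    then show ?thesis using y(1) zero_le_power2[of y] by linarith
  qed
  also have "\<dots> \<le> 60 * exp y" using e y(1) zero_le_power2[of y] by linarith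
  finally have 1: "\<bar>x^4 / w\<^sup>2 - 6 * x\<^sup>2 / w + 3\<bar> \<le> 60 * exp y" .
  have "sqrt 2 \<le> 1.5" by (rule real_le_lsqrt) (auto simp: power2_eq_square)
  have 2: "exp y * gauss w x = sqrt 2 * gauss (2 * w) x"
  proof -
    have "- x\<^sup>2 / (2 * w) = - y + - x\<^sup>2 / (2 * (2 * w))" using w by (simp add: y_def field_simps)
    then have "exp (- x\<^sup>2 / (2 * w)) = exp (- y) * exp (- x\<^sup>2 / (2 * (2 * w)))" 
      by (simp only: exp_add)
    then show ?thesis using w by (simp add: gauss_def real_sqrt_mult exp_minus field_simps)
  qed
  have "\<bar>herm w x\<bar> = \<bar>x^4 / w\<^sup>2 - 6 * x\<^sup>2 / w + 3\<bar> * gauss w x / w\<^sup>2"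
    using gauss_pos[OF w, of x] by (simp add: herm_def abs_mult)
  also have "\<dots> \<le> 60 * exp y * gauss w x / w\<^sup>2"
    using 1 gauss_pos[OF w, of x] by (intro divide_right_mono mult_right_mono) auto
  also have "\<dots> = 60 * sqrt 2 * gauss (2 * w) x / w\<^sup>2" using 2 by simp
  also have "\<dots> \<le> 100 * gauss (2 * w) x / w\<^sup>2"
    using \<open>sqrt 2 \<le> 1.5\<close> gauss_pos[of "2 * w" x] w by (intro divide_right_mono mult_right_mono) auto
  finally show ?thesis .
qed

lemma gauss_le_double: "w > 0 \<Longrightarrow> gauss w x \<le> 2 * gauss (2 * w) x"
proof -
  assume w: "w > 0"
  have "exp (- x\<^sup>2 / (2 * w)) \<le> exp (- x\<^sup>2 / (2 * (2 * w)))" using w by (simp add: field_simps)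
  moreover have "sqrt 2 \<le> 2" by (rule real_le_lsqrt) auto
  ultimately have "exp (- x\<^sup>2 / (2 * w)) * sqrt 2 \<le> exp (- x\<^sup>2 / (2 * (2 * w))) * 2"
    by (intro mult_mono) auto
  then show ?thesis using w by (simp add: gauss_def real_sqrt_mult field_simps)
qed

lemma abs_wave_le:
  fixes w :: "'a::euclidean_space \<Rightarrow> real"
  assumes w: "\<And>b. b \<in> Basis \<Longrightarrow> w b > 0" and e: "e \<in> Basis"
  shows "\<bar>wave e w x\<bar> \<le> 100 * 2 ^ DIM('a) / (w e)\<^sup>2 * bump (\<lambda>b. 2 * w b) x"
proof -
  let ?g = "\<lambda>b. gauss (2 * w b) (x \<bullet> b)"
  have g: "?g b > 0" if "b \<in> Basis" for b using w[OF that] by (intro gauss_pos) auto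
  have "\<bar>wave e w x\<bar> = \<bar>herm (w e) (x \<bullet> e)\<bar> * (\<Prod>b\<in>Basis - {e}. gauss (w b) (x \<bullet> b))"
    unfolding wave_eq[OF e] abs_mult abs_prod
    using w by (intro arg_cong2[where f="(*)"] prod.cong) (auto intro!: abs_of_pos gauss_pos)
  also have "\<dots> \<le> (100 * ?g e / (w e)\<^sup>2) * (\<Prod>b\<in>Basis - {e}. 2 * ?g b)"
    using w e g by (intro mult_mono abs_herm_le prod_mono) 
      (auto intro!: gauss_le_double prod_nonneg mult_nonneg_nonneg divide_nonneg_nonneg gauss_nonneg)
  also have "\<dots> = 100 * 2 ^ card (Basis - {e}) / (w e)\<^sup>2 * (?g e * (\<Prod>b\<in>Basis - {e}. ?g b))"
    by (simp add: prod.distrib)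
  also have "?g e * (\<Prod>b\<in>Basis - {e}. ?g b) = bump (\<lambda>b. 2 * w b) x"
    unfolding bump_def by (rule prod.remove[symmetric]) (use e in auto)
  also have "100 * 2 ^ card (Basis - {e}) / (w e)\<^sup>2 * bump (\<lambda>b. 2 * w b) x 
    \<le> 100 * 2 ^ DIM('a) / (w e)\<^sup>2 * bump (\<lambda>b. 2 * w b) x"
    using w e by (intro mult_right_mono divide_right_mono mult_left_mono power_increasing less_imp_le[OF bump_pos])
      (auto intro: card_mono)
  finally show ?thesis .
qed

text \<open>Young's inequality for \<open>F x / A\<close> and \<open>G x / B\<close>, integrated.\<close>

lemma Hoelder_nn_integral:
  fixes F G :: "'a \<Rightarrow> real"
  assumes [measurable]: "F \<in> borel_measurable M" "G \<in> borel_measurable M"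
    and nn: "\<And>x. F x \<ge> 0" "\<And>x. G x \<ge> 0"
    and q: "q > 1" "r > 1" "1 / q + 1 / r = 1"
    and A: "A > 0" "(\<integral>\<^sup>+x. ennreal (F x powr q) \<partial>M) \<le> ennreal (A powr q)"
    and B: "B > 0" "(\<integral>\<^sup>+x. ennreal (G x powr r) \<partial>M) \<le> ennreal (B powr r)"
  shows "(\<integral>\<^sup>+x. ennreal (F x * G x) \<partial>M) \<le> ennreal (A * B)"
proof -
  have "(\<integral>\<^sup>+x. ennreal (F x * G x) \<partial>M) \<le> 
     (\<integral>\<^sup>+x. (ennreal (A * B / q / A powr q) * ennreal (F x powr q) + ennreal (A * B / r / B powr r) * ennreal (G x powr r)) \<partial>M)"
  proof (intro nn_integral_mono)
    fix x
    have "(F x / A) * (G x / B) \<le> (F x / A) powr q / q + (G x / B) powr r / r"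
      using nn A B q by (intro Youngs_inequality) auto
    then have "A * B * ((F x / A) * (G x / B)) \<le> A * B * ((F x powr q / A powr q) / q + (G x powr r / B powr r) / r)"
      using nn A B by (intro mult_left_mono) (auto simp: powr_divide)
    then have "F x * G x \<le> (A * B / q / A powr q) * (F x powr q) + (A * B / r / B powr r) * (G x powr r)"
      using A B by (simp add: algebra_simps)
    then show "ennreal (F x * G x) \<le> ennreal (A * B / q / A powr q) * ennreal (F x powr q) + ennreal (A * B / r / B powr r) * ennreal (G x powr r)"
      using A B q by (simp add: ennreal_leI flip: ennreal_mult ennreal_plus)
  qed
  also have "\<dots> = ennreal (A * B / q / A powr q) * (\<integral>\<^sup>+x. ennreal (F x powr q) \<partial>M) 
      + ennreal (A * B / r / B powr r) * (\<integral>\<^sup>+x. ennreal (G x powr r) \<partial>M)"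
    by (simp add: nn_integral_add nn_integral_cmult)
  also have "\<dots> \<le> ennreal (A * B / q / A powr q) * ennreal (A powr q) + ennreal (A * B / r / B powr r) * ennreal (B powr r)"
    by (intro add_mono mult_left_mono A B) auto
  also have "\<dots> = ennreal (A * B / q + A * B / r)"
    using A B q by (simp flip: ennreal_mult ennreal_plus)
  also have "A * B / q + A * B / r = A * B * (1 / q + 1 / r)" by (simp add: algebra_simps)
  finally show ?thesis using q(3) by simp
qed

section \<open>Averages along a parametrized set as Fourier multipliers\<close>

definition conv_op :: "('t::euclidean_space \<Rightarrow> 'a::euclidean_space) \<Rightarrow> ('t \<Rightarrow> real) \<Rightarrow> ('a \<Rightarrow> complex) \<Rightarrow> 'a \<Rightarrow> complex" where
  "conv_op \<gamma> k f z = (LINT t|lborel. f (z - \<gamma> t) * of_real (k t))"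

definition conv_mult :: "('t::euclidean_space \<Rightarrow> 'a::euclidean_space) \<Rightarrow> ('t \<Rightarrow> real) \<Rightarrow> 'a \<Rightarrow> complex" where
  "conv_mult \<gamma> k \<xi> = (LINT t|lborel. exp (- \<i> * of_real (\<gamma> t \<bullet> \<xi>)) * of_real (k t))"

lemma fourier_lborel:
  assumes [measurable]: "f \<in> borel_measurable borel"
  shows "fourier f \<xi> = (LINT x|lborel. exp (- \<i> * of_real (x \<bullet> \<xi>)) * f x)"
  unfolding fourier_def by (rule integral_completion) measurable

lemma inv_fourier_lborel:
  fixes G :: "'a::euclidean_space \<Rightarrow> complex"
  assumes [measurable]: "G \<in> borel_measurable borel"
  shows "inv_fourier G x = (LINT \<xi>|lborel. iexp (x \<bullet> \<xi>) * G \<xi>) / of_real ((2 * pi) ^ DIM('a))"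
  unfolding inv_fourier_def by (subst integral_completion) auto

lemma
  fixes f :: "'a::euclidean_space \<Rightarrow> 'b::{banach, second_countable_topology}"
  assumes "integrable lborel f"
  shows integrable_lborel_translate: "integrable lborel (\<lambda>x. f (x - a))"
    and integral_lborel_translate: "(LINT x|lborel. f (x - a)) = (LINT x|lborel. f x)"
proof -
  have [measurable]: "f \<in> borel_measurable borel" using assms by auto
  have d: "distr lborel borel ((+) (- a)) = (lborel :: 'a measure)" by (rule lborel_distr_plus)
  show "integrable lborel (\<lambda>x. f (x - a))"
    using assms by (subst (asm) d[symmetric], subst (asm) integrable_distr_eq) auto
  have "(LINT x|lborel. f x) = (LINT x|distr lborel borel ((+) (- a)). f x)" unfolding d ..
  also have "\<dots> = (LINT x|lborel. f (x - a))" by (subst integral_distr) auto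
  finally show "(LINT x|lborel. f (x - a)) = (LINT x|lborel. f x)" ..
qed

lemma conv_mult_measurable [measurable]:
  assumes [measurable]: "\<gamma> \<in> borel_measurable borel" "k \<in> borel_measurable borel"
  shows "conv_mult \<gamma> k \<in> borel_measurable borel"
  unfolding conv_mult_def by measurable

lemma norm_conv_mult_le:
  assumes "integrable lborel k"
  shows "norm (conv_mult \<gamma> k \<xi>) \<le> (LINT t|lborel. \<bar>k t\<bar>)"
proof -
  have "norm (conv_mult \<gamma> k \<xi>) \<le> (LINT t|lborel. norm (exp (- \<i> * of_real (\<gamma> t \<bullet> \<xi>)) * complex_of_real (k t)))"
    unfolding conv_mult_def by (rule integral_norm_bound)
  then show ?thesis by (simp add: norm_mult)
qed

lemma conv_op_measurable [measurable]:
  assumes [measurable]: "\<gamma> \<in> borel_measurable borel" "k \<in> borel_measurable borel" "f \<in> borel_measurable borel"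
  shows "conv_op \<gamma> k f \<in> borel_measurable borel"
  unfolding conv_op_def by measurable

lemma fourier_conv_op:
  fixes \<gamma> :: "'t::euclidean_space \<Rightarrow> 'a::euclidean_space"
  assumes [measurable]: "\<gamma> \<in> borel_measurable borel" and k: "integrable lborel k" and f: "integrable lborel f"
  shows "fourier (conv_op \<gamma> k f) \<xi> = conv_mult \<gamma> k \<xi> * fourier f \<xi>"
proof -
  have [measurable]: "f \<in> borel_measurable borel" "k \<in> borel_measurable borel" using f k by auto
  let ?F = "\<lambda>t z. exp (- \<i> * of_real (z \<bullet> \<xi>)) * f (z - \<gamma> t) * of_real (k t)"
  have fe: "integrable lborel (\<lambda>z. exp (- \<i> * of_real (z \<bullet> \<xi>)) * f z)"
    by (rule Bochner_Integration.integrable_bound[OF f]) (auto simp: norm_mult)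
  have int: "integrable (lborel \<Otimes>\<^sub>M lborel) (case_prod ?F)"
  proof (rule lborel_pair.Fubini_integrable)
    have "(LINT z|lborel. norm (?F t z)) = \<bar>k t\<bar> * (LINT z|lborel. norm (f z))" for t
      using integral_lborel_translate[OF integrable_norm[OF f], of "\<gamma> t"] by (simp add: norm_mult)
    then show "integrable lborel (\<lambda>t. LINT z|lborel. norm (case (t, z) of (t, z) \<Rightarrow> ?F t z))"
      using integrable_mult_left[OF integrable_abs[OF k]] by simp
    have "integrable lborel (?F t)" for t
    proof (rule Bochner_Integration.integrable_bound)
      show "integrable lborel (\<lambda>z. norm (f (z - \<gamma> t)) * \<bar>k t\<bar>)"
        by (intro integrable_mult_left integrable_norm integrable_lborel_translate f)
    qed (auto simp: norm_mult)
    then show "AE t in lborel. integrable lborel (\<lambda>z. case (t, z) of (t, z) \<Rightarrow> ?F t z)" by simp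
  qed measurable
  have "fourier (conv_op \<gamma> k f) \<xi> = (LINT z|lborel. exp (- \<i> * of_real (z \<bullet> \<xi>)) * conv_op \<gamma> k f z)"
    by (rule fourier_lborel) measurable
  also have "\<dots> = (LINT z|lborel. (LINT t|lborel. ?F t z))"
    unfolding conv_op_def by (simp only: integral_mult_right_zero[symmetric] mult.assoc)
  also have "\<dots> = (LINT t|lborel. (LINT z|lborel. ?F t z))"
    by (rule lborel_pair.Fubini_integral[OF int])
  also have "(\<lambda>t. LINT z|lborel. ?F t z) = (\<lambda>t. fourier f \<xi> * (exp (- \<i> * of_real (\<gamma> t \<bullet> \<xi>)) * of_real (k t)))"
  proof
    fix t
    have "?F t z = exp (- \<i> * of_real ((z - \<gamma> t) \<bullet> \<xi>)) * f (z - \<gamma> t) * (exp (- \<i> * of_real (\<gamma> t \<bullet> \<xi>)) * of_real (k t))" for z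
      by (simp add: inner_diff_left algebra_simps flip: exp_add)
    then have "(LINT z|lborel. ?F t z) = (LINT z|lborel. exp (- \<i> * of_real ((z - \<gamma> t) \<bullet> \<xi>)) * f (z - \<gamma> t)) * (exp (- \<i> * of_real (\<gamma> t \<bullet> \<xi>)) * of_real (k t))"
      by (simp only: integral_mult_left_zero)
    then show "(LINT z|lborel. ?F t z) = fourier f \<xi> * (exp (- \<i> * of_real (\<gamma> t \<bullet> \<xi>)) * of_real (k t))"
      using integral_lborel_translate[OF fe, of "\<gamma> t"] by (simp only: fourier_lborel[of f] \<open>f \<in> borel_measurable borel\<close>)
  qed
  also have "(LINT t|lborel. fourier f \<xi> * (exp (- \<i> * of_real (\<gamma> t \<bullet> \<xi>)) * of_real (k t))) = conv_mult \<gamma> k \<xi> * fourier f \<xi>"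
    unfolding conv_mult_def by (simp only: integral_mult_right_zero mult.commute)
  finally show ?thesis .
qed

lemma integrable_times_lborel_pair:
  fixes F :: "'a::euclidean_space \<Rightarrow> complex" and G :: "'b::euclidean_space \<Rightarrow> complex"
    and h :: "'a \<Rightarrow> 'b \<Rightarrow> complex"
  assumes F: "integrable lborel F" and G: "integrable lborel G"
    and [measurable]: "case_prod h \<in> borel_measurable (lborel \<Otimes>\<^sub>M lborel)"
    and h: "\<And>x y. norm (h x y) \<le> 1"
  shows "integrable (lborel \<Otimes>\<^sub>M lborel) (\<lambda>(x, y). h x y * (F x * G y))"
proof -
  have [measurable]: "F \<in> borel_measurable borel" "G \<in> borel_measurable borel" using F G by auto
  have "integrable (lborel \<Otimes>\<^sub>M lborel) (\<lambda>(x, y). F x * G y)"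
  proof (rule lborel_pair.Fubini_integrable)
    show "integrable lborel (\<lambda>x. LINT y|lborel. norm (case (x, y) of (x, y) \<Rightarrow> F x * G y))"
      using integrable_mult_left[OF integrable_norm[OF F]] by (simp add: norm_mult)
    show "AE x in lborel. integrable lborel (\<lambda>y. case (x, y) of (x, y) \<Rightarrow> F x * G y)"
      using G by simp
  qed measurable
  then show ?thesis
    by (rule Bochner_Integration.integrable_bound)
       (auto simp: norm_mult mult_left_le_one_le h)
qed

text \<open>Plancherel's formula in the form that Fubini's theorem gives directly, with the inverse transform of
\<open>G\<close> on one side and the transform of \<open>\<phi>\<close> on the other.\<close>

lemma pairing_inv_fourier:
  fixes G :: "'a::euclidean_space \<Rightarrow> complex" and \<phi> :: "'a \<Rightarrow> real"
  assumes G: "integrable lborel G" and \<phi>: "integrable lborel \<phi>"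
  shows "(LINT z|lborel. inv_fourier G z * of_real (\<phi> z)) = 
    (LINT \<xi>|lborel. G \<xi> * (LINT z|lborel. iexp (z \<bullet> \<xi>) * of_real (\<phi> z))) / of_real ((2 * pi) ^ DIM('a))"
proof -
  have [measurable]: "G \<in> borel_measurable borel" "\<phi> \<in> borel_measurable borel" using G \<phi> by auto
  let ?F = "\<lambda>\<xi> z. iexp (z \<bullet> \<xi>) * (G \<xi> * of_real (\<phi> z))"
  have int: "integrable (lborel \<Otimes>\<^sub>M lborel) (case_prod ?F)"
    by (rule integrable_times_lborel_pair) (use G \<phi> in auto)
  have "(LINT z|lborel. inv_fourier G z * of_real (\<phi> z)) = (LINT z|lborel. (LINT \<xi>|lborel. ?F \<xi> z) / of_real ((2 * pi) ^ DIM('a)))"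
    unfolding inv_fourier_lborel[OF \<open>G \<in> borel_measurable borel\<close>] 
    by (simp only: integral_mult_left_zero[symmetric] mult.assoc times_divide_eq_left)
  also have "\<dots> = (LINT z|lborel. (LINT \<xi>|lborel. ?F \<xi> z)) / of_real ((2 * pi) ^ DIM('a))"
    by (rule integral_divide_zero)
  also have "(LINT z|lborel. (LINT \<xi>|lborel. ?F \<xi> z)) = (LINT \<xi>|lborel. (LINT z|lborel. ?F \<xi> z))"
    by (rule lborel_pair.Fubini_integral[OF int])
  also have "\<dots> = (LINT \<xi>|lborel. G \<xi> * (LINT z|lborel. iexp (z \<bullet> \<xi>) * of_real (\<phi> z)))"
    by (simp only: integral_mult_right_zero[symmetric] mult.left_commute)
  finally show ?thesis .
qed

lemma integrable_bump:
  fixes w :: "'a::euclidean_space \<Rightarrow> real"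
  assumes "\<And>b. b \<in> Basis \<Longrightarrow> w b > 0"
  shows "integrable lborel (bump w)"
proof -
  have "integrable lborel (\<lambda>x. complex_of_real (bump w x))"
    using integrable_fourier_bump[OF assms, where \<xi>=0] by simp
  then show ?thesis by (simp only: complex_of_real_integrable_eq)
qed

lemma integrable_wave:
  fixes w :: "'a::euclidean_space \<Rightarrow> real"
  assumes "\<And>b. b \<in> Basis \<Longrightarrow> w b > 0" "e \<in> Basis"
  shows "integrable lborel (wave e w)"
proof -
  have "integrable lborel (\<lambda>x. complex_of_real (wave e w x))"
    using integrable_fourier_wave[OF assms, where \<xi>=0] by simp
  then show ?thesis by (simp only: complex_of_real_integrable_eq)
qed

lemma quad_uminus [simp]: "quad w (- x) = quad w x"
  by (simp add: quad_def)

lemma fourier_of_bump: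
  fixes w :: "'a::euclidean_space \<Rightarrow> real"
  assumes "\<And>b. b \<in> Basis \<Longrightarrow> w b > 0"
  shows "fourier (\<lambda>x. complex_of_real (bump w x)) \<xi> = of_real (sqrt (2 * pi) ^ DIM('a) * exp (- quad w \<xi> / 2))"
proof -
  have "fourier (\<lambda>x. complex_of_real (bump w x)) \<xi> = (LINT x|lborel. iexp (x \<bullet> (- \<xi>)) * of_real (bump w x))"
    by (subst fourier_lborel) (auto simp: inner_minus_right)
  then show ?thesis using fourier_bump[OF assms, where \<xi>="- \<xi>"] by simp
qed

lemma Lp_norm_bump:
  fixes w :: "'a::euclidean_space \<Rightarrow> real"
  assumes w: "\<And>b. b \<in> Basis \<Longrightarrow> w b > 0" and p: "p > 0"
  shows "Lp_norm p (\<lambda>x. complex_of_real (bump w x)) = 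
    ennreal ((sqrt (2 * pi / p) ^ DIM('a)) powr (1 / p) * (\<Prod>b\<in>Basis. w b) powr ((1 / p - 1) / 2))"
proof -
  have "(\<integral>\<^sup>+x. ennreal (norm (complex_of_real (bump w x)) powr p) \<partial>lebesgue) 
      = (\<integral>\<^sup>+x. ennreal (bump w x powr p) \<partial>lborel)"
    using bump_pos[of w] w by (subst nn_integral_completion) (auto intro!: nn_integral_cong simp: abs_of_pos)
  also note nn_integral_bump_powr[OF w p]
  finally have 1: "(\<integral>\<^sup>+x. ennreal (norm (complex_of_real (bump w x)) powr p) \<partial>lebesgue) =
    ennreal (sqrt (2 * pi / p) ^ DIM('a) * (\<Prod>b\<in>Basis. w b) powr ((1 - p) / 2))" by simp
  have 2: "(1 - p) / 2 * (1 / p) = (1 / p - 1) / 2" using p by (simp add: field_simps)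
  have "(sqrt (2 * pi / p) ^ DIM('a) * (\<Prod>b\<in>Basis. w b) powr ((1 - p) / 2)) powr (1 / p)
     = (sqrt (2 * pi / p) ^ DIM('a)) powr (1 / p) * (\<Prod>b\<in>Basis. w b) powr ((1 / p - 1) / 2)"
    using p unfolding 2[symmetric] by (subst powr_mult) (auto simp: powr_powr)
  then show ?thesis
    unfolding Lp_norm_def Let_def 1 using p by simp
qed

lemma Lp_norm_leD:
  assumes q: "q > 0" and D: "D \<ge> 0" and le: "Lp_norm q f \<le> ennreal D"
  shows "(\<integral>\<^sup>+x. ennreal (norm (f x) powr q) \<partial>lebesgue) \<le> ennreal (D powr q)"
proof -
  define I where "I = (\<integral>\<^sup>+x. ennreal (norm (f x) powr q) \<partial>lebesgue)"
  have I: "I \<noteq> \<infinity>" using le unfolding Lp_norm_def Let_def I_def[symmetric] by (auto simp: top_unique)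
  then have "ennreal (enn2real I powr (1 / q)) \<le> ennreal D"
    using le unfolding Lp_norm_def Let_def I_def[symmetric] by simp
  then have "enn2real I powr (1 / q) \<le> D" using D by simp
  then have "(enn2real I powr (1 / q)) powr q \<le> D powr q" using q by (intro powr_mono2) auto
  then have "enn2real I \<le> D powr q" using q by (simp add: powr_powr)
  then have "ennreal (enn2real I) \<le> ennreal (D powr q)" by (rule ennreal_leI)
  moreover have "I = ennreal (enn2real I)" using I by (simp add: less_top)
  ultimately show ?thesis unfolding I_def[symmetric] by simp
qed

section \<open>Testing a Sobolev bound with Gaussians\<close>

text \<open>Up to the factor \<open>e\<^bsup>-u\<^esup>\<close>, the pairing of \<open>(I - \<Delta>)\<^bsup>s/2\<^esup> T f\<close> with the heat flow at time \<open>u\<close> of a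
\<open>wave\<close>, computed on the Fourier side, when \<open>T\<close> has the multiplier \<open>m\<close> and \<open>f\<close> is a \<open>bump\<close>. Including
\<open>e\<^bsup>-u\<^esup>\<close> turns \<open>e\<^bsup>-u\<bar>\<xi>\<bar>\<^sup>2\<^esup>\<close> into \<open>e\<^bsup>-u(1 + \<bar>\<xi>\<bar>\<^sup>2)\<^esup>\<close>, whose Mellin transform in \<open>u\<close> is a power
of \<open>1 + \<bar>\<xi>\<bar>\<^sup>2\<close>.\<close>

definition heat_pairing :: "('a::euclidean_space \<Rightarrow> complex) \<Rightarrow> real \<Rightarrow> 'a \<Rightarrow> ('a \<Rightarrow> real) \<Rightarrow> real \<Rightarrow> complex" where
  "heat_pairing m s e w u =
     (LINT \<xi>|lborel. of_real ((1 + (norm \<xi>)\<^sup>2) powr (s / 2) * exp (- u * (1 + (norm \<xi>)\<^sup>2)) *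
        ((\<xi> \<bullet> e) ^ 4 * exp (- quad w \<xi>))) * m \<xi>)"

text \<open>The factor \<open>(\<Prod>w b) powr ((1 / p - 1 / q - 1) / 2)\<close> is the product of the \<open>L\<^sup>p\<close> norm of the input
\<open>bump w\<close> and of the dual norm of the tester, a \<open>wave\<close> with variances \<open>w b + 2u\<close>. Heat flow adds
\<open>2u\<close> to every variance; in the direction \<open>e\<close>, where four derivatives are
taken, this gains the factor \<open>1 / (w e + 2u)\<^sup>2\<close>.\<close>

lemma heat_pairing_bound:
  fixes \<gamma> :: "'t::euclidean_space \<Rightarrow> 'a::euclidean_space"
  assumes \<gamma>[measurable]: "\<gamma> \<in> borel_measurable borel" and k: "integrable lborel k"
    and bdd: "bounded_Lp_Sobolev (conv_op \<gamma> k) p q s"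
    and p: "p > 1" and q: "q > 1" and e: "e \<in> Basis"
  obtains A where "A \<ge> 0"
    "\<And>w u. (\<And>b. b \<in> Basis \<Longrightarrow> w b > 0) \<Longrightarrow> u \<ge> 0 \<Longrightarrow>
       norm (heat_pairing (conv_mult \<gamma> k) s e w u)
       \<le> A * (\<Prod>b\<in>Basis. w b) powr ((1 / p - 1 / q - 1) / 2) * exp (- u) / (w e + 2 * u)\<^sup>2"
proof -
  have km[measurable]: "k \<in> borel_measurable borel" using k by auto
  obtain C where C: "\<And>f. schwartz f \<Longrightarrow> sobolev_norm q s (conv_op \<gamma> k f) \<le> ennreal C * Lp_norm p f"
    using bdd unfolding bounded_Lp_Sobolev_def by blast
  define C' where "C' = max C 1"
  have C'_pos: "C' > 0" by (simp add: C'_def)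
  have C'_bound: "sobolev_norm q s (conv_op \<gamma> k f) \<le> ennreal C' * Lp_norm p f" if "schwartz f" for f
    by (rule order_trans[OF C[OF that]]) (auto intro!: mult_right_mono ennreal_leI simp: C'_def)
  note C' = C'_pos C'_bound
  \<comment> \<open>The exponent dual to \<open>q\<close>.\<close>
  define r where "r = q / (q - 1)"
  have r: "r > 1" "1 / q + 1 / r = 1" "1 / r = 1 - 1 / q" using q by (auto simp: r_def field_simps)
  let ?d = "DIM('a)"
  define cp where "cp = (sqrt (2 * pi / p) ^ ?d) powr (1 / p)"
  define cr where "cr = (sqrt (2 * pi / r) ^ ?d) powr (1 / r)"
  have pos: "cp > 0" "cr > 0" using p r by (auto simp: cp_def cr_def)
  define A where "A = C' * cp * (100 * 2 ^ ?d * cr)"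
  show ?thesis
  proof (rule that[of A])
    show "A \<ge> 0" using pos C' by (auto simp: A_def)
    fix w :: "'a \<Rightarrow> real" and u :: real
    assume w: "\<And>b. b \<in> Basis \<Longrightarrow> w b > 0" and u: "u \<ge> 0"
    define W where "W = (\<Prod>b\<in>Basis. w b)"
    have W: "W > 0" unfolding W_def using w by (intro prod_pos) auto
    define f where "f = (\<lambda>x. complex_of_real (bump w x))"
    define D where "D = cp * W powr ((1 / p - 1) / 2)"
    have D: "D > 0" using pos W by (simp add: D_def)
    have fm[measurable]: "f \<in> borel_measurable borel" unfolding f_def by measurable
    have fi: "integrable lborel f" unfolding f_def complex_of_real_integrable_eq by (rule integrable_bump[of w, OF w])
    define G where "G = (\<lambda>\<xi>. of_real ((1 + (norm \<xi>)\<^sup>2) powr (s / 2)) * fourier (conv_op \<gamma> k f) \<xi>)"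
    have G_eq: "G \<xi> = of_real ((1 + (norm \<xi>)\<^sup>2) powr (s / 2)) * (conv_mult \<gamma> k \<xi> * of_real (sqrt (2 * pi) ^ ?d * exp (- quad w \<xi> / 2)))" for \<xi>
      unfolding G_def fourier_conv_op[OF \<gamma> k fi] unfolding f_def
      by (subst fourier_of_bump) (use w in auto)
    have Gm[measurable]: "G \<in> borel_measurable borel" unfolding G_eq[abs_def] by measurable
    have Gi: "integrable lborel G"
    proof (rule Bochner_Integration.integrable_bound)
      have "integrable lborel (\<lambda>\<xi>. (1 + (norm \<xi>)\<^sup>2) powr (s / 2) * exp (- quad (\<lambda>b. 1 / 2 * w b) \<xi>))"
        using w by (intro integrable_weighted_gauss) auto
      then show "integrable lborel (\<lambda>\<xi>. ((LINT t|lborel. \<bar>k t\<bar>) * sqrt (2 * pi) ^ ?d) * ((1 + (norm \<xi>)\<^sup>2) powr (s / 2) * exp (- quad w \<xi> / 2)))"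
        unfolding quad_scale by (intro integrable_mult_right) simp
      show "AE \<xi> in lborel. norm (G \<xi>) \<le> norm (((LINT t|lborel. \<bar>k t\<bar>) * sqrt (2 * pi) ^ ?d) * ((1 + (norm \<xi>)\<^sup>2) powr (s / 2) * exp (- quad w \<xi> / 2)))"
      proof (intro AE_I2)
        fix \<xi>
        have "norm (G \<xi>) = (1 + (norm \<xi>)\<^sup>2) powr (s / 2) * (norm (conv_mult \<gamma> k \<xi>) * (sqrt (2 * pi) ^ ?d * exp (- quad w \<xi> / 2)))"
          unfolding G_eq norm_mult norm_of_real by simp
        also have "\<dots> \<le> (1 + (norm \<xi>)\<^sup>2) powr (s / 2) * ((LINT t|lborel. \<bar>k t\<bar>) * (sqrt (2 * pi) ^ ?d * exp (- quad w \<xi> / 2)))"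
          by (intro mult_left_mono mult_right_mono norm_conv_mult_le k) auto
        finally show "norm (G \<xi>) \<le> norm (((LINT t|lborel. \<bar>k t\<bar>) * sqrt (2 * pi) ^ ?d) * ((1 + (norm \<xi>)\<^sup>2) powr (s / 2) * exp (- quad w \<xi> / 2)))"
          by (simp add: mult_ac)
      qed
    qed measurable
    define B where "B = bessel_op s (conv_op \<gamma> k f)"
    have B_eq: "B = inv_fourier G" by (simp add: B_def bessel_op_def G_def)
    have Bm[measurable]: "B \<in> borel_measurable borel"
      unfolding B_eq inv_fourier_lborel[OF Gm, abs_def] by measurable
    have "Lp_norm q B \<le> ennreal C' * Lp_norm p f"
      using C'(2)[of f] schwartz_bump[of w, OF w] unfolding B_def sobolev_norm_def f_def by blast
    also have "Lp_norm p f = ennreal D"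
      unfolding f_def D_def cp_def W_def by (rule Lp_norm_bump[OF w]) (use p in auto)
    also have "ennreal C' * ennreal D = ennreal (C' * D)" using C' D by (simp add: ennreal_mult)
    finally have "(\<integral>\<^sup>+x. ennreal (norm (B x) powr q) \<partial>lebesgue) \<le> ennreal ((C' * D) powr q)"
      by (rule Lp_norm_leD[rotated 2]) (use q C' D in auto)
    then have B1: "(\<integral>\<^sup>+x. ennreal (norm (B x) powr q) \<partial>lborel) \<le> ennreal ((C' * D) powr q)"
      by (subst (asm) nn_integral_completion) auto
    define j where "j = (\<lambda>\<xi>. of_real ((1 + (norm \<xi>)\<^sup>2) powr (s / 2) * exp (- u * (norm \<xi>)\<^sup>2) *
           ((\<xi> \<bullet> e) ^ 4 * exp (- quad w \<xi>))) * conv_mult \<gamma> k \<xi>)"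
    define w' where "w' = (\<lambda>b. w b + 2 * u)"
    have w': "w' b > 0" if "b \<in> Basis" for b using w[OF that] u by (simp add: w'_def)
    define \<phi> where "\<phi> = wave e w'"
    have \<phi>m[measurable]: "\<phi> \<in> borel_measurable borel" unfolding \<phi>_def by measurable
    define \<kappa> where "\<kappa> = 100 * 2 ^ ?d / (w' e)\<^sup>2"
    have \<kappa>: "\<kappa> > 0" using w'[OF e] by (simp add: \<kappa>_def)
    define D' where "D' = \<kappa> * (cr * W powr ((1 / r - 1) / 2))"
    have D': "D' > 0" using \<kappa> pos W by (simp add: D'_def)
    have P1: "(\<integral>\<^sup>+x. ennreal (\<bar>\<phi> x\<bar> powr r) \<partial>lborel) \<le> ennreal (D' powr r)"
    proof -
      have w2: "2 * w' b > 0" if "b \<in> Basis" for b using w'[OF that] by simp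
      have "(\<integral>\<^sup>+x. ennreal (\<bar>\<phi> x\<bar> powr r) \<partial>lborel) \<le> (\<integral>\<^sup>+x. ennreal (\<kappa> powr r) * ennreal (bump (\<lambda>b. 2 * w' b) x powr r) \<partial>lborel)"
      proof (intro nn_integral_mono)
        fix x
        have "\<bar>\<phi> x\<bar> powr r \<le> (\<kappa> * bump (\<lambda>b. 2 * w' b) x) powr r"
          unfolding \<phi>_def \<kappa>_def using abs_wave_le[of w', OF w' e, of x] r by (intro powr_mono2) auto
        also have "\<dots> = \<kappa> powr r * bump (\<lambda>b. 2 * w' b) x powr r"
          using \<kappa> bump_pos[of "\<lambda>b. 2 * w' b" x] w2 by (intro powr_mult) 
        finally show "ennreal (\<bar>\<phi> x\<bar> powr r) \<le> ennreal (\<kappa> powr r) * ennreal (bump (\<lambda>b. 2 * w' b) x powr r)"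
          by (simp add: ennreal_leI flip: ennreal_mult)
      qed
      also have "\<dots> = ennreal (\<kappa> powr r) * ennreal (sqrt (2 * pi / r) ^ ?d * (\<Prod>b\<in>Basis. 2 * w' b) powr ((1 - r) / 2))"
        using r by (subst nn_integral_cmult) (auto simp: nn_integral_bump_powr[of "\<lambda>b. 2 * w' b", OF w2])
      also have "\<dots> \<le> ennreal (\<kappa> powr r) * ennreal (sqrt (2 * pi / r) ^ ?d * W powr ((1 - r) / 2))"
      proof (intro mult_left_mono ennreal_leI)
        have "W \<le> (\<Prod>b\<in>Basis. 2 * w' b)"
          unfolding W_def using w u by (intro prod_mono) (auto simp: w'_def less_imp_le intro: less_imp_le add_increasing2)
        then show "(\<Prod>b\<in>Basis. 2 * w' b) powr ((1 - r) / 2) \<le> W powr ((1 - r) / 2)"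
          using W r by (intro powr_mono2') auto
      qed (use r in auto)
      also have "\<dots> = ennreal (\<kappa> powr r * (sqrt (2 * pi / r) ^ ?d * W powr ((1 - r) / 2)))"
        using r by (intro ennreal_mult[symmetric]) auto
      also have "\<kappa> powr r * (sqrt (2 * pi / r) ^ ?d * W powr ((1 - r) / 2)) = D' powr r"
      proof -
        have h: "(1 - r) / 2 = (1 / r - 1) / 2 * r" using r(1) by (simp add: field_simps)
        have "cr powr r = sqrt (2 * pi / r) ^ ?d" using r(1) unfolding cr_def powr_powr by simp
        then show ?thesis
          unfolding D'_def h by (simp add: powr_mult powr_powr)
      qed
      finally show ?thesis .
    qed
    have H: "(\<integral>\<^sup>+x. ennreal (norm (B x) * \<bar>\<phi> x\<bar>) \<partial>lborel) \<le> ennreal (C' * D * D')"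
      by (rule Hoelder_nn_integral[of _ _ _ q r]) (use q r B1 P1 C' D D' in auto)
    have "norm (LINT z|lborel. B z * of_real (\<phi> z)) \<le> C' * D * D'"
    proof -
      have "integrable lborel (\<lambda>z. B z * of_real (\<phi> z))"
        by (rule integrableI_bounded) (use H in \<open>auto simp: norm_mult less_top[symmetric] top_unique\<close>)
      then have "ennreal (norm (LINT z|lborel. B z * of_real (\<phi> z))) \<le> ennreal (C' * D * D')"
        using integral_norm_bound_ennreal[of lborel "\<lambda>z. B z * of_real (\<phi> z)"] H by (simp add: norm_mult)
      then show ?thesis using C' D D' by simp
    qed
    moreover have "(LINT z|lborel. B z * of_real (\<phi> z)) = (LINT \<xi>|lborel. j \<xi>)"
    proof -
      have "(LINT z|lborel. B z * of_real (\<phi> z)) = (LINT \<xi>|lborel. G \<xi> * of_real (sqrt (2 * pi) ^ ?d * ((\<xi> \<bullet> e) ^ 4 * exp (- quad w' \<xi> / 2)))) / of_real ((2 * pi) ^ ?d)"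
      proof -
        have iw: "integrable lborel (wave e w')" by (rule integrable_wave) (use w' e in auto)
        have fw: "(LINT z|lborel. iexp (z \<bullet> \<xi>) * of_real (wave e w' z)) =
            of_real (sqrt (2 * pi) ^ ?d * ((\<xi> \<bullet> e) ^ 4 * exp (- quad w' \<xi> / 2)))" for \<xi>
          by (rule fourier_wave) (use w' e in auto)
        show ?thesis unfolding B_eq \<phi>_def pairing_inv_fourier[OF Gi iw] fw by (rule refl)
      qed
      also have "\<dots> = (LINT \<xi>|lborel. G \<xi> * of_real (sqrt (2 * pi) ^ ?d * ((\<xi> \<bullet> e) ^ 4 * exp (- quad w' \<xi> / 2))) / of_real ((2 * pi) ^ ?d))"
        by (rule integral_divide_zero[symmetric])
      also have "\<dots> = (LINT \<xi>|lborel. j \<xi>)"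
      proof (intro Bochner_Integration.integral_cong refl)
        fix \<xi> :: 'a
        define S where "S = sqrt (2 * pi) ^ ?d"
        have "S * S = (sqrt (2 * pi) * sqrt (2 * pi)) ^ ?d" by (simp only: S_def power_mult_distrib)
        then have S: "S \<noteq> 0" "(2 * pi) ^ ?d = S * S" by (simp_all add: S_def)
        have x: "exp (- quad w \<xi> / 2) * exp (- quad w' \<xi> / 2) = exp (- u * (norm \<xi>)\<^sup>2) * exp (- quad w \<xi>)"
          unfolding w'_def quad_add_const exp_add[symmetric]
          by (rule arg_cong[where f=exp]) (simp add: field_simps)
        have "G \<xi> * of_real (sqrt (2 * pi) ^ ?d * ((\<xi> \<bullet> e) ^ 4 * exp (- quad w' \<xi> / 2))) / of_real ((2 * pi) ^ ?d)
          = of_real ((1 + (norm \<xi>)\<^sup>2) powr (s / 2)) * conv_mult \<gamma> k \<xi> * of_real ((\<xi> \<bullet> e) ^ 4) *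
             of_real (exp (- quad w \<xi> / 2) * exp (- quad w' \<xi> / 2)) * of_real (S * S) / of_real (S * S)"
          unfolding G_eq S_def[symmetric] S(2) by (simp only: of_real_mult mult_ac)
        also have "\<dots> = of_real ((1 + (norm \<xi>)\<^sup>2) powr (s / 2)) * conv_mult \<gamma> k \<xi> * of_real ((\<xi> \<bullet> e) ^ 4) *
             of_real (exp (- quad w \<xi> / 2) * exp (- quad w' \<xi> / 2))"
          using S(1) by (intro nonzero_mult_div_cancel_right) simp
        also have "\<dots> = j \<xi>"
          unfolding x j_def by (simp only: of_real_mult mult_ac)
        finally show "G \<xi> * of_real (sqrt (2 * pi) ^ ?d * ((\<xi> \<bullet> e) ^ 4 * exp (- quad w' \<xi> / 2))) / of_real ((2 * pi) ^ ?d)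
          = j \<xi>" .
      qed
      finally show ?thesis .
    qed
    ultimately have main: "norm (LINT \<xi>|lborel. j \<xi>) \<le> C' * D * D'" by simp
    have "heat_pairing (conv_mult \<gamma> k) s e w u = 
       of_real (exp (- u)) * (LINT \<xi>|lborel. j \<xi>)"
      unfolding heat_pairing_def j_def integral_mult_right_zero[symmetric] distrib_left mult_1_right exp_add
      by (simp only: of_real_mult mult_ac)
    then have "norm (heat_pairing (conv_mult \<gamma> k) s e w u) \<le> exp (- u) * (C' * D * D')"
      using main by (simp only: norm_mult norm_of_real) simp
    also have "exp (- u) * (C' * D * D') = A * W powr ((1 / p - 1 / q - 1) / 2) * exp (- u) / (w e + 2 * u)\<^sup>2"
    proof -
      have "(1 / p - 1 / q - 1) / 2 = (1 / p - 1) / 2 + (1 / r - 1) / 2" 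
      proof -
        have "(a - b - 1) / 2 = (a - 1) / 2 + ((1 - b) - 1) / 2" for a b :: real by (simp add: field_simps)
        then show ?thesis unfolding r(3) by blast
      qed
      then have "W powr ((1 / p - 1 / q - 1) / 2) = W powr ((1 / p - 1) / 2) * W powr ((1 / r - 1) / 2)"
        by (simp only: powr_add)
      then show ?thesis unfolding A_def D_def D'_def \<kappa>_def w'_def by simp
    qed
    finally show "norm (heat_pairing (conv_mult \<gamma> k) s e w u)
       \<le> A * (\<Prod>b\<in>Basis. w b) powr ((1 / p - 1 / q - 1) / 2) * exp (- u) / (w e + 2 * u)\<^sup>2"
      unfolding W_def .
  qed
qed

section \<open>Removing the Bessel weight\<close>

definition gamma_density :: "real \<Rightarrow> real \<Rightarrow> real" where
  "gamma_density a u = (if u > 0 then u powr (a - 1) * exp (- u) else 0)"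

lemma gamma_density_measurable [measurable]: "gamma_density a \<in> borel_measurable borel"
  unfolding gamma_density_def by measurable

lemma gamma_density_nonneg: "gamma_density a u \<ge> 0"
  by (simp add: gamma_density_def)

lemma has_bochner_integral_gamma_density:
  assumes a: "a > 0"
  shows "has_bochner_integral lborel (gamma_density a) (Gamma a)"
proof (rule has_bochner_integral_nn_integral)
  have "((\<lambda>t. if t \<in> {0..} then t powr (a - 1) / exp t else 0) has_integral Gamma a) UNIV"
    using Gamma_integral_real[OF a] by (simp only: has_integral_restrict_UNIV)
  then have "(gamma_density a has_integral Gamma a) UNIV"
    by (rule has_integral_eq[rotated]) (auto simp: gamma_density_def exp_minus divide_inverse)
  then show "(\<integral>\<^sup>+u. ennreal (gamma_density a u) \<partial>lborel) = ennreal (Gamma a)"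
    by (intro nn_integral_has_integral_lborel gamma_density_nonneg) auto
qed (use a in \<open>auto simp: gamma_density_nonneg Gamma_real_pos less_imp_le\<close>)

lemma
  assumes a: "a > 0" and l: "l > 0"
  shows integrable_gamma_density_scaled: "integrable lborel (\<lambda>u. l * gamma_density a (u * l))"
    and integral_gamma_density_scaled: "(LINT u|lborel. l * gamma_density a (u * l)) = Gamma a"
proof -
  have i: "integrable lborel (gamma_density a)" "(LINT u|lborel. gamma_density a u) = Gamma a"
    using has_bochner_integral_gamma_density[OF a] by (auto simp: has_bochner_integral_iff)
  have eq: "u * l = u / (1 / l)" for u by simp
  show "integrable lborel (\<lambda>u. l * gamma_density a (u * l))"
    unfolding eq using l by (intro integrable_mult_right lborel_rescale i) auto
  show "(LINT u|lborel. l * gamma_density a (u * l)) = Gamma a"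
    unfolding eq using l by (simp add: lborel_rescale(2)[OF i(1), of "1 / l"] i(2) del: divide_divide_eq_right)
qed

lemma gamma_density_scaled:
  "l > 0 \<Longrightarrow> l * gamma_density a (u * l) = (if u > 0 then u powr (a - 1) * (l powr a * exp (- u * l)) else 0)"
  by (auto simp: gamma_density_def powr_mult zero_less_mult_iff powr_diff)

text \<open>Since \<open>\<integral> u\<^bsup>a-1\<^esup> l\<^sup>a e\<^bsup>-ul\<^esup> du = \<Gamma>(a)\<close> for every \<open>l > 0\<close>, integrating the hypothesis against \<open>u\<^bsup>a-1\<^esup>\<close>
replaces the weight \<open>l\<^sup>a e\<^bsup>-ul\<^esup>\<close>, where \<open>l = 1 + \<bar>\<xi>\<bar>\<^sup>2\<close>, by a constant. On the right-hand side the
factor \<open>u\<^bsup>-\<kappa>\<^esup>\<close> is harmless at \<open>u = 0\<close> because \<open>\<kappa> < a\<close>.\<close>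

lemma mellin_bound:
  fixes H :: "'a::euclidean_space \<Rightarrow> complex"
  assumes H: "integrable lborel H" and \<kappa>: "\<kappa> < a" and a: "a > 0" and Y: "Y \<ge> 0"
    and bound: "\<And>u. u > 0 \<Longrightarrow> norm (LINT \<xi>|lborel. of_real ((1 + (norm \<xi>)\<^sup>2) powr a * exp (- u * (1 + (norm \<xi>)\<^sup>2))) * H \<xi>)
         \<le> Y * exp (- u) * u powr (- \<kappa>)"
  shows "norm (LINT \<xi>|lborel. H \<xi>) \<le> Y * Gamma (a - \<kappa>) / Gamma a"
proof -
  have [measurable]: "H \<in> borel_measurable borel" using H by auto
  let ?l = "\<lambda>\<xi>::'a. 1 + (norm \<xi>)\<^sup>2"
  have l: "?l \<xi> > 0" for \<xi> by (simp add: add_pos_nonneg)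
  let ?F = "\<lambda>\<xi> u. complex_of_real (?l \<xi> * gamma_density a (u * ?l \<xi>)) * H \<xi>"
  have Fu: "(LINT u|lborel. ?F \<xi> u) = of_real (Gamma a) * H \<xi>" for \<xi>
    by (simp only: integral_mult_left_zero integral_complex_of_real integral_gamma_density_scaled[OF a l])
  have int: "integrable (lborel \<Otimes>\<^sub>M lborel) (case_prod ?F)"
  proof (rule lborel_pair.Fubini_integrable)
    have "norm (?F \<xi> u) = (?l \<xi> * gamma_density a (u * ?l \<xi>)) * norm (H \<xi>)" for \<xi> u
      unfolding norm_mult norm_of_real
      using gamma_density_nonneg[of a "u * ?l \<xi>"] l[of \<xi>] by (simp add: abs_mult)
    then have "(LINT u|lborel. norm (?F \<xi> u)) = Gamma a * norm (H \<xi>)" for \<xi>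
      by (simp only: integral_mult_left_zero integral_gamma_density_scaled[OF a l])
    then show "integrable lborel (\<lambda>\<xi>. LINT u|lborel. norm (case (\<xi>, u) of (\<xi>, u) \<Rightarrow> ?F \<xi> u))"
      using integrable_mult_right[OF integrable_norm[OF H]] by simp
    have "integrable lborel (?F \<xi>)" for \<xi>
      by (intro integrable_mult_left integrable_of_real integrable_gamma_density_scaled a l)
    then show "AE \<xi> in lborel. integrable lborel (\<lambda>u. case (\<xi>, u) of (\<xi>, u) \<Rightarrow> ?F \<xi> u)" by simp
  qed measurable
  have gk: "integrable lborel (gamma_density (a - \<kappa>))" "(LINT u|lborel. gamma_density (a - \<kappa>) u) = Gamma (a - \<kappa>)"
    using has_bochner_integral_gamma_density[of "a - \<kappa>"] \<kappa> by (auto simp: has_bochner_integral_iff)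
  have "of_real (Gamma a) * (LINT \<xi>|lborel. H \<xi>) = (LINT \<xi>|lborel. (LINT u|lborel. ?F \<xi> u))"
    unfolding Fu by simp
  also have "\<dots> = (LINT u|lborel. (LINT \<xi>|lborel. ?F \<xi> u))"
    by (rule lborel_pair.Fubini_integral[OF int, symmetric])
  finally have eq: "of_real (Gamma a) * (LINT \<xi>|lborel. H \<xi>) = (LINT u|lborel. (LINT \<xi>|lborel. ?F \<xi> u))" .
  have pt: "norm (LINT \<xi>|lborel. ?F \<xi> u) \<le> Y * gamma_density (a - \<kappa>) u" for u
  proof (cases "u > 0")
    case True
    have "?F \<xi> u = of_real (u powr (a - 1)) * (of_real (?l \<xi> powr a * exp (- u * ?l \<xi>)) * H \<xi>)" for \<xi>
      unfolding gamma_density_scaled[OF l] using True by (simp only: if_True of_real_mult mult.assoc)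
    then have "norm (LINT \<xi>|lborel. ?F \<xi> u) = u powr (a - 1) * norm (LINT \<xi>|lborel. of_real (?l \<xi> powr a * exp (- u * ?l \<xi>)) * H \<xi>)"
      by (simp only: integral_mult_right_zero norm_mult norm_of_real) simp
    also have "\<dots> \<le> u powr (a - 1) * (Y * exp (- u) * u powr (- \<kappa>))"
      by (intro mult_left_mono bound True) auto
    also have "\<dots> = Y * gamma_density (a - \<kappa>) u"
      using True by (simp add: gamma_density_def mult_ac flip: powr_add) (simp add: algebra_simps)
    finally show ?thesis .
  next
    case False
    then show ?thesis unfolding gamma_density_scaled[OF l] by (simp add: gamma_density_def)
  qed
  have Gpos: "Gamma a > 0" using a by (rule Gamma_real_pos)
  have "Gamma a * norm (LINT \<xi>|lborel. H \<xi>) = norm (of_real (Gamma a) * (LINT \<xi>|lborel. H \<xi>))"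
    unfolding norm_mult norm_of_real using Gpos by simp
  also have "\<dots> = norm (LINT u|lborel. (LINT \<xi>|lborel. ?F \<xi> u))" unfolding eq ..
  also have "\<dots> \<le> (LINT u|lborel. norm (LINT \<xi>|lborel. ?F \<xi> u))" by (rule integral_norm_bound)
  also have "\<dots> \<le> (LINT u|lborel. Y * gamma_density (a - \<kappa>) u)"
    using pt gk(1) Y by (intro integral_mono_AE' integrable_mult_right) (auto simp: gamma_density_nonneg)
  also have "\<dots> = Y * Gamma (a - \<kappa>)" using gk(2) by simp
  finally show ?thesis using Gpos by (simp add: field_simps)
qed

lemma pairing_conv_mult:
  fixes \<gamma> :: "'t::euclidean_space \<Rightarrow> 'a::euclidean_space"
  assumes [measurable]: "\<gamma> \<in> borel_measurable borel" and k: "integrable lborel k" and g: "integrable lborel g"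
  shows "(LINT \<xi>|lborel. conv_mult \<gamma> k \<xi> * of_real (g \<xi>)) = 
    (LINT t|lborel. of_real (k t) * (LINT \<xi>|lborel. iexp (\<xi> \<bullet> (- \<gamma> t)) * of_real (g \<xi>)))"
proof -
  let ?F = "\<lambda>\<xi> t. iexp (\<xi> \<bullet> (- \<gamma> t)) * (of_real (g \<xi>) * complex_of_real (k t))"
  have int: "integrable (lborel \<Otimes>\<^sub>M lborel) (case_prod ?F)"
    by (rule integrable_times_lborel_pair) (use k g in auto)
  have "(LINT \<xi>|lborel. conv_mult \<gamma> k \<xi> * of_real (g \<xi>)) = (LINT \<xi>|lborel. (LINT t|lborel. ?F \<xi> t))"
    unfolding conv_mult_def integral_mult_left_zero[symmetric]
    by (simp add: inner_commute mult_ac)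
  also have "\<dots> = (LINT t|lborel. (LINT \<xi>|lborel. ?F \<xi> t))"
    by (rule lborel_pair.Fubini_integral[OF int, symmetric])
  also have "\<dots> = (LINT t|lborel. of_real (k t) * (LINT \<xi>|lborel. iexp (\<xi> \<bullet> (- \<gamma> t)) * of_real (g \<xi>)))"
    unfolding integral_mult_right_zero[symmetric] by (simp only: mult_ac)
  finally show ?thesis .
qed

lemma one_minus_exp_div:
  fixes l :: real
  assumes l: "l > 0" and d: "d > 0"
  shows "(LINT v|lborel. indicator {0..d} v * exp (- v * l)) = (1 - exp (- d * l)) / l"
proof -
  have "((\<lambda>v. exp (- v * l)) has_integral (- exp (- d * l) / l) - (- exp (- 0 * l) / l)) {0..d}"
  proof (rule fundamental_theorem_of_calculus)
    show "((\<lambda>v. - exp (- v * l) / l) has_vector_derivative exp (- v * l)) (at v within {0..d})" for v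
      using l by (auto intro!: derivative_eq_intros simp flip: has_real_derivative_iff_has_vector_derivative)
  qed (use d in auto)
  then have "integral {0..d} (\<lambda>v. exp (- v * l)) = (1 - exp (- d * l)) / l"
    by (simp add: integral_unique diff_divide_distrib)
  moreover have "set_integrable lborel {0..d} (\<lambda>v. exp (- v * l))"
    by (intro borel_integrable_atLeastAtMost' continuous_intros)
  ultimately show ?thesis
    using set_borel_integral_eq_integral(2)[of "{0..d}" "\<lambda>v. exp (- v * l)"]
    by (simp add: set_lebesgue_integral_def)
qed

lemma integrable_indicator_Icc: "integrable lborel (\<lambda>v. complex_of_real (indicator {0..d::real} v))"
proof -
  have "integrable lborel (indicator {0..d} :: real \<Rightarrow> real)"
    by (simp add: integrable_indicator_iff emeasure_lborel_Icc_eq)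
  then show ?thesis by (simp only: complex_of_real_integrable_eq)
qed

lemma integrable_poly_weighted_gauss:
  fixes w :: "'a::euclidean_space \<Rightarrow> real"
  assumes w: "\<And>b. b \<in> Basis \<Longrightarrow> w b > 0" and e: "e \<in> Basis"
  shows "integrable lborel (\<lambda>x::'a. (1 + (norm x)\<^sup>2) powr a * ((x \<bullet> e) ^ 4 * exp (- quad w x)))"
proof (rule Bochner_Integration.integrable_bound[OF integrable_weighted_gauss[of w "a + 2", OF w]])
  show "AE x in lborel. norm ((1 + (norm x)\<^sup>2) powr a * ((x \<bullet> e) ^ 4 * exp (- quad w x)))
     \<le> norm ((1 + (norm x)\<^sup>2) powr (a + 2) * exp (- quad w x))"
  proof (intro AE_I2)
    fix x :: 'a
    have pos: "1 + (norm x)\<^sup>2 > 0" by (simp add: add_pos_nonneg)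
    have "\<bar>x \<bullet> e\<bar> \<le> norm x" using e by (rule Basis_le_norm)
    then have "(x \<bullet> e)\<^sup>2 \<le> (norm x)\<^sup>2" by (metis abs_le_square_iff abs_norm_cancel)
    then have "(x \<bullet> e)\<^sup>2 \<le> 1 + (norm x)\<^sup>2" by simp
    then have "((x \<bullet> e)\<^sup>2)\<^sup>2 \<le> (1 + (norm x)\<^sup>2)\<^sup>2" by (intro power_mono) auto
    then have "(x \<bullet> e) ^ 4 \<le> (1 + (norm x)\<^sup>2) powr 2"
      using pos by (simp add: powr_numeral flip: power_mult)
    then have "(1 + (norm x)\<^sup>2) powr a * ((x \<bullet> e) ^ 4 * exp (- quad w x))
      \<le> (1 + (norm x)\<^sup>2) powr a * ((1 + (norm x)\<^sup>2) powr 2 * exp (- quad w x))"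
      by (intro mult_left_mono mult_right_mono) auto
    then show "norm ((1 + (norm x)\<^sup>2) powr a * ((x \<bullet> e) ^ 4 * exp (- quad w x)))
     \<le> norm ((1 + (norm x)\<^sup>2) powr (a + 2) * exp (- quad w x))"
      by (simp add: powr_add mult.assoc abs_mult)
  qed
qed (use assms in auto)

text \<open>Bounds for \<open>heat_pairing\<close> at the single order \<open>s\<close> are turned into a bound for the pairing without
the weight \<open>(1 + \<bar>\<xi>\<bar>\<^sup>2)\<^bsup>s/2\<^esup>\<close>. As \<open>s\<close> may be negative, the Mellin transform is applied with exponent
\<open>s/2 + 1 > 0\<close> to the difference of the pairings at times \<open>u\<close> and \<open>u + \<delta>\<close>. This leaves the weight
\<open>(1 - e\<^bsup>-\<delta>l\<^esup>) / l = \<integral>\<^sub>0\<^sup>\<delta> e\<^bsup>-vl\<^esup> dv\<close> with \<open>l = 1 + \<bar>\<xi>\<bar>\<^sup>2\<close>, and so an average over \<open>0 \<le> v \<le> \<delta>\<close> of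
pairings that are integrals of \<open>k\<close> against Gaussians along \<open>\<gamma>\<close>. A common lower bound \<open>c\<close> for these
integrals survives the averaging.

The exponent \<open>\<kappa>\<close> says how much of the decay \<open>1 / (w e + 2u)\<^sup>2\<close> is spent on convergence at \<open>u = 0\<close>; the
rest gives the power of \<open>w e\<close>.\<close>

lemma pairing_lower_bound_le:
  fixes \<gamma> :: "'t::euclidean_space \<Rightarrow> 'a::euclidean_space"
  assumes \<gamma>[measurable]: "\<gamma> \<in> borel_measurable borel" and k: "integrable lborel k"
    and bdd: "bounded_Lp_Sobolev (conv_op \<gamma> k) p q s"
    and p: "p > 1" and q: "q > 1" and e: "e \<in> Basis"
    and s: "s > -2" and \<kappa>: "0 \<le> \<kappa>" "\<kappa> \<le> 2" "\<kappa> < s / 2 + 1"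
  obtains A where "A \<ge> 0"
    "\<And>w \<delta> c. (\<And>b. b \<in> Basis \<Longrightarrow> w b > 0) \<Longrightarrow> 0 < \<delta> \<Longrightarrow> \<delta> \<le> 1 \<Longrightarrow> 0 \<le> c \<Longrightarrow>
       (\<And>v. 0 \<le> v \<Longrightarrow> v \<le> \<delta> \<Longrightarrow> c \<le> (LINT t|lborel. k t * wave e (\<lambda>b. 2 * (w b + v)) (\<gamma> t))) \<Longrightarrow>
       c * \<delta> \<le> A * (\<Prod>b\<in>Basis. w b) powr ((1 / p - 1 / q - 1) / 2) * w e powr (\<kappa> - 2)"
proof -
  have km[measurable]: "k \<in> borel_measurable borel" using k by auto
  define a where "a = s / 2 + 1"
  have a: "a > 0" "\<kappa> < a" "s / 2 = a - 1" using s \<kappa> by (auto simp: a_def)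
  obtain A0 where A0: "A0 \<ge> 0"
    "\<And>w u. (\<And>b. b \<in> Basis \<Longrightarrow> w b > 0) \<Longrightarrow> u \<ge> 0 \<Longrightarrow>
       norm (heat_pairing (conv_mult \<gamma> k) s e w u)
       \<le> A0 * (\<Prod>b\<in>Basis. w b) powr ((1 / p - 1 / q - 1) / 2) * exp (- u) / (w e + 2 * u)\<^sup>2"
    using heat_pairing_bound[OF \<gamma> k bdd p q e] by blast
  define A where "A = exp 1 * (2 * A0 * Gamma (a - \<kappa>) / Gamma a)"
  show ?thesis
  proof (rule that[of A])
    have "Gamma (a - \<kappa>) > 0" "Gamma a > 0" using a by (auto intro!: Gamma_real_pos)
    then show "A \<ge> 0" using A0(1) by (auto simp: A_def)
    fix w :: "'a \<Rightarrow> real" and \<delta> c :: real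
    assume w: "\<And>b. b \<in> Basis \<Longrightarrow> w b > 0" and \<delta>: "0 < \<delta>" "\<delta> \<le> 1" and c: "0 \<le> c"
      and low: "\<And>v. 0 \<le> v \<Longrightarrow> v \<le> \<delta> \<Longrightarrow> c \<le> (LINT t|lborel. k t * wave e (\<lambda>b. 2 * (w b + v)) (\<gamma> t))"
    let ?l = "\<lambda>\<xi>::'a. 1 + (norm \<xi>)\<^sup>2"
    have l: "?l \<xi> > 0" "?l \<xi> \<ge> 1" for \<xi> by (simp_all add: add_pos_nonneg)
    define W where "W = (\<Prod>b\<in>Basis. w b) powr ((1 / p - 1 / q - 1) / 2)"
    have W: "W \<ge> 0" by (simp add: W_def)
    define M where "M = (LINT t|lborel. \<bar>k t\<bar>)"
    have M: "norm (conv_mult \<gamma> k \<xi>) \<le> M" for \<xi> unfolding M_def by (rule norm_conv_mult_le[OF k])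
    define h where "h = (\<lambda>\<xi>. of_real ((\<xi> \<bullet> e) ^ 4 * exp (- quad w \<xi>)) * conv_mult \<gamma> k \<xi>)"
    have hm[measurable]: "h \<in> borel_measurable borel" unfolding h_def by measurable
    have hi: "integrable lborel (\<lambda>\<xi>. of_real (?l \<xi> powr t) * h \<xi>)" for t
    proof (rule Bochner_Integration.integrable_bound)
      show "integrable lborel (\<lambda>\<xi>. M * (?l \<xi> powr t * ((\<xi> \<bullet> e) ^ 4 * exp (- quad w \<xi>))))"
        by (intro integrable_mult_right integrable_poly_weighted_gauss w e)
      show "AE \<xi> in lborel. norm (of_real (?l \<xi> powr t) * h \<xi>) \<le> norm (M * (?l \<xi> powr t * ((\<xi> \<bullet> e) ^ 4 * exp (- quad w \<xi>))))"
      proof (intro AE_I2)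
        fix \<xi>
        have "norm (of_real (?l \<xi> powr t) * h \<xi>) = (?l \<xi> powr t * ((\<xi> \<bullet> e) ^ 4 * exp (- quad w \<xi>))) * norm (conv_mult \<gamma> k \<xi>)"
          unfolding h_def norm_mult norm_of_real by simp
        also have "\<dots> \<le> (?l \<xi> powr t * ((\<xi> \<bullet> e) ^ 4 * exp (- quad w \<xi>))) * M"
          by (intro mult_left_mono M) simp
        also have "\<dots> \<le> norm (M * (?l \<xi> powr t * ((\<xi> \<bullet> e) ^ 4 * exp (- quad w \<xi>))))" by (simp add: mult.commute)
        finally show "norm (of_real (?l \<xi> powr t) * h \<xi>) \<le> norm (M * (?l \<xi> powr t * ((\<xi> \<bullet> e) ^ 4 * exp (- quad w \<xi>))))" .
      qed
    qed measurable
    have h0: "integrable lborel h" using hi[of 0] l(1) by (simp add: less_imp_neq[symmetric])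
    define H where "H = (\<lambda>\<xi>. of_real ((1 - exp (- \<delta> * ?l \<xi>)) / ?l \<xi>) * h \<xi>)"
    have Hm[measurable]: "H \<in> borel_measurable borel" unfolding H_def by measurable
    have Hi: "integrable lborel H"
    proof (rule Bochner_Integration.integrable_bound[OF h0])
      show "AE \<xi> in lborel. norm (H \<xi>) \<le> norm (h \<xi>)"
      proof (intro AE_I2)
        fix \<xi>
        define z where "z = (1 - exp (- \<delta> * ?l \<xi>)) / ?l \<xi>"
        have "0 \<le> z" unfolding z_def using l(1)[of \<xi>] \<delta> by simp
        moreover have "z \<le> 1 / 1" unfolding z_def using l[of \<xi>] by (intro frac_le) (auto simp del: div_by_1)
        ultimately show "norm (H \<xi>) \<le> norm (h \<xi>)"
          unfolding H_def norm_mult norm_of_real z_def[symmetric] by (intro mult_left_le_one_le) auto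
      qed
    qed measurable
    define I where "I = (\<lambda>u. LINT \<xi>|lborel. of_real (?l \<xi> powr (s / 2) * exp (- u * ?l \<xi>)) * h \<xi>)"
    define Y where "Y = 2 * A0 * W * w e powr (\<kappa> - 2)"
    have Y: "Y \<ge> 0" using A0(1) W by (simp add: Y_def)
    have Iint: "integrable lborel (\<lambda>\<xi>. of_real (?l \<xi> powr (s / 2) * exp (- u * ?l \<xi>)) * h \<xi>)" if "u \<ge> 0" for u
    proof (rule Bochner_Integration.integrable_bound[OF hi[of "s / 2"]])
      show "AE \<xi> in lborel. norm (of_real (?l \<xi> powr (s / 2) * exp (- u * ?l \<xi>)) * h \<xi>) \<le> norm (of_real (?l \<xi> powr (s / 2)) * h \<xi>)"
      proof (intro AE_I2)
        fix \<xi>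
        have "exp (- u * ?l \<xi>) \<le> 1" using that l(1)[of \<xi>] by simp
        then have "?l \<xi> powr (s / 2) * exp (- u * ?l \<xi>) \<le> ?l \<xi> powr (s / 2)" by (intro mult_left_le) auto
        then show "norm (of_real (?l \<xi> powr (s / 2) * exp (- u * ?l \<xi>)) * h \<xi>) \<le> norm (of_real (?l \<xi> powr (s / 2)) * h \<xi>)"
          unfolding norm_mult[of _ "h \<xi>"] norm_of_real by (intro mult_right_mono) auto
      qed
    qed measurable
    have Ib: "norm (I u) \<le> A0 * W * exp (- u) / (w e + 2 * u)\<^sup>2" if "u \<ge> 0" for u
      using A0(2)[of w u] w that unfolding heat_pairing_def I_def h_def W_def by (simp only: of_real_mult mult.assoc)
    have bound: "norm (LINT \<xi>|lborel. of_real (?l \<xi> powr a * exp (- u * ?l \<xi>)) * H \<xi>) \<le> Y * exp (- u) * u powr (- \<kappa>)" if u: "u > 0" for u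
    proof -
      have we: "w e > 0" using w e by blast
      have pt: "of_real (?l \<xi> powr a * exp (- u * ?l \<xi>)) * H \<xi> =
          of_real (?l \<xi> powr (s / 2) * exp (- u * ?l \<xi>)) * h \<xi> - of_real (?l \<xi> powr (s / 2) * exp (- (u + \<delta>) * ?l \<xi>)) * h \<xi>" for \<xi>
      proof -
        have "?l \<xi> powr a = ?l \<xi> powr (s / 2) * ?l \<xi>"
          unfolding a(3) using l(1)[of \<xi>] by (simp add: powr_diff)
        then have "?l \<xi> powr a * exp (- u * ?l \<xi>) * ((1 - exp (- \<delta> * ?l \<xi>)) / ?l \<xi>) = 
          ?l \<xi> powr (s / 2) * exp (- u * ?l \<xi>) - ?l \<xi> powr (s / 2) * (exp (- u * ?l \<xi>) * exp (- \<delta> * ?l \<xi>))"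
          using l(1)[of \<xi>] by (simp add: field_simps)
        also have "exp (- u * ?l \<xi>) * exp (- \<delta> * ?l \<xi>) = exp (- (u + \<delta>) * ?l \<xi>)"
          unfolding exp_add[symmetric] by (rule arg_cong[where f=exp]) (simp add: algebra_simps)
        finally show ?thesis
          unfolding H_def mult.assoc[symmetric] of_real_mult[symmetric] 
          by (simp only: of_real_diff left_diff_distrib)
      qed
      have "(LINT \<xi>|lborel. of_real (?l \<xi> powr a * exp (- u * ?l \<xi>)) * H \<xi>) = I u - I (u + \<delta>)"
        unfolding pt I_def using u \<delta> by (intro Bochner_Integration.integral_diff Iint) auto
      then have "norm (LINT \<xi>|lborel. of_real (?l \<xi> powr a * exp (- u * ?l \<xi>)) * H \<xi>) \<le> norm (I u) + norm (I (u + \<delta>))"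
        by (simp only: norm_triangle_ineq4)
      also have "\<dots> \<le> A0 * W * exp (- u) / (w e + 2 * u)\<^sup>2 + A0 * W * exp (- (u + \<delta>)) / (w e + 2 * (u + \<delta>))\<^sup>2"
        using u \<delta> by (intro add_mono Ib) auto
      also have "A0 * W * exp (- (u + \<delta>)) / (w e + 2 * (u + \<delta>))\<^sup>2 \<le> A0 * W * exp (- u) / (w e + 2 * u)\<^sup>2"
        using A0(1) W u \<delta> we by (intro frac_le mult_left_mono mult_nonneg_nonneg power_mono) auto
      also have "A0 * W * exp (- u) / (w e + 2 * u)\<^sup>2 + A0 * W * exp (- u) / (w e + 2 * u)\<^sup>2 
          = 2 * (A0 * W * exp (- u)) * (w e + 2 * u) powr (-2)"
        using u we by (simp add: powr_minus powr_numeral divide_inverse)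
      also have "\<dots> \<le> 2 * (A0 * W * exp (- u)) * (w e powr (\<kappa> - 2) * u powr (- \<kappa>))"
      proof (intro mult_left_mono)
        have "(w e + 2 * u) powr (-2) = (w e + 2 * u) powr (\<kappa> - 2) * (w e + 2 * u) powr (- \<kappa>)"
          by (simp flip: powr_add)
        also have "\<dots> \<le> w e powr (\<kappa> - 2) * u powr (- \<kappa>)"
          using u we \<kappa> by (intro mult_mono powr_mono2') auto
        finally show "(w e + 2 * u) powr (-2) \<le> w e powr (\<kappa> - 2) * u powr (- \<kappa>)" .
      qed (use A0(1) W in auto)
      also have "\<dots> = Y * exp (- u) * u powr (- \<kappa>)" unfolding Y_def by (simp only: mult_ac)
      finally show ?thesis by simp
    qed
    have up: "norm (LINT \<xi>|lborel. H \<xi>) \<le> Y * Gamma (a - \<kappa>) / Gamma a"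
      by (rule mellin_bound[OF Hi a(2,1) Y bound])
    \<comment> \<open>The weight \<open>(1 - e\<^bsup>-\<delta>l\<^esup>) / l\<close> written as an integral over \<open>v\<close>. The cutoff \<open>v \<ge> 0\<close> keeps the
      kernel bounded by \<open>1\<close>, as the lemma on products requires.\<close>
    let ?E = "\<lambda>\<xi> v. complex_of_real (if v \<ge> 0 then exp (- v * ?l \<xi>) else 0)"
    let ?F = "\<lambda>\<xi> v. ?E \<xi> v * (h \<xi> * of_real (indicator {0..\<delta>} v))"
    have int: "integrable (lborel \<Otimes>\<^sub>M lborel) (case_prod ?F)"
    proof (rule integrable_times_lborel_pair[OF h0 integrable_indicator_Icc])
      show "norm (?E \<xi> v) \<le> 1" for \<xi> v using l(1)[of \<xi>] by simp
    qed measurable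
    have "(LINT v|lborel. ?F \<xi> v) = H \<xi>" for \<xi>
    proof -
      have "?F \<xi> v = of_real (indicator {0..\<delta>} v * exp (- v * ?l \<xi>)) * h \<xi>" for v
        by (simp add: indicator_def)
      then show ?thesis
        unfolding H_def by (simp only: integral_mult_left_zero integral_complex_of_real one_minus_exp_div[OF l(1) \<delta>(1)])
    qed
    then have "(LINT \<xi>|lborel. H \<xi>) = (LINT v|lborel. (LINT \<xi>|lborel. ?F \<xi> v))"
      using lborel_pair.Fubini_integral[OF int] by simp
    moreover define \<Phi> where "\<Phi> = (\<lambda>v. LINT \<xi>|lborel. ?F \<xi> v)"
    ultimately have HPhi: "(LINT \<xi>|lborel. H \<xi>) = (LINT v|lborel. \<Phi> v)" by simp
    have Phi_int: "integrable lborel \<Phi>" unfolding \<Phi>_def by (rule lborel_pair.integrable_snd[OF int])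
    have Phi_low: "Re (\<Phi> v) \<ge> indicator {0..\<delta>} v * (exp (-1) * c)" for v
    proof (cases "v \<in> {0..\<delta>}")
      case True
      define w' where "w' = (\<lambda>b. 2 * (w b + v))"
      have w': "w' b > 0" if "b \<in> Basis" for b using w[OF that] True by (simp add: w'_def)
      let ?g = "\<lambda>\<xi>. (\<xi> \<bullet> e) ^ 4 * exp (- quad w' \<xi> / 2)"
      have gi: "integrable lborel ?g"
      proof -
        have "integrable lborel (\<lambda>\<xi>. complex_of_real (?g \<xi>))"
          using integrable_inv_fourier_wave[OF w' e, where \<xi>=0] by simp
        then show ?thesis by (simp only: complex_of_real_integrable_eq)
      qed
      have gf: "(LINT \<xi>|lborel. iexp (\<xi> \<bullet> x) * of_real (?g \<xi>)) = of_real (sqrt (2 * pi) ^ DIM('a) * wave e w' x)" for x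
        by (rule inv_fourier_wave) (use w' e in auto)
      have "?F \<xi> v = of_real (exp (- v)) * (conv_mult \<gamma> k \<xi> * of_real (?g \<xi>))" for \<xi>
      proof -
        have "exp (- v * ?l \<xi>) * exp (- quad w \<xi>) = exp (- v) * exp (- quad w' \<xi> / 2)"
          unfolding w'_def quad_scale quad_add_const exp_add[symmetric]
          by (rule arg_cong[where f=exp]) (simp add: algebra_simps)
        then have "?F \<xi> v = conv_mult \<gamma> k \<xi> * of_real ((\<xi> \<bullet> e) ^ 4 * (exp (- v) * exp (- quad w' \<xi> / 2)))"
          using True unfolding h_def by (simp add: mult_ac flip: of_real_mult)
        then show ?thesis by (simp only: of_real_mult mult_ac)
      qed
      then have "\<Phi> v = of_real (exp (- v)) * (LINT \<xi>|lborel. conv_mult \<gamma> k \<xi> * of_real (?g \<xi>))"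
        unfolding \<Phi>_def by (simp only: integral_mult_right_zero)
      also have "(LINT \<xi>|lborel. conv_mult \<gamma> k \<xi> * of_real (?g \<xi>)) = 
          (LINT t|lborel. of_real (sqrt (2 * pi) ^ DIM('a) * (k t * wave e w' (\<gamma> t))))"
        unfolding pairing_conv_mult[OF \<gamma> k gi] gf wave_uminus by (simp only: of_real_mult mult_ac)
      also have "\<dots> = of_real (sqrt (2 * pi) ^ DIM('a) * (LINT t|lborel. k t * wave e w' (\<gamma> t)))"
        by (simp only: integral_complex_of_real integral_mult_right_zero)
      finally have "Re (\<Phi> v) = exp (- v) * (sqrt (2 * pi) ^ DIM('a) * (LINT t|lborel. k t * wave e w' (\<gamma> t)))"
        by (simp only: of_real_mult[symmetric] Re_complex_of_real)
      moreover have "exp (-1) * (1 * c) \<le> exp (- v) * (sqrt (2 * pi) ^ DIM('a) * (LINT t|lborel. k t * wave e w' (\<gamma> t)))"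
      proof (intro mult_mono)
        have "1 \<le> sqrt (2 * pi)" using pi_gt3 by simp
        then show "1 \<le> sqrt (2 * pi) ^ DIM('a)" by (rule one_le_power)
        show "c \<le> (LINT t|lborel. k t * wave e w' (\<gamma> t))"
          using low[of v] True unfolding w'_def by simp
      qed (use True \<delta> c in auto)
      ultimately show ?thesis using True by simp
    next
      case False
      then show ?thesis by (simp add: \<Phi>_def)
    qed
    have "(LINT v|lborel. indicator {0..\<delta>} v * (exp (-1) * c)) \<le> (LINT v|lborel. Re (\<Phi> v))"
      using Phi_low by (intro integral_mono integrable_mult_left integrable_Re Phi_int) (auto simp: integrable_indicator_iff emeasure_lborel_Icc_eq)
    also have "(LINT v|lborel. indicator {0..\<delta>} v * (exp (-1) * c)) = \<delta> * (exp (-1) * c)"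
      using \<delta> by simp
    also have "(LINT v|lborel. Re (\<Phi> v)) = Re (LINT \<xi>|lborel. H \<xi>)"
      unfolding HPhi using integral_Re[OF Phi_int] by simp
    also have "\<dots> \<le> norm (LINT \<xi>|lborel. H \<xi>)" by (rule complex_Re_le_cmod)
    also note up
    finally have "exp 1 * (\<delta> * (exp (-1) * c)) \<le> exp 1 * (Y * Gamma (a - \<kappa>) / Gamma a)"
      by (intro mult_left_mono) auto
    also have "exp 1 * (\<delta> * (exp (-1) * c)) = (exp 1 * exp (-1)) * (c * \<delta>)" by (simp only: mult_ac)
    also have "exp 1 * exp (-1) = (1::real)" unfolding exp_add[symmetric] by simp
    finally show "c * \<delta> \<le> A * (\<Prod>b\<in>Basis. w b) powr ((1 / p - 1 / q - 1) / 2) * w e powr (\<kappa> - 2)"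
      unfolding A_def Y_def W_def by (simp add: mult_ac)
  qed
qed

section \<open>Power series in several variables\<close>

definition mi_size :: "('n::finite \<Rightarrow> nat) \<Rightarrow> nat" where
  "mi_size \<alpha> = (\<Sum>i\<in>UNIV. \<alpha> i)"

lemma has_sum_diff_real:
  fixes f g :: "'a \<Rightarrow> real"
  assumes "(f has_sum a) A" "(g has_sum b) A"
  shows "((\<lambda>x. f x - g x) has_sum (a - b)) A"
  using has_sum_add[OF assms(1), of "\<lambda>x. - g x" "- b"] assms(2) by (simp add: has_sum_uminus)

lemma powser_zero_imp_coeff_zero:
  fixes a :: "nat \<Rightarrow> real"
  assumes r: "r > 0" and sums: "\<And>x. \<bar>x\<bar> < r \<Longrightarrow> (\<lambda>n. a n * x ^ n) sums 0"
  shows "a n = 0"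
proof (induction n rule: less_induct)
  case (less n)
  have "(\<lambda>k. a (k + n) * x ^ k) sums 0" if x: "x \<noteq> 0" "\<bar>x\<bar> < r" for x
  proof -
    have "(\<lambda>k. a (k + n) * x ^ (k + n)) sums (0 - (\<Sum>i<n. a i * x ^ i))"
      using sums_split_initial_segment[OF sums[OF x(2)], of n] .
    also have "(\<Sum>i<n. a i * x ^ i) = 0" using less by (intro sum.neutral) auto
    finally have "(\<lambda>k. a (k + n) * x ^ (k + n) / x ^ n) sums (0 / x ^ n)"
      by (intro sums_divide) simp
    then show ?thesis using x by (simp add: power_add)
  qed
  then have "((\<lambda>_. 0) \<longlongrightarrow> a (0 + n)) (at (0::real))"
    using r by (intro powser_limit_0_strong[where a="\<lambda>k. a (k + n)" and s=r]) auto
  then show ?case using LIM_unique[of "\<lambda>_. 0" "a n" 0 0] by (simp add: tendsto_const_iff)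
qed

lemma abs_multi_power_le:
  assumes "\<And>i. \<bar>t $ i\<bar> \<le> \<rho>"
  shows "\<bar>multi_power t \<alpha>\<bar> \<le> \<rho> ^ mi_size \<alpha>"
proof -
  have "\<bar>multi_power t \<alpha>\<bar> \<le> (\<Prod>i\<in>UNIV. \<rho> ^ \<alpha> i)"
    unfolding multi_power_def abs_prod using assms by (intro prod_mono) (auto simp: power_abs intro: power_mono)
  then show ?thesis by (simp add: mi_size_def power_sum)
qed

text \<open>Evaluating the series at the corner of a cube inside the ball of convergence gives a summable
majorant for the whole cube, in the maximum norm that suits monomials.\<close>

lemma has_power_series_at_polydisc:
  fixes f :: "real ^ 'n \<Rightarrow> real"
  assumes "has_power_series_at f u c"
  obtains \<rho> where "\<rho> > 0" "\<rho> \<le> 1" "(\<lambda>\<alpha>. \<bar>c \<alpha>\<bar> * \<rho> ^ mi_size \<alpha>) summable_on UNIV"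
    "\<And>t. (\<And>i. \<bar>t $ i - u $ i\<bar> \<le> \<rho>) \<Longrightarrow> ((\<lambda>\<alpha>. c \<alpha> * multi_power (t - u) \<alpha>) has_sum f t) UNIV"
proof -
  obtain r where r: "r > 0" "\<And>t. t \<in> ball u r \<Longrightarrow> ((\<lambda>\<alpha>. c \<alpha> * multi_power (t - u) \<alpha>) has_sum f t) UNIV"
    using assms unfolding has_power_series_at_def by blast
  define \<rho> where "\<rho> = min 1 (r / (2 * real CARD('n)))"
  have \<rho>: "\<rho> > 0" "\<rho> \<le> 1" using r by (auto simp: \<rho>_def)
  have ball: "t \<in> ball u r" if "\<And>i. \<bar>t $ i - u $ i\<bar> \<le> \<rho>" for t
  proof -
    have "norm (t - u) \<le> (\<Sum>i\<in>UNIV. \<bar>(t - u) $ i\<bar>)" by (rule norm_le_l1_cart)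
    also have "\<dots> \<le> (\<Sum>i\<in>(UNIV::'n set). \<rho>)" using that by (intro sum_mono) auto
    also have "\<dots> = real CARD('n) * \<rho>" by simp
    also have "\<dots> \<le> real CARD('n) * (r / (2 * real CARD('n)))"
      unfolding \<rho>_def by (intro mult_left_mono) auto
    also have "\<dots> < r" using r by simp
    finally show ?thesis by (simp add: dist_norm norm_minus_commute)
  qed
  show ?thesis
  proof (rule that[OF \<rho>])
    let ?t = "u + (\<chi> i. \<rho>)"
    have "(\<lambda>\<alpha>. c \<alpha> * multi_power (?t - u) \<alpha>) summable_on UNIV"
      using r(2)[OF ball[of ?t]] \<rho> by (auto simp: summable_on_def)
    then have "(\<lambda>\<alpha>. norm (c \<alpha> * multi_power (?t - u) \<alpha>)) summable_on UNIV"
      by (rule summable_on_iff_abs_summable_on_real[THEN iffD1])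
    moreover have "multi_power (?t - u) \<alpha> = \<rho> ^ mi_size \<alpha>" for \<alpha>
      by (simp add: multi_power_def mi_size_def power_sum)
    ultimately show "(\<lambda>\<alpha>. \<bar>c \<alpha>\<bar> * \<rho> ^ mi_size \<alpha>) summable_on UNIV"
      using \<rho> by (simp add: abs_mult)
  qed (use r ball in blast)
qed

text \<open>The uniqueness theorem for one variable is applied to one coordinate after the other: the
coordinates in \<open>A\<close> have been dealt with, so their exponents are prescribed by \<open>\<beta>\<close>, and the others
are still variables. For \<open>A = UNIV\<close> a single coefficient is left.\<close>

lemma power_series_vanishing_partial:
  fixes c :: "('n::finite \<Rightarrow> nat) \<Rightarrow> real"
  assumes \<rho>: "\<rho> > 0"
    and zero: "\<And>t. (\<And>i. \<bar>t $ i\<bar> \<le> \<rho>) \<Longrightarrow> ((\<lambda>\<alpha>. c \<alpha> * multi_power t \<alpha>) has_sum 0) UNIV"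
    and A: "finite A"
  shows "(\<And>i. \<bar>t $ i\<bar> \<le> min \<rho> 1) \<Longrightarrow> ((\<lambda>\<alpha>. c \<alpha> * (\<Prod>i\<in>-A. (t $ i) ^ \<alpha> i)) has_sum 0) {\<alpha>. \<forall>i\<in>A. \<alpha> i = \<beta> i}"
  using A
proof (induction A arbitrary: t)
  case empty
  then show ?case using zero[of t] by (simp add: multi_power_def)
next
  case (insert j A)
  let ?X = "{\<alpha>. \<forall>i\<in>A. \<alpha> i = \<beta> i}"
  let ?Y = "\<lambda>k. {\<alpha> \<in> ?X. \<alpha> j = k}"
  define g where "g = (\<lambda>\<alpha>. c \<alpha> * (\<Prod>i\<in>-insert j A. (t $ i) ^ \<alpha> i))"
  define a where "a = (\<lambda>k. infsum g (?Y k))"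
  have eq: "c \<alpha> * (\<Prod>i\<in>-A. ((\<chi> i. if i = j then x else t $ i) $ i) ^ \<alpha> i) = g \<alpha> * x ^ \<alpha> j" for x \<alpha>
  proof -
    have co: "-A = insert j (-insert j A)" using insert.hyps by auto
    then have "(\<Prod>i\<in>-A. ((\<chi> i. if i = j then x else t $ i) $ i) ^ \<alpha> i) = 
        x ^ \<alpha> j * (\<Prod>i\<in>-insert j A. ((\<chi> i. if i = j then x else t $ i) $ i) ^ \<alpha> i)"
      unfolding co by (subst prod.insert) auto
    also have "(\<Prod>i\<in>-insert j A. ((\<chi> i. if i = j then x else t $ i) $ i) ^ \<alpha> i) = (\<Prod>i\<in>-insert j A. (t $ i) ^ \<alpha> i)"
      by (intro prod.cong) auto
    finally show ?thesis by (simp add: g_def)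
  qed
  have *: "((\<lambda>\<alpha>. g \<alpha> * x ^ \<alpha> j) has_sum 0) ?X" if "\<bar>x\<bar> \<le> min \<rho> 1" for x
    using insert.IH[of "\<chi> i. if i = j then x else t $ i"] insert.prems that unfolding eq by (simp split: if_splits)
  define x0 where "x0 = min \<rho> 1"
  have x0: "x0 > 0" using \<rho> by (simp add: x0_def)
  have gs: "g summable_on ?Y k" for k
  proof -
    have "(\<lambda>\<alpha>. g \<alpha> * x0 ^ \<alpha> j) summable_on ?Y k"
      by (rule summable_on_subset_banach[of _ ?X]) (use *[of x0] x0 in \<open>auto simp: summable_on_def x0_def\<close>)
    then have "(\<lambda>\<alpha>. g \<alpha> * x0 ^ k) summable_on ?Y k"
      by (rule summable_on_cong[THEN iffD1, rotated]) auto
    then show ?thesis using x0 by (subst (asm) summable_on_cmult_left') auto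
  qed
  have "(\<lambda>k. a k * x ^ k) sums 0" if x: "\<bar>x\<bar> < x0" for x
  proof -
    let ?h = "\<lambda>(k::nat, \<alpha>). g \<alpha> * x ^ \<alpha> j"
    have inj: "inj_on (\<lambda>\<alpha>. (\<alpha> j, \<alpha>)) ?X" by (auto simp: inj_on_def)
    have im: "(\<lambda>\<alpha>. (\<alpha> j, \<alpha>)) ` ?X = Sigma UNIV ?Y" by auto
    have "(?h has_sum 0) (Sigma UNIV ?Y)"
      unfolding im[symmetric] has_sum_reindex[OF inj] using *[of x] x by (simp add: o_def x0_def)
    moreover have "((\<lambda>\<alpha>. ?h (k, \<alpha>)) has_sum a k * x ^ k) (?Y k)" for k
    proof -
      have "((\<lambda>\<alpha>. g \<alpha> * x ^ k) has_sum a k * x ^ k) (?Y k)"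
        unfolding a_def by (intro has_sum_cmult_left has_sum_infsum gs)
      then show ?thesis by (rule has_sum_cong[THEN iffD1, rotated]) auto
    qed
    ultimately have "((\<lambda>k. a k * x ^ k) has_sum 0) UNIV"
      by (rule has_sum_Sigma[OF isUCont_plus])
    then show ?thesis by (rule has_sum_imp_sums)
  qed
  then have "a (\<beta> j) = 0" using x0 by (rule powser_zero_imp_coeff_zero[rotated])
  then have "(g has_sum 0) (?Y (\<beta> j))"
    using has_sum_infsum[OF gs[of "\<beta> j"]] by (simp add: a_def)
  moreover have "?Y (\<beta> j) = {\<alpha>. \<forall>i\<in>insert j A. \<alpha> i = \<beta> i}" by auto
  ultimately show ?case unfolding g_def by simp
qed

lemma power_series_coeffs_unique:
  fixes f :: "real ^ 'n \<Rightarrow> real"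
  assumes c: "has_power_series_at f 0 c" and d: "has_power_series_at f 0 d"
  shows "c = d"
proof
  fix \<beta>
  obtain \<rho>1 where 1: "\<rho>1 > 0" "\<rho>1 \<le> 1" "(\<lambda>\<alpha>. \<bar>c \<alpha>\<bar> * \<rho>1 ^ mi_size \<alpha>) summable_on UNIV"
    "\<And>t. (\<And>i. \<bar>t $ i - 0 $ i\<bar> \<le> \<rho>1) \<Longrightarrow> ((\<lambda>\<alpha>. c \<alpha> * multi_power (t - 0) \<alpha>) has_sum f t) UNIV"
    using has_power_series_at_polydisc[OF c] by blast
  obtain \<rho>2 where 2: "\<rho>2 > 0" "\<rho>2 \<le> 1" "(\<lambda>\<alpha>. \<bar>d \<alpha>\<bar> * \<rho>2 ^ mi_size \<alpha>) summable_on UNIV"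
    "\<And>t. (\<And>i. \<bar>t $ i - 0 $ i\<bar> \<le> \<rho>2) \<Longrightarrow> ((\<lambda>\<alpha>. d \<alpha> * multi_power (t - 0) \<alpha>) has_sum f t) UNIV"
    using has_power_series_at_polydisc[OF d] by blast
  define \<rho> where "\<rho> = min \<rho>1 \<rho>2"
  have \<rho>: "\<rho> > 0" "\<rho> \<le> \<rho>1" "\<rho> \<le> \<rho>2" using 1 2 by (auto simp: \<rho>_def)
  have zero: "((\<lambda>\<alpha>. (c \<alpha> - d \<alpha>) * multi_power t \<alpha>) has_sum 0) UNIV" if "\<And>i. \<bar>t $ i\<bar> \<le> \<rho>" for t
  proof -
    have "\<bar>t $ i - 0 $ i\<bar> \<le> \<rho>1" "\<bar>t $ i - 0 $ i\<bar> \<le> \<rho>2" for i using that[of i] \<rho> by auto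
    then have "((\<lambda>\<alpha>. c \<alpha> * multi_power t \<alpha>) has_sum f t) UNIV" "((\<lambda>\<alpha>. d \<alpha> * multi_power t \<alpha>) has_sum f t) UNIV"
      using 1(4)[of t] 2(4)[of t] by auto
    from has_sum_diff_real[OF this] show ?thesis by (simp add: algebra_simps)
  qed
  have "((\<lambda>\<alpha>. (c \<alpha> - d \<alpha>) * (\<Prod>i\<in>-UNIV. ((0 :: real^'n) $ i) ^ \<alpha> i)) has_sum 0) {\<alpha>. \<forall>i\<in>UNIV. \<alpha> i = \<beta> i}"
    by (rule power_series_vanishing_partial[OF \<rho>(1) zero]) (use \<rho> in auto)
  also have "{\<alpha>. \<forall>i\<in>UNIV. \<alpha> i = \<beta> i} = {\<beta>}" by auto
  finally have "((\<lambda>\<alpha>. c \<alpha> - d \<alpha>) has_sum 0) {\<beta>}" by simp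
  then have "c \<beta> - d \<beta> = 0"
    by (metis finite.emptyI finite.insertI has_sum_finite_iff sum.empty sum.insert_if add_0_right empty_iff)
  then show "c \<beta> = d \<beta>" by simp
qed

lemma taylor_coeff_eq:
  assumes "has_power_series_at f 0 c"
  shows "taylor_coeff f = c"
  unfolding taylor_coeff_def using assms by (intro the_equality) (auto intro: power_series_coeffs_unique)

lemma has_power_series_at_imp_continuous:
  fixes f :: "real ^ 'n \<Rightarrow> real"
  assumes "has_power_series_at f u c"
  shows "continuous (at u) f"
proof -
  obtain \<rho> where \<rho>: "\<rho> > 0" "\<rho> \<le> 1" "(\<lambda>\<alpha>. \<bar>c \<alpha>\<bar> * \<rho> ^ mi_size \<alpha>) summable_on UNIV"
    "\<And>t. (\<And>i. \<bar>t $ i - u $ i\<bar> \<le> \<rho>) \<Longrightarrow> ((\<lambda>\<alpha>. c \<alpha> * multi_power (t - u) \<alpha>) has_sum f t) UNIV"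
    using has_power_series_at_polydisc[OF assms] by blast
  define \<Sigma> where "\<Sigma> = infsum (\<lambda>\<alpha>. \<bar>c \<alpha>\<bar> * \<rho> ^ mi_size \<alpha>) UNIV"
  have est: "\<bar>f t - f u\<bar> \<le> norm (t - u) * (2 * \<Sigma> / \<rho>)" if t: "norm (t - u) \<le> \<rho>" for t
  proof -
    define d where "d = norm (t - u)"
    have d: "0 \<le> d" "d \<le> \<rho>" using t by (auto simp: d_def)
    have ti: "\<bar>(t - u) $ i\<bar> \<le> d" for i unfolding d_def by (rule component_le_norm_cart)
    have "((\<lambda>\<alpha>. c \<alpha> * multi_power (t - u) \<alpha>) has_sum f t) UNIV"
      using \<rho>(4)[of t] ti d by (metis order_trans vector_minus_component)
    moreover have "((\<lambda>\<alpha>. c \<alpha> * multi_power (u - u) \<alpha>) has_sum f u) UNIV" using \<rho>(4)[of u] \<rho>(1) by simp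
    ultimately have hs: "((\<lambda>\<alpha>. c \<alpha> * multi_power (t - u) \<alpha> - c \<alpha> * multi_power (u - u) \<alpha>) has_sum (f t - f u)) UNIV"
      by (rule has_sum_diff_real)
    have pt: "\<bar>c \<alpha> * multi_power (t - u) \<alpha> - c \<alpha> * multi_power (u - u) \<alpha>\<bar> \<le> (d / \<rho>) * (\<bar>c \<alpha>\<bar> * \<rho> ^ mi_size \<alpha>)" for \<alpha>
    proof (cases "mi_size \<alpha> = 0")
      case True
      then have "\<alpha> i = 0" for i by (auto simp: mi_size_def)
      then show ?thesis using d \<rho> by (simp add: multi_power_def)
    next
      case False
      then obtain i where "\<alpha> i \<noteq> 0" by (auto simp: mi_size_def)
      then have z: "multi_power (u - u) \<alpha> = 0" unfolding multi_power_def by (intro prod_zero) auto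
      have "\<bar>multi_power (t - u) \<alpha>\<bar> \<le> d ^ mi_size \<alpha>" by (rule abs_multi_power_le) (rule ti)
      also have "\<dots> = (d / \<rho>) ^ mi_size \<alpha> * \<rho> ^ mi_size \<alpha>" using \<rho> by (simp add: power_divide)
      also have "\<dots> \<le> (d / \<rho>) * \<rho> ^ mi_size \<alpha>"
      proof (intro mult_right_mono)
        obtain m where "mi_size \<alpha> = Suc m" using False not0_implies_Suc by blast
        then show "(d / \<rho>) ^ mi_size \<alpha> \<le> d / \<rho>"
          using power_decreasing[of 1 "Suc m" "d / \<rho>"] d \<rho>(1) by simp
      qed (use \<rho> in auto)
      finally have "\<bar>c \<alpha>\<bar> * \<bar>multi_power (t - u) \<alpha>\<bar> \<le> \<bar>c \<alpha>\<bar> * ((d / \<rho>) * \<rho> ^ mi_size \<alpha>)"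
        by (intro mult_left_mono) auto
      then show ?thesis using z by (simp add: abs_mult mult_ac)
    qed
    have "((\<lambda>\<alpha>. (d / \<rho>) * (\<bar>c \<alpha>\<bar> * \<rho> ^ mi_size \<alpha>)) has_sum (d / \<rho>) * \<Sigma>) UNIV"
      unfolding \<Sigma>_def by (intro has_sum_cmult_right has_sum_infsum \<rho>)
    moreover have hs': "((\<lambda>\<alpha>. - (c \<alpha> * multi_power (t - u) \<alpha> - c \<alpha> * multi_power (u - u) \<alpha>)) has_sum - (f t - f u)) UNIV"
      using hs by (subst has_sum_uminus) simp
    ultimately have "f t - f u \<le> (d / \<rho>) * \<Sigma>" "- (f t - f u) \<le> (d / \<rho>) * \<Sigma>"
      using has_sum_mono[OF hs] has_sum_mono[OF hs'] pt by (auto simp: abs_le_iff)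
    moreover have "\<Sigma> \<ge> 0" unfolding \<Sigma>_def using \<rho> by (intro infsum_nonneg) auto
    ultimately have "\<bar>f t - f u\<bar> \<le> (d / \<rho>) * \<Sigma>" by linarith
    also have "\<dots> \<le> (d / \<rho>) * (2 * \<Sigma>)" using \<open>\<Sigma> \<ge> 0\<close> d \<rho> by (intro mult_left_mono) auto
    finally show ?thesis by (simp add: d_def mult_ac)
  qed
  have "((\<lambda>t. f t - f u) \<longlongrightarrow> 0) (at u)"
  proof (rule Lim_null_comparison)
    show "\<forall>\<^sub>F t in at u. norm (f t - f u) \<le> norm (t - u) * (2 * \<Sigma> / \<rho>)"
      unfolding eventually_at using \<rho>(1) est by (intro exI[of _ \<rho>]) (auto simp: dist_norm)
    have "((\<lambda>t. norm (t - u) * (2 * \<Sigma> / \<rho>)) \<longlongrightarrow> norm (u - u) * (2 * \<Sigma> / \<rho>)) (at u)"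
      by (intro tendsto_intros)
    then show "((\<lambda>t. norm (t - u) * (2 * \<Sigma> / \<rho>)) \<longlongrightarrow> 0) (at u)" by simp
  qed
  then show ?thesis unfolding continuous_at by (simp add: LIM_zero_iff)
qed

section \<open>Vertices of the Newton polyhedron\<close>

lemma nat_seq_mono_subseq:
  fixes s :: "nat \<Rightarrow> nat"
  shows "\<exists>r :: nat \<Rightarrow> nat. strict_mono r \<and> mono (\<lambda>k. s (r k))"
proof -
  obtain f where f: "strict_mono f" "monoseq (\<lambda>n. s (f n))" using seq_monosub by blast
  show ?thesis
  proof (cases "incseq (\<lambda>n. s (f n))")
    case True
    then show ?thesis using f by blast
  next
    case False
    then have dec: "decseq (\<lambda>n. s (f n))" using f(2) monoseq_iff by blast
    obtain K where K: "\<And>n. s (f K) \<le> s (f n)"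
      using ex_has_least_nat[of "\<lambda>_. True" 0 "\<lambda>n. s (f n)"] by auto
    have "s (f (K + k)) = s (f K)" for k
      using K[of "K + k"] decseqD[OF dec, of K "K + k"] by simp
    then have "strict_mono (\<lambda>k. f (K + k)) \<and> mono (\<lambda>k. s (f (K + k)))"
      using f(1) by (auto simp: strict_mono_def mono_def)
    then show ?thesis by blast
  qed
qed

text \<open>Dickson's lemma. In an infinite set, passing to a monotone subsequence for one coordinate
after the other produces two comparable elements.\<close>

lemma antichain_finite:
  fixes X :: "('n::finite \<Rightarrow> nat) set"
  assumes anti: "\<And>f g. f \<in> X \<Longrightarrow> g \<in> X \<Longrightarrow> f \<le> g \<Longrightarrow> f = g"
  shows "finite X"
proof (rule ccontr)
  assume "infinite X"
  then obtain s :: "nat \<Rightarrow> 'n \<Rightarrow> nat" where s: "inj s" "range s \<subseteq> X"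
    using infinite_countable_subset by blast
  have "\<exists>r :: nat \<Rightarrow> nat. strict_mono r \<and> (\<forall>i\<in>A. mono (\<lambda>k. s (r k) i))" if "finite A" for A :: "'n set"
    using that
  proof (induction A)
    case empty
    show ?case by (intro exI[of _ id]) (auto simp: strict_mono_def)
  next
    case (insert j A)
    then obtain r :: "nat \<Rightarrow> nat" where r: "strict_mono r" "\<forall>i\<in>A. mono (\<lambda>k. s (r k) i)" by blast
    obtain r' :: "nat \<Rightarrow> nat" where r': "strict_mono r'" "mono (\<lambda>k. s (r (r' k)) j)"
      using nat_seq_mono_subseq[of "\<lambda>k. s (r k) j"] by blast
    have "strict_mono (\<lambda>k. r (r' k))" using r(1) r'(1) by (auto simp: strict_mono_def)
    moreover have "mono (\<lambda>k. s (r (r' k)) i)" if "i \<in> A" for i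
      using r(2) that r'(1) by (auto simp: mono_def strict_mono_less_eq)
    ultimately show ?case using r'(2) by blast
  qed
  from this[of UNIV] obtain r :: "nat \<Rightarrow> nat" where r: "strict_mono r" "\<forall>i. mono (\<lambda>k. s (r k) i)" by auto
  have "s (r 0) \<le> s (r 1)" unfolding le_fun_def using r(2) by (auto simp: mono_def)
  then have "s (r 0) = s (r 1)" using anti s(2) by blast
  then have "r 0 = r 1" using s(1) by (simp add: inj_eq)
  then show False using r(1) by (simp add: strict_mono_eq)
qed

definition newton_orthants :: "(real ^ 'n \<Rightarrow> real) \<Rightarrow> (real ^ 'n) set" where
  "newton_orthants f = (\<Union>\<alpha>\<in>{\<alpha>. taylor_coeff f \<alpha> \<noteq> 0}. {t. \<forall>i. real (\<alpha> i) \<le> t $ i})"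

lemma newton_polyhedron_alt: "newton_polyhedron f = convex hull (newton_orthants f)"
  by (simp add: newton_polyhedron_def newton_orthants_def)

text \<open>If a point \<open>\<beta>\<close> of the support lay properly below \<open>v\<close>, then \<open>v\<close> would be the midpoint of \<open>\<beta>\<close> and
\<open>2v - \<beta>\<close>, and both belong to the orthant with corner \<open>\<beta>\<close>.\<close>

lemma vertex_minimal:
  fixes f :: "real ^ 'n \<Rightarrow> real"
  assumes v: "real_index v extreme_point_of newton_polyhedron f"
    and \<beta>: "taylor_coeff f \<beta> \<noteq> 0" "\<beta> \<le> v"
  shows "\<beta> = v"
proof (rule ccontr)
  assume ne: "\<beta> \<noteq> v"
  define x where "x = real_index \<beta>"
  define y where "y = (\<chi> i. 2 * real (v i) - real (\<beta> i))"
  have le: "real (\<beta> i) \<le> real (v i)" for i using le_funD[OF \<beta>(2), of i] by simp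
  have "real (\<beta> i) \<le> 2 * real (v i) - real (\<beta> i)" for i using le[of i] by linarith
  then have "x \<in> newton_orthants f" "y \<in> newton_orthants f"
    unfolding newton_orthants_def x_def y_def real_index_def using \<beta>(1) by auto
  then have xy: "x \<in> newton_polyhedron f" "y \<in> newton_polyhedron f"
    unfolding newton_polyhedron_alt by (auto intro: hull_inc)
  have mid: "real_index v = midpoint x y"
    unfolding midpoint_def x_def y_def real_index_def by (simp add: vec_eq_iff)
  have "x \<noteq> y"
  proof
    assume "x = y"
    then have "x $ i = y $ i" for i by simp
    then have "real (\<beta> i) = real (v i)" for i by (simp add: x_def y_def real_index_def)
    then show False using ne by auto
  qed
  then have "real_index v \<in> open_segment x y" unfolding mid by simp
  then show False using v xy unfolding extreme_point_of_def by blast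
qed

lemma vertex_in_support:
  fixes f :: "real ^ 'n \<Rightarrow> real"
  assumes v: "real_index v extreme_point_of newton_polyhedron f"
  shows "taylor_coeff f v \<noteq> 0"
proof -
  have "real_index v \<in> newton_orthants f"
    using extreme_point_of_convex_hull v unfolding newton_polyhedron_alt by blast
  then obtain \<beta> where \<beta>: "taylor_coeff f \<beta> \<noteq> 0" "\<beta> \<le> v"
    by (auto simp: newton_orthants_def real_index_def le_fun_def)
  then show ?thesis using vertex_minimal[OF v \<beta>] by simp
qed

text \<open>This matters because \<open>newton_star\<close> would be \<open>0\<close>, as a sum over an infinite set, if there were
infinitely many vertices.\<close>

lemma finite_vertices:
  fixes f :: "real ^ 'n \<Rightarrow> real"
  shows "finite {v. real_index v extreme_point_of newton_polyhedron f}"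
proof (rule antichain_finite)
  fix g h :: "'n \<Rightarrow> nat"
  assume "g \<in> {v. real_index v extreme_point_of newton_polyhedron f}"
    "h \<in> {v. real_index v extreme_point_of newton_polyhedron f}" "g \<le> h"
  then show "g = h" using vertex_minimal[of h f g] vertex_in_support[of g f] by simp
qed

text \<open>An open half-space together with a ball in its bounding hyperplane. The points of norm \<open>R\<close> in the
hyperplane are extreme points of this set because balls are strictly convex.\<close>

lemma convex_strict_halfspace_union_cap:
  fixes l :: "'a::euclidean_space"
  shows "convex {z. c < l \<bullet> z \<or> (l \<bullet> z = c \<and> norm z \<le> R)}" (is "convex ?Y")
  unfolding convex_alt
proof (intro ballI allI impI)
  fix x y and u :: real assume xy: "x \<in> ?Y" "y \<in> ?Y" and u: "0 \<le> u \<and> u \<le> 1"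
  let ?z = "(1 - u) *\<^sub>R x + u *\<^sub>R y"
  have lz: "l \<bullet> ?z = (1 - u) * (l \<bullet> x) + u * (l \<bullet> y)" by (simp add: inner_add_right)
  have ge: "l \<bullet> x \<ge> c" "l \<bullet> y \<ge> c" using xy by auto
  consider "u = 0" | "u = 1" | "0 < u" "u < 1" "l \<bullet> x = c" "l \<bullet> y = c" | "0 < u" "u < 1" "l \<bullet> x > c \<or> l \<bullet> y > c"
    using u ge by fastforce
  then show "?z \<in> ?Y"
  proof cases
    case 3
    then have n: "norm x \<le> R" "norm y \<le> R" using xy by auto
    have "norm ?z \<le> (1 - u) * norm x + u * norm y"
      using norm_triangle_ineq[of "(1 - u) *\<^sub>R x" "u *\<^sub>R y"] 3 by simp
    also have "\<dots> \<le> (1 - u) * R + u * R" using n 3 by (intro add_mono mult_left_mono) auto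
    finally have "norm ?z \<le> R" by (simp add: algebra_simps)
    moreover have "l \<bullet> ?z = c" unfolding lz using 3 by (simp add: algebra_simps)
    ultimately show ?thesis by simp
  next
    case 4
    have "(1 - u) * c \<le> (1 - u) * (l \<bullet> x)" "u * c \<le> u * (l \<bullet> y)" using ge 4 by (auto intro: mult_left_mono)
    moreover have "(1 - u) * c < (1 - u) * (l \<bullet> x) \<or> u * c < u * (l \<bullet> y)" using 4 by auto
    ultimately have "(1 - u) * c + u * c < l \<bullet> ?z" unfolding lz by linarith
    then show ?thesis by (simp add: algebra_simps)
  qed (use xy in auto)
qed

text \<open>A linear functional with positive coefficients attains its minimum over the Newton polyhedron at a
vertex. Among the finitely many minimizers in the support, one of largest norm is a vertex: the
polyhedron lies in the convex set of the previous lemma, of which that minimizer is an extreme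
point.\<close>

lemma vertex_below:
  fixes f :: "real ^ 'n \<Rightarrow> real" and l :: "real ^ 'n"
  assumes l: "\<And>i. l $ i > 0" and \<alpha>: "taylor_coeff f \<alpha> \<noteq> 0"
  obtains v where "real_index v extreme_point_of newton_polyhedron f" "l \<bullet> real_index v \<le> l \<bullet> real_index \<alpha>"
proof -
  let ?L = "\<lambda>\<beta>. l \<bullet> real_index \<beta>"
  have Lsum: "?L \<beta> = (\<Sum>i\<in>UNIV. l $ i * real (\<beta> i))" for \<beta>
    by (simp add: inner_vec_def real_index_def)
  define F where "F = {\<beta>. taylor_coeff f \<beta> \<noteq> 0 \<and> ?L \<beta> \<le> ?L \<alpha>}"
  have "finite F"
  proof (rule finite_subset)
    define B where "B = (\<lambda>i. nat \<lceil>?L \<alpha> / l $ i\<rceil>)"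
    show "F \<subseteq> PiE UNIV (\<lambda>i. {..B i})"
    proof
      fix \<beta> assume b: "\<beta> \<in> F"
      have "\<beta> i \<le> B i" for i
      proof -
        have "l $ i * real (\<beta> i) \<le> ?L \<beta>"
          unfolding Lsum by (intro member_le_sum) (auto intro!: mult_nonneg_nonneg less_imp_le[OF l])
        also have "\<dots> \<le> ?L \<alpha>" using b by (simp add: F_def)
        finally have "real (\<beta> i) \<le> ?L \<alpha> / l $ i" using l[of i] by (simp add: field_simps)
        then show ?thesis unfolding B_def by linarith
      qed
      then show "\<beta> \<in> PiE UNIV (\<lambda>i. {..B i})" by auto
    qed
    show "finite (PiE UNIV (\<lambda>i::'n. {..B i}))" by (intro finite_PiE) auto
  qed
  moreover have "\<alpha> \<in> F" using \<alpha> by (simp add: F_def)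
  ultimately obtain \<beta>0 where \<beta>0: "\<beta>0 \<in> F" "\<And>\<beta>. \<beta> \<in> F \<Longrightarrow> ?L \<beta>0 \<le> ?L \<beta>"
    using ex_is_arg_min_if_finite[of F ?L] unfolding is_arg_min_linorder by blast
  define c where "c = ?L \<beta>0"
  have cmin: "c \<le> ?L \<beta>" if "taylor_coeff f \<beta> \<noteq> 0" for \<beta>
    using \<beta>0 that unfolding c_def F_def by force
  define F1 where "F1 = {\<beta>\<in>F. ?L \<beta> = c}"
  have "finite F1" "\<beta>0 \<in> F1" using \<open>finite F\<close> \<beta>0 by (auto simp: F1_def c_def)
  then obtain v where v: "v \<in> F1" "\<And>\<beta>. \<beta> \<in> F1 \<Longrightarrow> norm (real_index \<beta>) \<le> norm (real_index v)"
    using ex_is_arg_min_if_finite[of F1 "\<lambda>\<beta>. - norm (real_index \<beta>)"] unfolding is_arg_min_linorder by auto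
  define R where "R = norm (real_index v)"
  have vc: "?L v = c" "taylor_coeff f v \<noteq> 0" "c \<le> ?L \<alpha>" using v \<open>\<alpha> \<in> F\<close> cmin \<alpha> by (auto simp: F1_def F_def)
  let ?Y = "{z. c < l \<bullet> z \<or> (l \<bullet> z = c \<and> norm z \<le> R)}"
  have Xsub: "newton_orthants f \<subseteq> ?Y"
  proof
    fix z assume "z \<in> newton_orthants f"
    then obtain \<beta> where \<beta>: "taylor_coeff f \<beta> \<noteq> 0" "\<And>i. real (\<beta> i) \<le> z $ i"
      by (auto simp: newton_orthants_def)
    have diff: "l \<bullet> z - ?L \<beta> = (\<Sum>i\<in>UNIV. l $ i * (z $ i - real (\<beta> i)))"
      unfolding Lsum by (simp add: inner_vec_def sum_subtractf right_diff_distrib)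
    have nn: "0 \<le> l $ i * (z $ i - real (\<beta> i))" for i using l[of i] \<beta>(2)[of i] by simp
    have sn: "0 \<le> (\<Sum>i\<in>UNIV. l $ i * (z $ i - real (\<beta> i)))" by (intro sum_nonneg nn)
    have ge: "c \<le> l \<bullet> z" using cmin[OF \<beta>(1)] diff sn by linarith
    show "z \<in> ?Y"
    proof (cases "l \<bullet> z = c")
      case True
      then have "(\<Sum>i\<in>UNIV. l $ i * (z $ i - real (\<beta> i))) = 0" "?L \<beta> = c"
        using cmin[OF \<beta>(1)] diff sn by linarith+
      then have "l $ i * (z $ i - real (\<beta> i)) = 0" for i
        using sum_nonneg_eq_0_iff[of UNIV "\<lambda>i. l $ i * (z $ i - real (\<beta> i))"] nn by simp
      then have "z $ i = real (\<beta> i)" for i using l[of i] by (metis eq_iff_diff_eq_0 less_irrefl mult_eq_0_iff)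
      then have "z = real_index \<beta>" by (simp add: real_index_def vec_eq_iff)
      moreover have "\<beta> \<in> F1" using \<beta>(1) \<open>?L \<beta> = c\<close> vc(3) by (simp add: F1_def F_def)
      ultimately show ?thesis using v(2) True by (simp add: R_def)
    next
      case False
      then show ?thesis using ge by simp
    qed
  qed
  have sub: "newton_polyhedron f \<subseteq> ?Y"
    unfolding newton_polyhedron_alt by (rule hull_minimal) (fact Xsub, rule convex_strict_halfspace_union_cap)
  have vN: "real_index v \<in> newton_polyhedron f"
    unfolding newton_polyhedron_alt newton_orthants_def real_index_def using vc(2) by (intro hull_inc) auto
  have "real_index v extreme_point_of newton_polyhedron f"
    unfolding extreme_point_of_def
  proof (intro conjI vN ballI notI)
    fix a b assume ab: "a \<in> newton_polyhedron f" "b \<in> newton_polyhedron f" and seg: "real_index v \<in> open_segment a b"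
    have Y: "a \<in> ?Y" "b \<in> ?Y" using ab sub by auto
    obtain u where u: "0 < u" "u < 1" "real_index v = (1 - u) *\<^sub>R a + u *\<^sub>R b"
      using seg unfolding in_segment by blast
    have lc: "c = (1 - u) * (l \<bullet> a) + u * (l \<bullet> b)"
      unfolding vc(1)[symmetric] u(3) by (simp add: inner_add_right)
    have ge: "c \<le> l \<bullet> a" "c \<le> l \<bullet> b" using Y by auto
    have "(1 - u) * (l \<bullet> a - c) + u * (l \<bullet> b - c) = 0" using lc by (simp add: algebra_simps)
    moreover have "0 \<le> (1 - u) * (l \<bullet> a - c)" "0 \<le> u * (l \<bullet> b - c)" using ge u by auto
    ultimately have "(1 - u) * (l \<bullet> a - c) = 0" "u * (l \<bullet> b - c) = 0" by linarith+
    then have "l \<bullet> a = c" "l \<bullet> b = c" using u by auto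
    then have "norm a \<le> R" "norm b \<le> R" using Y by auto
    then show False
      using dist_decreases_open_segment[OF seg, of 0] by (simp add: R_def)
  qed
  then show ?thesis using that vc by simp
qed

text \<open>With \<open>u\<^sub>i = e\<^bsup>-l\<^sub>i\<^esup>\<close> the monomial \<open>u\<^sup>\<alpha>\<close> is \<open>e\<^bsup>-l\<bullet>\<alpha>\<^esup>\<close>, and \<open>l\<bullet>\<alpha>\<close> is at least the value of \<open>l\<close> at
some vertex.\<close>

lemma monomial_le_newton_star:
  fixes f :: "real ^ 'n \<Rightarrow> real"
  assumes u: "\<And>i. 0 < u $ i" "\<And>i. u $ i < 1" and \<alpha>: "taylor_coeff f \<alpha> \<noteq> 0"
  shows "multi_power u \<alpha> \<le> newton_star f u"
proof -
  define l where "l = (\<chi> i. - ln (u $ i))"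
  have l: "l $ i > 0" for i using u[of i] by (simp add: l_def)
  obtain v where v: "real_index v extreme_point_of newton_polyhedron f" "l \<bullet> real_index v \<le> l \<bullet> real_index \<alpha>"
    using vertex_below[OF l \<alpha>] by blast
  have e: "multi_power u \<beta> = exp (- (l \<bullet> real_index \<beta>))" for \<beta>
  proof -
    have "exp (- (l \<bullet> real_index \<beta>)) = exp (\<Sum>i\<in>UNIV. real (\<beta> i) * ln (u $ i))"
      by (simp add: inner_vec_def real_index_def l_def sum_negf mult.commute)
    also have "\<dots> = (\<Prod>i\<in>UNIV. exp (real (\<beta> i) * ln (u $ i)))" by (simp add: exp_sum)
    also have "\<dots> = multi_power u \<beta>"
      unfolding multi_power_def using u(1) by (intro prod.cong) (auto simp: exp_of_nat_mult)
    finally show ?thesis ..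
  qed
  have "multi_power u \<alpha> \<le> multi_power u v" unfolding e using v(2) by simp
  also have "\<dots> = (\<Prod>i\<in>UNIV. \<bar>u $ i\<bar> ^ v i)"
    unfolding multi_power_def using u(1) by (intro prod.cong) (auto simp: abs_of_pos)
  also have "\<dots> \<le> newton_star f u"
    unfolding newton_star_def using v(1) finite_vertices
    by (intro member_le_sum) (auto intro: prod_nonneg)
  finally show ?thesis .
qed

text \<open>Estimating each monomial by \<open>newton_star\<close> at the same point would lose the convergence of the
series. The monomials are therefore compared at \<open>u = \<beta> / \<rho>\<close>, which leaves the summable factors
\<open>\<bar>c \<alpha>\<bar> \<rho>\<^bsup>\<bar>\<alpha>\<bar>\<^esup>\<close>; since there are finitely many vertices, rescaling back to \<open>\<beta>\<close> costs a constant.\<close>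

lemma abs_le_newton_star:
  fixes f :: "real ^ 'n \<Rightarrow> real"
  assumes ps: "has_power_series_at f 0 c"
  obtains \<rho> C where "\<rho> > 0" "C > 0"
    "\<And>\<beta> t. (\<And>i. 0 < \<beta> $ i) \<Longrightarrow> (\<And>i. \<beta> $ i < \<rho>) \<Longrightarrow> (\<And>i. \<bar>t $ i\<bar> \<le> \<beta> $ i) \<Longrightarrow> \<bar>f t\<bar> \<le> C * newton_star f \<beta>"
proof -
  obtain \<rho> where \<rho>: "\<rho> > 0" "\<rho> \<le> 1" "(\<lambda>\<alpha>. \<bar>c \<alpha>\<bar> * \<rho> ^ mi_size \<alpha>) summable_on UNIV"
    "\<And>t. (\<And>i. \<bar>t $ i - 0 $ i\<bar> \<le> \<rho>) \<Longrightarrow> ((\<lambda>\<alpha>. c \<alpha> * multi_power (t - 0) \<alpha>) has_sum f t) UNIV"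
    using has_power_series_at_polydisc[OF ps] by blast
  have tc: "taylor_coeff f = c" by (rule taylor_coeff_eq[OF ps])
  define \<Sigma> where "\<Sigma> = infsum (\<lambda>\<alpha>. \<bar>c \<alpha>\<bar> * \<rho> ^ mi_size \<alpha>) UNIV"
  have S0: "\<Sigma> \<ge> 0" unfolding \<Sigma>_def using \<rho> by (intro infsum_nonneg) auto
  define V where "V = {v. real_index v extreme_point_of newton_polyhedron f}"
  have V: "finite V" unfolding V_def by (rule finite_vertices)
  define D where "D = (\<Sum>v\<in>V. mi_size v)"
  show ?thesis
  proof (rule that[of \<rho> "(\<Sigma> + 1) / \<rho> ^ D"])
    fix \<beta> t :: "real ^ 'n" assume b: "\<And>i. 0 < \<beta> $ i" "\<And>i. \<beta> $ i < \<rho>" and t: "\<And>i. \<bar>t $ i\<bar> \<le> \<beta> $ i"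
    define u where "u = (\<chi> i. \<beta> $ i / \<rho>)"
    have u: "0 < u $ i" "u $ i < 1" for i using b[of i] \<rho>(1) by (auto simp: u_def)
    have bu: "multi_power \<beta> \<alpha> = \<rho> ^ mi_size \<alpha> * multi_power u \<alpha>" for \<alpha>
    proof -
      have "\<beta> $ i = \<rho> * u $ i" for i using \<rho>(1) by (simp add: u_def)
      then show ?thesis by (simp add: multi_power_def mi_size_def power_sum power_mult_distrib prod.distrib)
    qed
    have star: "newton_star f u \<le> newton_star f \<beta> / \<rho> ^ D"
    proof -
      have "newton_star f u = (\<Sum>v\<in>V. multi_power u v)"
        unfolding newton_star_def V_def multi_power_def using u by (simp add: abs_of_pos)
      also have "\<dots> \<le> (\<Sum>v\<in>V. multi_power \<beta> v / \<rho> ^ D)"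
      proof (intro sum_mono)
        fix v assume v: "v \<in> V"
        have "mi_size v \<le> D" unfolding D_def by (rule member_le_sum) (use v V in auto)
        then have "\<rho> ^ D \<le> \<rho> ^ mi_size v" using \<rho> by (intro power_decreasing) auto
        moreover have "multi_power u v \<ge> 0" unfolding multi_power_def using u by (intro prod_nonneg) (auto intro: less_imp_le)
        ultimately have "\<rho> ^ D * multi_power u v \<le> multi_power \<beta> v" unfolding bu by (intro mult_right_mono)
        then show "multi_power u v \<le> multi_power \<beta> v / \<rho> ^ D" using \<rho>(1) by (simp add: field_simps)
      qed
      also have "\<dots> = newton_star f \<beta> / \<rho> ^ D"
        unfolding newton_star_def V_def multi_power_def sum_divide_distrib using b by (simp add: abs_of_pos)
      finally show ?thesis .
    qed
    have star_nn: "newton_star f u \<ge> 0" unfolding newton_star_def by (intro sum_nonneg prod_nonneg) auto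
    have hs: "((\<lambda>\<alpha>. c \<alpha> * multi_power t \<alpha>) has_sum f t) UNIV"
      using \<rho>(4)[of t] t b(2) by (simp add: order_trans[OF t] less_imp_le)
    have pt: "\<bar>c \<alpha> * multi_power t \<alpha>\<bar> \<le> \<bar>c \<alpha>\<bar> * \<rho> ^ mi_size \<alpha> * newton_star f u" for \<alpha>
    proof (cases "c \<alpha> = 0")
      case False
      have "\<bar>multi_power t \<alpha>\<bar> \<le> multi_power \<beta> \<alpha>"
        unfolding multi_power_def abs_prod using t by (intro prod_mono) (auto simp: power_abs intro: power_mono)
      also have "\<dots> \<le> \<rho> ^ mi_size \<alpha> * newton_star f u"
        unfolding bu using \<rho>(1) monomial_le_newton_star[of u f \<alpha>] u False tc by (intro mult_left_mono) auto
      finally show ?thesis unfolding abs_mult mult.assoc by (intro mult_left_mono) auto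
    qed simp
    have hb: "((\<lambda>\<alpha>. \<bar>c \<alpha>\<bar> * \<rho> ^ mi_size \<alpha> * newton_star f u) has_sum \<Sigma> * newton_star f u) UNIV"
      unfolding \<Sigma>_def by (intro has_sum_cmult_left has_sum_infsum \<rho>)
    have hs': "((\<lambda>\<alpha>. - (c \<alpha> * multi_power t \<alpha>)) has_sum - f t) UNIV"
      using hs by (subst has_sum_uminus) simp
    have "f t \<le> \<Sigma> * newton_star f u" "- f t \<le> \<Sigma> * newton_star f u"
      using has_sum_mono[OF hs hb] has_sum_mono[OF hs' hb] pt by (auto simp: abs_le_iff)
    then have "\<bar>f t\<bar> \<le> \<Sigma> * newton_star f u" by linarith
    also have "\<dots> \<le> (\<Sigma> + 1) * (newton_star f \<beta> / \<rho> ^ D)"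
      using star star_nn S0 by (intro mult_mono) auto
    finally show "\<bar>f t\<bar> \<le> (\<Sigma> + 1) / \<rho> ^ D * newton_star f \<beta>" by simp
  qed (use \<rho> S0 in auto)
qed

section \<open>Large boxes inside sublevel sets\<close>

lemma Basis_vec_real: "(Basis :: (real ^ 'n) set) = (\<lambda>i. axis i 1) ` UNIV"
  by (auto simp: Basis_vec_def)

lemma inj_axis_1: "inj (\<lambda>i::'n. axis i (1::real) :: real ^ 'n)"
  by (auto simp: inj_def axis_eq_axis)

lemma prod_Basis_vec: "(\<Prod>b\<in>(Basis :: (real ^ 'n) set). f b) = (\<Prod>i\<in>UNIV. f (axis i 1))"
  unfolding Basis_vec_real by (subst prod.reindex[OF inj_axis_1]) (simp add: o_def)

lemma nn_integral_powr_unit_interval: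
  assumes "0 < \<delta>"
  shows "(\<integral>\<^sup>+x. ennreal (if x \<in> {0..1::real} then x powr (\<delta> - 1) else 0) \<partial>lborel) = ennreal (1 / \<delta>)"
proof (rule nn_integral_has_integral_lborel)
  have "((\<lambda>x. x powr (\<delta> - 1)) has_integral (1 powr (\<delta> - 1 + 1) / (\<delta> - 1 + 1))) {0..1}"
    using assms by (intro has_integral_powr_from_0) auto
  then have "((\<lambda>x. x powr (\<delta> - 1)) has_integral (1 / \<delta>)) {0..1::real}" by simp
  then show "((\<lambda>x. if x \<in> {0..1::real} then x powr (\<delta> - 1) else 0) has_integral (1 / \<delta>)) UNIV"
    by (simp only: has_integral_restrict_UNIV)
qed auto

text \<open>Markov's inequality for \<open>\<Prod>t\<^sub>i\<^bsup>-(1-\<delta>)\<^esup>\<close>, whose integral over the unit cube is \<open>\<delta>\<^bsup>-n\<^esup>\<close>.\<close>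

lemma measure_small_product_le:
  fixes A :: "(real ^ 'n) set"
  assumes \<delta>: "0 < \<delta>" "\<delta> < 1" and \<eta>: "\<eta> > 0"
    and A: "\<And>t. t \<in> A \<Longrightarrow> (\<forall>i. 0 < t $ i \<and> t $ i < 1) \<and> (\<Prod>i\<in>UNIV. t $ i) < \<eta>"
  shows "measure lebesgue A \<le> \<eta> powr (1 - \<delta>) * (1 / \<delta>) ^ CARD('n)"
proof -
  let ?g = "\<lambda>x::real. if x \<in> {0..1} then x powr (\<delta> - 1) else 0"
  let ?P = "{t :: real ^ 'n. (\<forall>i. 0 < t $ i \<and> t $ i < 1) \<and> (\<Prod>i\<in>UNIV. t $ i) < \<eta>}"
  have comp[measurable]: "(\<lambda>t::real^'n. t $ i) \<in> borel_measurable borel" for i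
    by (intro borel_measurable_continuous_onI continuous_intros)
  have P[measurable]: "?P \<in> sets borel" by measurable
  have "emeasure lborel ?P = (\<integral>\<^sup>+t. indicator ?P t \<partial>lborel)" by simp
  also have "\<dots> \<le> (\<integral>\<^sup>+t. ennreal (\<eta> powr (1 - \<delta>)) * (\<Prod>b\<in>Basis. ennreal (?g (t \<bullet> b))) \<partial>(lborel :: (real ^ 'n) measure))"
  proof (rule nn_integral_mono)
    fix t :: "real ^ 'n"
    show "indicator ?P t \<le> ennreal (\<eta> powr (1 - \<delta>)) * (\<Prod>b\<in>Basis. ennreal (?g (t \<bullet> b)))"
    proof (cases "t \<in> ?P")
      case True
      define \<pi> where "\<pi> = (\<Prod>i\<in>UNIV. t $ i)"
      have t: "0 < t $ i" "t $ i < 1" for i using True by auto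
      have \<pi>: "0 < \<pi>" "\<pi> < \<eta>" using True t unfolding \<pi>_def by (auto intro: prod_pos)
      have "(\<Prod>b\<in>Basis. ennreal (?g (t \<bullet> b))) = ennreal (\<Prod>i\<in>UNIV. (t $ i) powr (\<delta> - 1))"
        unfolding prod_Basis_vec using t by (simp add: inner_axis prod_ennreal less_imp_le)
      also have "(\<Prod>i\<in>UNIV. (t $ i) powr (\<delta> - 1)) = \<pi> powr (\<delta> - 1)"
        unfolding \<pi>_def using t by (intro prod_powr_distrib[symmetric] less_imp_le) 
      finally have e: "(\<Prod>b\<in>Basis. ennreal (?g (t \<bullet> b))) = ennreal (\<pi> powr (\<delta> - 1))" .
      have "\<pi> powr (1 - \<delta>) \<le> \<eta> powr (1 - \<delta>)" using \<pi> \<delta> by (intro powr_mono2) auto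
      then have "\<pi> powr (1 - \<delta>) * \<pi> powr (\<delta> - 1) \<le> \<eta> powr (1 - \<delta>) * \<pi> powr (\<delta> - 1)"
        by (intro mult_right_mono) auto
      then have "1 \<le> \<eta> powr (1 - \<delta>) * \<pi> powr (\<delta> - 1)" using \<pi> by (simp flip: powr_add)
      then show ?thesis unfolding e using True by (simp flip: ennreal_mult)
    qed simp
  qed
  also have "\<dots> = ennreal (\<eta> powr (1 - \<delta>)) * (\<Prod>b\<in>(Basis::(real^'n) set). (\<integral>\<^sup>+x. ennreal (?g x) \<partial>lborel))"
  proof -
    have eq: "(\<integral>\<^sup>+t. (\<Prod>b\<in>Basis. ennreal (?g (t \<bullet> b))) \<partial>(lborel :: (real ^ 'n) measure)) = (\<Prod>b\<in>(Basis::(real^'n) set). (\<integral>\<^sup>+x. ennreal (?g x) \<partial>lborel))"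
      by (rule nn_integral_lborel_prod) auto
    have "(\<lambda>t. ennreal (?g (t \<bullet> b))) \<in> borel_measurable (lborel :: (real^'n) measure)" for b
      by measurable
    then have m: "(\<lambda>t. \<Prod>b\<in>Basis. ennreal (?g (t \<bullet> b))) \<in> borel_measurable (lborel :: (real^'n) measure)"
      by (rule borel_measurable_prod_ennreal)
    show ?thesis unfolding nn_integral_cmult[OF m] eq by (rule refl)
  qed
  also have "\<dots> = ennreal (\<eta> powr (1 - \<delta>)) * ennreal (1 / \<delta>) ^ CARD('n)"
    unfolding nn_integral_powr_unit_interval[OF \<delta>(1)] by simp
  also have "\<dots> = ennreal (\<eta> powr (1 - \<delta>) * (1 / \<delta>) ^ CARD('n))"
    using \<delta> by (simp add: ennreal_mult ennreal_power)
  finally have em: "emeasure lborel ?P \<le> ennreal (\<eta> powr (1 - \<delta>) * (1 / \<delta>) ^ CARD('n))" .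
  have "emeasure lebesgue A \<le> emeasure lebesgue ?P"
    using A P by (intro emeasure_mono) auto
  also have "\<dots> = emeasure lborel ?P" by (simp add: emeasure_completion)
  also note em
  finally have "emeasure lebesgue A \<le> ennreal (\<eta> powr (1 - \<delta>) * (1 / \<delta>) ^ CARD('n))" .
  then show ?thesis
    unfolding measure_def using \<delta> by (intro enn2real_leI) auto
qed

lemma ex_small_powr:
  fixes c K \<omega> :: real
  assumes "\<omega> > 0" "c > 0"
  obtains \<epsilon>0 where "\<epsilon>0 > 0" "\<And>\<epsilon>. 0 < \<epsilon> \<Longrightarrow> \<epsilon> < \<epsilon>0 \<Longrightarrow> K * \<epsilon> powr \<omega> < c"
proof (rule that[of "(c / (\<bar>K\<bar> + 1)) powr (1 / \<omega>)"])
  fix \<epsilon> :: real assume \<epsilon>: "0 < \<epsilon>" "\<epsilon> < (c / (\<bar>K\<bar> + 1)) powr (1 / \<omega>)"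
  then have "\<epsilon> powr \<omega> < ((c / (\<bar>K\<bar> + 1)) powr (1 / \<omega>)) powr \<omega>"
    using assms by (intro powr_less_mono2) auto
  also have "\<dots> = c / (\<bar>K\<bar> + 1)" using assms by (simp add: powr_powr)
  finally have "\<epsilon> powr \<omega> * (\<bar>K\<bar> + 1) < c" by (simp add: pos_less_divide_eq)
  moreover have "K * \<epsilon> powr \<omega> \<le> \<epsilon> powr \<omega> * (\<bar>K\<bar> + 1)"
  proof -
    have "K * \<epsilon> powr \<omega> \<le> (\<bar>K\<bar> + 1) * \<epsilon> powr \<omega>" by (intro mult_right_mono) auto
    then show ?thesis by (simp add: mult.commute)
  qed
  ultimately show "K * \<epsilon> powr \<omega> < c" by linarith
qed (use assms in auto)

text \<open>If all points of the sublevel set had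
\<open>\<Prod>t\<^sub>i < \<epsilon>\<^bsup>a+\<delta>\<^esup>\<close>, the measure of the set would be at most a constant times
\<open>\<epsilon>\<^bsup>(a+\<delta>)(1-\<delta>')\<^esup> = \<epsilon>\<^bsup>a+\<delta>/2\<^esup>\<close> for a suitable \<open>\<delta>'\<close>, which is less than the growth condition allows. The loss of
\<open>\<delta>\<close> in the exponent makes the logarithm irrelevant.\<close>

lemma sublevel_growth_box:
  fixes S :: "real ^ 'n \<Rightarrow> real"
  assumes growth: "sublevel_growth S a d" and \<delta>: "\<delta> > 0" and r: "r > 0"
  obtains \<epsilon>0 where "\<epsilon>0 > 0"
    "\<And>\<epsilon>. 0 < \<epsilon> \<Longrightarrow> \<epsilon> < \<epsilon>0 \<Longrightarrow>
       \<exists>\<beta>. (\<forall>i. 0 < \<beta> $ i \<and> \<beta> $ i < r) \<and> newton_star S \<beta> < \<epsilon> \<and> \<epsilon> powr (a + \<delta>) \<le> (\<Prod>i\<in>UNIV. \<beta> $ i)"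
proof -
  note growth' = growth[unfolded sublevel_growth_def]
  have a: "a > 0" using growth' by (rule conjunct1)
  obtain r0 where r0: "r0 > 0" "\<And>r. 0 < r \<Longrightarrow> r < r0 \<Longrightarrow> \<exists>b B. 0 < b \<and> 0 < B \<and>
           (\<forall>\<epsilon>. 0 < \<epsilon> \<and> \<epsilon> < 1/2 \<longrightarrow>
              (let \<mu> = measure lebesgue {t. (\<forall>i. 0 < t $ i \<and> t $ i < r) \<and> newton_star S t < \<epsilon>}
               in b * \<epsilon> powr a * \<bar>ln \<epsilon>\<bar> ^ d < \<mu> \<and> \<mu> < B * \<epsilon> powr a * \<bar>ln \<epsilon>\<bar> ^ d))"
    using conjunct2[OF conjunct2[OF growth']] by blast
  define r' where "r' = min r (min (r0 / 2) 1)"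
  have r': "0 < r'" "r' < r0" "r' \<le> r" "r' \<le> 1" using r r0(1) by (auto simp: r'_def)
  let ?A = "\<lambda>\<epsilon>. {t. (\<forall>i. 0 < t $ i \<and> t $ i < r') \<and> newton_star S t < \<epsilon>}"
  obtain b where b: "b > 0" "\<And>\<epsilon>. 0 < \<epsilon> \<Longrightarrow> \<epsilon> < 1/2 \<Longrightarrow> b * \<epsilon> powr a * \<bar>ln \<epsilon>\<bar> ^ d < measure lebesgue (?A \<epsilon>)"
    using r0(2)[OF r'(1,2)] unfolding Let_def by blast
  define \<delta>' where "\<delta>' = (\<delta> / 2) / (a + \<delta>)"
  have \<delta>': "0 < \<delta>'" "\<delta>' < 1" "(a + \<delta>) * (1 - \<delta>') = a + \<delta> / 2"
    using a \<delta> by (auto simp: \<delta>'_def field_simps)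
  define K where "K = (1 / \<delta>') ^ CARD('n)"
  obtain \<epsilon>1 where \<epsilon>1: "\<epsilon>1 > 0" "\<And>\<epsilon>. 0 < \<epsilon> \<Longrightarrow> \<epsilon> < \<epsilon>1 \<Longrightarrow> K * \<epsilon> powr (\<delta> / 2) < b * ln 2 ^ d"
    using ex_small_powr[of "\<delta> / 2" "b * ln 2 ^ d" K] \<delta> b(1) by auto
  show ?thesis
  proof (rule that[of "min \<epsilon>1 (1/2)"])
    fix \<epsilon> :: real assume \<epsilon>: "0 < \<epsilon>" "\<epsilon> < min \<epsilon>1 (1/2)"
    have "\<exists>\<beta>\<in>?A \<epsilon>. \<epsilon> powr (a + \<delta>) \<le> (\<Prod>i\<in>UNIV. \<beta> $ i)"
    proof (rule ccontr)
      assume no: "\<not> ?thesis"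
      have "measure lebesgue (?A \<epsilon>) \<le> (\<epsilon> powr (a + \<delta>)) powr (1 - \<delta>') * K"
        unfolding K_def using \<epsilon> \<delta>' no r' by (intro measure_small_product_le) (auto simp: not_le intro: less_le_trans)
      also have "(\<epsilon> powr (a + \<delta>)) powr (1 - \<delta>') = \<epsilon> powr a * \<epsilon> powr (\<delta> / 2)"
        unfolding powr_powr \<delta>'(3) by (simp add: powr_add)
      also have "\<epsilon> powr a * \<epsilon> powr (\<delta> / 2) * K < \<epsilon> powr a * (b * ln 2 ^ d)"
        using \<epsilon>1(2)[of \<epsilon>] \<epsilon> by (simp add: mult_ac)
      also have "\<dots> \<le> b * \<epsilon> powr a * \<bar>ln \<epsilon>\<bar> ^ d"
      proof -
        have "ln \<epsilon> \<le> ln (1/2)" using \<epsilon> by (subst ln_le_cancel_iff) auto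
        then have "ln 2 \<le> \<bar>ln \<epsilon>\<bar>" by (simp add: ln_div)
        then have "ln 2 ^ d \<le> \<bar>ln \<epsilon>\<bar> ^ d" by (intro power_mono) auto
        then show ?thesis unfolding mult.assoc[symmetric] mult.commute[of "\<epsilon> powr a" b]
          using b(1) by (intro mult_left_mono) auto
      qed
      also have "\<dots> < measure lebesgue (?A \<epsilon>)" using \<epsilon> by (intro b(2)) auto
      finally show False .
    qed
    then show "\<exists>\<beta>. (\<forall>i. 0 < \<beta> $ i \<and> \<beta> $ i < r) \<and> newton_star S \<beta> < \<epsilon> \<and> \<epsilon> powr (a + \<delta>) \<le> (\<Prod>i\<in>UNIV. \<beta> $ i)"
      using r'(3) by (auto intro: less_le_trans)
  qed (use \<epsilon>1 in auto)
qed

section \<open>Lower bound for averages of the oscillating Gaussian\<close>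

lemma prod_Basis_prod:
  "(\<Prod>b\<in>(Basis :: ('a::euclidean_space \<times> 'b::euclidean_space) set). f b) = (\<Prod>i\<in>Basis. f (i, 0)) * (\<Prod>j\<in>Basis. f (0, j))"
proof -
  have d: "(\<lambda>u. (u, 0)) ` Basis \<inter> (\<lambda>v. (0, v)) ` Basis = ({} :: ('a \<times> 'b) set)"
    by (auto simp: nonzero_Basis)
  have i: "inj_on (\<lambda>u. (u, 0 :: 'b)) (Basis :: 'a set)" "inj_on (\<lambda>v. (0 :: 'a, v)) (Basis :: 'b set)"
    by (auto simp: inj_on_def)
  show ?thesis
    unfolding Basis_prod_def by (simp add: prod.union_disjoint d prod.reindex i o_def)
qed

lemma wave_last_coordinate:
  fixes w :: "'a::euclidean_space \<times> real \<Rightarrow> real"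
  shows "wave (0, 1) w (x, y) = herm (w (0, 1)) y * bump (\<lambda>b. w (b, 0)) x"
proof -
  have "wave (0, 1) w (x, y) = (\<Prod>i\<in>Basis. (if (i, 0 :: real) = (0, 1) then herm else gauss) (w (i, 0)) (x \<bullet> i)) * herm (w (0, 1)) y"
    unfolding wave_def prod_Basis_prod by (simp add: inner_Pair)
  also have "(\<Prod>i\<in>Basis. (if (i, 0 :: real) = (0, 1) then herm else gauss) (w (i, 0)) (x \<bullet> i)) = bump (\<lambda>b. w (b, 0)) x"
    unfolding bump_def by (intro prod.cong) auto
  finally show ?thesis by simp
qed

lemma integral_bump:
  fixes w :: "'a::euclidean_space \<Rightarrow> real"
  assumes "\<And>b. b \<in> Basis \<Longrightarrow> w b > 0"
  shows "(LINT x|lborel. bump w x) = sqrt (2 * pi) ^ DIM('a)"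
proof -
  have "(LINT x|lborel. iexp (x \<bullet> 0) * complex_of_real (bump w x)) = of_real (sqrt (2 * pi) ^ DIM('a) * exp (- quad w 0 / 2))"
    by (rule fourier_bump) (use assms in auto)
  then have "(LINT x|lborel. complex_of_real (bump w x)) = of_real (sqrt (2 * pi) ^ DIM('a))"
    by (simp add: quad_def)
  then show ?thesis unfolding integral_complex_of_real of_real_eq_iff .
qed

lemma herm_ge:
  assumes w: "w > 0" and y: "y\<^sup>2 \<le> w / 4"
  shows "1 / (w\<^sup>2 * sqrt w) \<le> herm w y"
proof -
  define z where "z = y\<^sup>2 / w"
  have z: "0 \<le> z" "z \<le> 1/4" using w y by (auto simp: z_def field_simps)
  have poly: "y ^ 4 / w\<^sup>2 - 6 * y\<^sup>2 / w + 3 = z\<^sup>2 - 6 * z + 3"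
    by (simp add: z_def power_divide flip: power_mult)
  have e: "- y\<^sup>2 / (2 * w) = - z / 2" using w by (simp add: z_def)
  have "1 \<le> 3 / 2 * (7 / 8 :: real)" by simp
  also have "\<dots> \<le> (z\<^sup>2 - 6 * z + 3) * exp (- z / 2)"
  proof (intro mult_mono)
    show "3 / 2 \<le> z\<^sup>2 - 6 * z + 3" using z zero_le_power2[of z] by linarith
    show "7 / 8 \<le> exp (- z / 2)" using exp_ge_add_one_self[of "- z / 2"] z by linarith
    then show "0 \<le> z\<^sup>2 - 6 * z + 3" using z zero_le_power2[of z] by linarith
  qed auto
  finally have "1 / (w\<^sup>2 * sqrt w) \<le> ((z\<^sup>2 - 6 * z + 3) * exp (- z / 2)) / (w\<^sup>2 * sqrt w)"
    using w by (intro divide_right_mono) auto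
  then show ?thesis unfolding herm_def gauss_def poly e by (simp add: mult.commute)
qed

lemma abs_herm_le_const:
  assumes w: "w > 0"
  shows "\<bar>herm w y\<bar> \<le> 100 / (w\<^sup>2 * sqrt w)"
proof -
  have "gauss (2 * w) y \<le> 1 / sqrt (2 * w)"
    unfolding gauss_def using w by (intro divide_right_mono) auto
  also have "\<dots> \<le> 1 / sqrt w" using w by (intro divide_left_mono) auto
  finally have "100 * gauss (2 * w) y / w\<^sup>2 \<le> 100 * (1 / sqrt w) / w\<^sup>2"
    using w by (intro divide_right_mono mult_left_mono) auto
  then show ?thesis using abs_herm_le[OF w, of y] by (simp add: mult.commute)
qed

lemma square_mult_gauss_le:
  assumes w: "w > 0"
  shows "x\<^sup>2 / w * gauss w x \<le> 8 * gauss (2 * w) x"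
proof -
  define y where "y = x\<^sup>2 / (4 * w)"
  have y: "0 \<le> y" "x\<^sup>2 / w = 4 * y" using w by (auto simp: y_def)
  have le: "y \<le> exp y" using exp_ge_add_one_self[of y] by linarith
  have "- x\<^sup>2 / (2 * w) = - y + - x\<^sup>2 / (2 * (2 * w))" using w by (simp add: y_def field_simps)
  then have e: "exp (- x\<^sup>2 / (2 * w)) = exp (- y) * exp (- x\<^sup>2 / (2 * (2 * w)))" by (simp only: exp_add)
  have g: "exp y * gauss w x = sqrt 2 * gauss (2 * w) x"
    using w unfolding gauss_def e by (simp add: real_sqrt_mult exp_minus)
  have "x\<^sup>2 / w * gauss w x \<le> 4 * exp y * gauss w x"
    unfolding y(2) using le gauss_nonneg[OF w, of x] by (intro mult_right_mono) auto
  also have "\<dots> = 4 * sqrt 2 * gauss (2 * w) x" using g by simp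
  also have "\<dots> \<le> 8 * gauss (2 * w) x"
  proof (intro mult_right_mono)
    have "sqrt 2 \<le> 2" by (rule real_le_lsqrt) auto
    then show "4 * sqrt 2 \<le> 8" by simp
  qed (use gauss_nonneg[of "2 * w" x] w in auto)
  finally show ?thesis .
qed

lemma square_mult_bump_le:
  fixes w :: "'a::euclidean_space \<Rightarrow> real"
  assumes w: "\<And>b. b \<in> Basis \<Longrightarrow> w b > 0" and b: "b \<in> Basis"
  shows "(x \<bullet> b)\<^sup>2 / w b * bump w x \<le> 8 * 2 ^ DIM('a) * bump (\<lambda>b. 2 * w b) x"
proof -
  let ?g = "\<lambda>b. gauss (2 * w b) (x \<bullet> b)"
  have nn: "?g c \<ge> 0" if "c \<in> Basis" for c using w[OF that] by (intro gauss_nonneg) auto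
  have "(x \<bullet> b)\<^sup>2 / w b * bump w x = ((x \<bullet> b)\<^sup>2 / w b * gauss (w b) (x \<bullet> b)) * (\<Prod>c\<in>Basis - {b}. gauss (w c) (x \<bullet> c))"
    unfolding bump_def by (subst prod.remove[OF _ b]) auto
  also have "\<dots> \<le> (8 * ?g b) * (\<Prod>c\<in>Basis - {b}. 2 * ?g c)"
    using w b nn by (intro mult_mono square_mult_gauss_le prod_mono) (auto intro!: gauss_le_double gauss_nonneg prod_nonneg)
  also have "\<dots> = 8 * 2 ^ card (Basis - {b}) * (?g b * (\<Prod>c\<in>Basis - {b}. ?g c))"
    by (simp add: prod.distrib)
  also have "?g b * (\<Prod>c\<in>Basis - {b}. ?g c) = bump (\<lambda>b. 2 * w b) x"
    unfolding bump_def by (rule prod.remove[symmetric]) (use b in auto)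
  also have "8 * 2 ^ card (Basis - {b}) * bump (\<lambda>b. 2 * w b) x \<le> 8 * 2 ^ DIM('a) * bump (\<lambda>b. 2 * w b) x"
    using w b by (intro mult_right_mono mult_left_mono power_increasing less_imp_le[OF bump_pos]) (auto intro: card_mono)
  finally show ?thesis .
qed

text \<open>Variances adapted to the box with half-sides \<open>\<beta>\<^sub>i\<close> and height \<open>\<epsilon>\<close>: on basis vectors, \<open>(\<beta>\<^sub>i / M)\<^sup>2\<close>
in the direction of the \<open>i\<close>-th coordinate and \<open>\<epsilon>\<^sup>2\<close> in the last direction.\<close>

definition box_scales :: "real \<Rightarrow> (real ^ 'n) \<Rightarrow> real \<Rightarrow> (real ^ 'n) \<times> real \<Rightarrow> real" where
  "box_scales M \<beta> \<epsilon> b = ((fst b \<bullet> \<beta>) / M)\<^sup>2 + (snd b * \<epsilon>)\<^sup>2"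

text \<open>On the box, \<open>\<bar>\<sigma> t\<bar>\<close> is so small that the factor \<open>herm\<close> is positive, and \<open>k \<ge> C1\<close>. Off the box the
sign of the integrand is unknown, but each half-side is at least \<open>M / 2\<close> standard deviations, so by
Chebyshev's inequality the Gaussian mass there is at most a constant times \<open>1 / M\<^sup>2\<close>. For large \<open>M\<close>,
depending on \<open>k\<close> but not on the box, the first part wins. The shift \<open>v \<le> \<epsilon>\<^sup>2\<close> changes the variances at
most by a factor \<open>2\<close> because \<open>\<epsilon> \<le> \<beta>\<^sub>i / M\<close>.\<close>

lemma integral_wave_lower_bound:
  fixes k \<sigma> :: "real ^ 'n \<Rightarrow> real"
  assumes \<sigma>[measurable]: "\<sigma> \<in> borel_measurable borel" and k: "integrable lborel k"
    and C: "\<And>t. \<bar>k t\<bar> \<le> C" and C1: "C1 > 0" and r: "r > 0"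
    and low: "AE t in lborel. (\<forall>i. \<bar>t $ i\<bar> < r) \<longrightarrow> C1 \<le> k t"
  obtains M c where "M \<ge> 1" "c > 0"
    "\<And>\<beta> \<epsilon> v. (\<And>i. 0 < \<beta> $ i) \<Longrightarrow> (\<And>i. \<beta> $ i < r) \<Longrightarrow> 0 < \<epsilon> \<Longrightarrow> (\<And>i. M * \<epsilon> \<le> \<beta> $ i) \<Longrightarrow>
       (\<And>t. (\<And>i. \<bar>t $ i\<bar> \<le> \<beta> $ i) \<Longrightarrow> \<bar>\<sigma> t\<bar> \<le> \<epsilon> / 2) \<Longrightarrow> 0 \<le> v \<Longrightarrow> v \<le> \<epsilon>\<^sup>2 \<Longrightarrow>
       c / \<epsilon> ^ 5 \<le> (LINT t|lborel. k t * wave (0, 1) (\<lambda>b. 2 * (box_scales M \<beta> \<epsilon> b + v)) (t, \<sigma> t))"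
proof -
  let ?n = "DIM(real ^ 'n)"
  define Q where "Q = C1 + 100 * C"
  have C0: "C \<ge> 0" using C[of 0] by linarith
  have Q: "Q > 0" using C0 C1 by (simp add: Q_def)
  \<comment> \<open>\<open>T / M\<^sup>2\<close> bounds the contribution from outside the box relative to that of the whole
    Gaussian, and \<open>M\<close> is chosen to make it at most \<open>C1 / 2\<close>.\<close>
  define T where "T = Q * real CARD('n) * (4 * (8 * 2 ^ ?n))"
  have T: "T \<ge> 0" using Q by (simp add: T_def)
  define M where "M = 1 + 2 * T / C1"
  have M: "M \<ge> 1" using T C1 by (simp add: M_def)
  have MT: "T / M\<^sup>2 \<le> C1 / 2"
  proof -
    have "2 * T \<le> C1 * M" using C1 by (simp add: M_def algebra_simps)
    also have "\<dots> \<le> C1 * M\<^sup>2" using M C1 by (intro mult_left_mono) (auto simp: power2_eq_square)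
    finally show ?thesis using M by (simp add: field_simps)
  qed
  have km[measurable]: "k \<in> borel_measurable borel" using k by auto
  show ?thesis
  proof (rule that[of M "C1 / 64"])
    fix \<beta> :: "real ^ 'n" and \<epsilon> v :: real
    assume \<beta>: "\<And>i. 0 < \<beta> $ i" "\<And>i. \<beta> $ i < r" and \<epsilon>: "0 < \<epsilon>" "\<And>i. M * \<epsilon> \<le> \<beta> $ i"
      and small: "\<And>t. (\<And>i. \<bar>t $ i\<bar> \<le> \<beta> $ i) \<Longrightarrow> \<bar>\<sigma> t\<bar> \<le> \<epsilon> / 2" and v: "0 \<le> v" "v \<le> \<epsilon>\<^sup>2"
    let ?w = "\<lambda>b. 2 * (box_scales M \<beta> \<epsilon> b + v)"
    define w0 where "w0 = ?w (0, 1)"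
    define w1 where "w1 = (\<lambda>b::real^'n. ?w (b, 0))"
    have w0: "w0 = 2 * (\<epsilon>\<^sup>2 + v)" by (simp add: w0_def box_scales_def)
    have w0_bounds: "2 * \<epsilon>\<^sup>2 \<le> w0" "w0 \<le> 4 * \<epsilon>\<^sup>2" "w0 > 0" using v \<epsilon>(1) by (auto simp: w0 add_pos_nonneg)
    have w1_axis: "w1 (axis i 1) = 2 * ((\<beta> $ i / M)\<^sup>2 + v)" for i
      by (simp add: w1_def box_scales_def inner_axis' )
    have w1_le: "w1 (axis i 1) \<le> 4 * (\<beta> $ i / M)\<^sup>2" for i
    proof -
      have "\<epsilon> \<le> \<beta> $ i / M" using \<epsilon>(2)[of i] M by (simp add: field_simps)
      then have "\<epsilon>\<^sup>2 \<le> (\<beta> $ i / M)\<^sup>2" using \<epsilon>(1) by (intro power_mono) auto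
      moreover have "2 * (x + v) \<le> 4 * x" if "\<epsilon>\<^sup>2 \<le> x" for x
        using order_trans[OF v(2) that] by simp
      ultimately show ?thesis unfolding w1_axis by blast
    qed
    have w1_pos': "w1 (axis i 1) > 0" for i unfolding w1_axis using \<beta>(1)[of i] M v by (auto intro!: add_pos_nonneg)
    have w1_pos: "w1 b > 0" if "b \<in> Basis" for b using that w1_pos' by (auto simp: Basis_vec_def)
    have w2_pos: "2 * w1 b > 0" if "b \<in> Basis" for b using w1_pos[OF that] by simp
    let ?g = "bump w1" let ?G = "bump (\<lambda>b. 2 * w1 b)"
    have g: "?g t \<ge> 0" for t using bump_pos[of w1 t] w1_pos by (simp add: less_imp_le)
    have G: "?G t \<ge> 0" for t using bump_pos[of "\<lambda>b. 2 * w1 b" t] w2_pos by (simp add: less_imp_le)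
    define N where "N = 1 / (w0\<^sup>2 * sqrt w0)"
    have N: "N > 0" using w0_bounds(3) by (simp add: N_def)
    have tail: "?g t \<le> 4 / M\<^sup>2 * (8 * 2 ^ ?n) * ?G t" if out: "\<bar>t $ i\<bar> > \<beta> $ i" for t i
    proof -
      have "(\<beta> $ i)\<^sup>2 \<le> (t $ i)\<^sup>2" using out \<beta>(1)[of i] by (simp add: abs_le_square_iff[symmetric])
      moreover have "w1 (axis i 1) * M\<^sup>2 / 4 \<le> (\<beta> $ i)\<^sup>2" using w1_le[of i] M by (simp add: power_divide field_simps)
      ultimately have "M\<^sup>2 / 4 \<le> (t $ i)\<^sup>2 / w1 (axis i 1)" using w1_pos'[of i] by (simp add: field_simps)
      then have "M\<^sup>2 / 4 * ?g t \<le> (t $ i)\<^sup>2 / w1 (axis i 1) * ?g t" using g[of t] by (intro mult_right_mono)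
      also have "\<dots> = (t \<bullet> axis i 1)\<^sup>2 / w1 (axis i 1) * ?g t" by (simp add: inner_axis)
      also have "\<dots> \<le> 8 * 2 ^ ?n * ?G t" by (rule square_mult_bump_le) (use w1_pos in auto)
      finally show ?thesis using M by (simp add: field_simps)
    qed
    have pt: "N * (C1 * ?g t - T / M\<^sup>2 * ?G t) \<le> k t * wave (0, 1) ?w (t, \<sigma> t)"
      if kt: "(\<forall>i. \<bar>t $ i\<bar> < r) \<longrightarrow> C1 \<le> k t" for t
    proof -
      have wv: "wave (0, 1) ?w (t, \<sigma> t) = herm w0 (\<sigma> t) * ?g t"
        unfolding wave_last_coordinate w0_def w1_def ..
      show ?thesis
      proof (cases "\<forall>i. \<bar>t $ i\<bar> \<le> \<beta> $ i")
        case True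
        then have "\<bar>\<sigma> t\<bar> \<le> \<epsilon> / 2" using small by blast
        then have "(\<sigma> t)\<^sup>2 \<le> (\<epsilon> / 2)\<^sup>2" using \<epsilon>(1) by (simp add: abs_le_square_iff[symmetric])
        then have "(\<sigma> t)\<^sup>2 \<le> \<epsilon>\<^sup>2 / 4" by (simp add: power_divide)
        then have "(\<sigma> t)\<^sup>2 \<le> w0 / 4" using w0_bounds(1) zero_le_power2[of \<epsilon>] by linarith
        then have "N \<le> herm w0 (\<sigma> t)" unfolding N_def by (rule herm_ge[OF w0_bounds(3)])
        moreover have "C1 \<le> k t" using True kt \<beta>(2) by (meson le_less_trans)
        ultimately have "C1 * N \<le> k t * herm w0 (\<sigma> t)" using C1 N by (intro mult_mono) auto
        then have "C1 * N * ?g t \<le> k t * herm w0 (\<sigma> t) * ?g t" using g[of t] by (intro mult_right_mono)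
        moreover have "0 \<le> N * (T / M\<^sup>2 * ?G t)" using N T G by auto
        ultimately show ?thesis unfolding wv by (simp add: algebra_simps)
      next
        case False
        then obtain i where i: "\<bar>t $ i\<bar> > \<beta> $ i" by (auto simp: not_le)
        have "\<bar>k t * herm w0 (\<sigma> t)\<bar> \<le> C * (100 * N)"
          unfolding abs_mult using C[of t] abs_herm_le_const[OF w0_bounds(3), of "\<sigma> t"] by (intro mult_mono) (auto simp: N_def)
        then have "- (C * (100 * N)) \<le> k t * herm w0 (\<sigma> t)" by linarith
        then have "- (C * (100 * N)) * ?g t \<le> k t * herm w0 (\<sigma> t) * ?g t" using g[of t] by (intro mult_right_mono)
        moreover have "Q * ?g t \<le> T / M\<^sup>2 * ?G t"
        proof -
          have "Q * ?g t \<le> Q * (4 / M\<^sup>2 * (8 * 2 ^ ?n) * ?G t)" using tail[OF i] Q by (intro mult_left_mono) auto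
          also have "\<dots> \<le> real CARD('n) * (Q * (4 / M\<^sup>2 * (8 * 2 ^ ?n) * ?G t))"
          proof -
            have "1 * x \<le> real CARD('n) * x" if "x \<ge> 0" for x
              using that by (intro mult_right_mono) (auto simp: Suc_le_eq)
            from this[of "Q * (4 / M\<^sup>2 * (8 * 2 ^ ?n) * ?G t)"] show ?thesis using Q G[of t] by simp
          qed
          finally show ?thesis by (simp add: T_def mult_ac)
        qed
        then have "N * (Q * ?g t) \<le> N * (T / M\<^sup>2 * ?G t)" using N by (intro mult_left_mono) auto
        ultimately show ?thesis unfolding wv Q_def by (simp add: algebra_simps)
      qed
    qed
    have gi: "integrable lborel ?g" by (rule integrable_bump) (use w1_pos in auto)
    have Gi: "integrable lborel ?G" by (rule integrable_bump) (use w2_pos in auto)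
    have ki: "integrable lborel (\<lambda>t. k t * wave (0, 1) ?w (t, \<sigma> t))"
    proof (rule Bochner_Integration.integrable_bound)
      show "integrable lborel (\<lambda>t. (C * (100 * N)) * ?g t)" by (intro integrable_mult_right gi)
      show "(\<lambda>t. k t * wave (0, 1) ?w (t, \<sigma> t)) \<in> borel_measurable lborel" by measurable
      show "AE t in lborel. norm (k t * wave (0, 1) ?w (t, \<sigma> t)) \<le> norm ((C * (100 * N)) * ?g t)"
      proof (intro AE_I2)
        fix t
        have "\<bar>k t\<bar> * \<bar>herm w0 (\<sigma> t)\<bar> \<le> C * (100 * N)"
          using C[of t] abs_herm_le_const[OF w0_bounds(3), of "\<sigma> t"] by (intro mult_mono) (auto simp: N_def)
        then have "\<bar>k t\<bar> * \<bar>herm w0 (\<sigma> t)\<bar> * ?g t \<le> C * (100 * N) * ?g t" using g[of t] by (intro mult_right_mono)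
        then show "norm (k t * wave (0, 1) ?w (t, \<sigma> t)) \<le> norm ((C * (100 * N)) * ?g t)"
          unfolding wave_last_coordinate w0_def[symmetric] w1_def[symmetric]
          using g[of t] N C0 by (simp add: abs_mult mult_ac)
      qed
    qed
    have S: "sqrt (2 * pi) ^ ?n \<ge> 1"
    proof -
      have "1 \<le> sqrt (2 * pi)" using pi_gt3 by simp
      then show ?thesis by (rule one_le_power)
    qed
    have "C1 / 64 / \<epsilon> ^ 5 \<le> N * (C1 / 2)"
    proof -
      have "w0\<^sup>2 * sqrt w0 \<le> (4 * \<epsilon>\<^sup>2)\<^sup>2 * sqrt (4 * \<epsilon>\<^sup>2)"
        using w0_bounds \<epsilon>(1) by (intro mult_mono power_mono) auto
      also have "sqrt (4 * \<epsilon>\<^sup>2) = 2 * \<epsilon>" using \<epsilon>(1) by (simp add: real_sqrt_mult)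
      also have "(4 * \<epsilon>\<^sup>2)\<^sup>2 * (2 * \<epsilon>) = 32 * \<epsilon> ^ 5" by (simp add: power_mult_distrib eval_nat_numeral)
      finally have "1 / (32 * \<epsilon> ^ 5) \<le> N"
        unfolding N_def using w0_bounds(3) \<epsilon>(1) by (intro divide_left_mono) auto
      then have "1 / (32 * \<epsilon> ^ 5) * (C1 / 2) \<le> N * (C1 / 2)" using C1 by (intro mult_right_mono) auto
      then show ?thesis by (simp add: mult_ac)
    qed
    also have "\<dots> \<le> N * (C1 - T / M\<^sup>2)" using MT N by (intro mult_left_mono) auto
    also have "\<dots> = N * (C1 - T / M\<^sup>2) * 1" by simp
    also have "\<dots> \<le> N * (C1 - T / M\<^sup>2) * sqrt (2 * pi) ^ ?n"
    proof (intro mult_left_mono mult_nonneg_nonneg)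
      show "0 \<le> C1 - T / M\<^sup>2" using MT C1 by linarith
    qed (use S N in auto)
    also have "\<dots> = (LINT t|lborel. N * (C1 * ?g t - T / M\<^sup>2 * ?G t))"
    proof -
      have "(LINT t|lborel. ?g t) = sqrt (2 * pi) ^ ?n" by (rule integral_bump) (use w1_pos in auto)
      moreover have "(LINT t|lborel. ?G t) = sqrt (2 * pi) ^ ?n" by (rule integral_bump) (use w2_pos in auto)
      ultimately show ?thesis using gi Gi by (simp add: algebra_simps)
    qed
    also have "\<dots> \<le> (LINT t|lborel. k t * wave (0, 1) ?w (t, \<sigma> t))"
    proof (rule integral_mono_AE)
      show "integrable lborel (\<lambda>t. N * (C1 * ?g t - T / M\<^sup>2 * ?G t))"
        by (intro integrable_mult_right Bochner_Integration.integrable_diff gi Gi)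
      show "AE t in lborel. N * (C1 * ?g t - T / M\<^sup>2 * ?G t) \<le> k t * wave (0, 1) ?w (t, \<sigma> t)"
        using low by eventually_elim (rule pt)
    qed (rule ki)
    finally show "C1 / 64 / \<epsilon> ^ 5 \<le> (LINT t|lborel. k t * wave (0, 1) ?w (t, \<sigma> t))" .
  qed (use M C1 in auto)
qed

section \<open>The condition on the order of smoothing\<close>

lemma lebesgue_integral_eq_off_null:
  fixes g h :: "'a::euclidean_space \<Rightarrow> complex"
  assumes g: "g \<in> borel_measurable borel" and N: "N \<in> null_sets lebesgue" and eq: "\<And>x. x \<notin> N \<Longrightarrow> h x = g x"
  shows "(LINT x|lebesgue. h x) = (LINT x|lborel. g x)"
proof -
  have gl: "g \<in> borel_measurable lebesgue" using g by (simp add: measurable_completion)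
  have hl: "h \<in> borel_measurable lebesgue"
  proof (rule measurableI)
    fix B :: "complex set" assume B: "B \<in> sets borel"
    have "h -` B = (g -` B - N) \<union> (h -` B \<inter> N)" using eq by auto
    moreover have "g -` B - N \<in> sets lebesgue"
      using measurable_sets[OF gl B] N by (auto simp: null_sets_def)
    moreover have "h -` B \<inter> N \<in> sets lebesgue"
      using N negligible_subset[of N "h -` B \<inter> N"] by (auto simp: negligible_iff_null_sets[symmetric] negligible_imp_sets)
    ultimately have "h -` B \<in> sets lebesgue" by (metis sets.Un)
    then show "h -` B \<inter> space lebesgue \<in> sets lebesgue" by simp
  qed simp
  have "AE x in lebesgue. h x = g x"
    using N eq by (auto simp: eventually_ae_filter intro!: bexI[of _ N])
  then have "(LINT x|lebesgue. h x) = (LINT x|lebesgue. g x)"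
    by (rule integral_cong_AE[OF hl gl])
  also have "\<dots> = (LINT x|lborel. g x)" by (rule integral_completion) (use g in simp)
  finally show ?thesis .
qed

lemma null_coordinate_hyperplanes: "{t :: real ^ 'n. \<exists>i. t $ i = 0} \<in> null_sets lborel"
proof -
  have "{t :: real ^ 'n. t $ i = 0} \<in> null_sets lborel" for i
  proof -
    have "negligible {t :: real ^ 'n. axis i 1 \<bullet> t = 0}"
      by (rule negligible_hyperplane) (simp add: axis_eq_0_iff)
    then have "{t :: real ^ 'n. t $ i = 0} \<in> null_sets lebesgue"
      by (simp add: negligible_iff_null_sets inner_axis')
    moreover have "{t :: real ^ 'n. t $ i = 0} \<in> sets borel"
      by (intro borel_closed closed_Collect_eq continuous_intros)
    ultimately show ?thesis by (simp add: null_sets_completion_iff)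
  qed
  then have "(\<Union>i. {t :: real ^ 'n. t $ i = 0}) \<in> null_sets lborel" by (intro null_sets_UN') auto
  moreover have "(\<Union>i. {t :: real ^ 'n. t $ i = 0}) = {t. \<exists>i. t $ i = 0}" by auto
  ultimately show ?thesis by simp
qed

text \<open>With \<open>\<theta> = 1 - 1/p + 1/q\<close>, the hypothesis on \<open>s\<close> says that \<open>\<kappa>0 = ((a + 1) \<theta> + 1) / 2\<close> is smaller than
\<open>s/2 + 1\<close>. As \<open>a \<le> 1/2\<close> and \<open>\<theta> < 2\<close>, it is also smaller than \<open>2\<close>. So \<open>\<kappa>\<close> fits in between, and \<open>\<delta>\<close>
only has to be small compared with \<open>\<kappa> - \<kappa>0\<close>.\<close>

lemma choose_exponents:
  fixes a \<theta> s :: real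
  assumes a: "0 < a" "a \<le> 1/2" and \<theta>: "0 < \<theta>" "\<theta> < 2" and s: "s > (a + 1) * \<theta> - 1"
  obtains \<kappa> \<delta> where "0 \<le> \<kappa>" "\<kappa> \<le> 2" "\<kappa> < s / 2 + 1" "\<delta> > 0" "a + \<delta> < 1" "2 * \<kappa> - 1 - \<theta> * (1 + a + \<delta>) > 0"
proof -
  define \<kappa>0 where "\<kappa>0 = ((a + 1) * \<theta> + 1) / 2"
  have "(a + 1) * \<theta> < (3 / 2) * 2" using a \<theta> by (intro mult_le_less_imp_less) auto
  moreover have "0 < (a + 1) * \<theta>" using a \<theta> by simp
  ultimately have \<kappa>0: "0 < \<kappa>0" "\<kappa>0 < 2" "\<kappa>0 < s / 2 + 1" using s by (auto simp: \<kappa>0_def)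
  define \<kappa> where "\<kappa> = (\<kappa>0 + min 2 (s / 2 + 1)) / 2"
  have \<kappa>: "\<kappa>0 < \<kappa>" "\<kappa> \<le> 2" "\<kappa> < s / 2 + 1" using \<kappa>0 by (auto simp: \<kappa>_def)
  define \<delta> where "\<delta> = min (1/4) ((\<kappa> - \<kappa>0) / \<theta>)"
  have \<delta>: "\<delta> > 0" using \<kappa> \<theta> by (auto simp: \<delta>_def)
  have \<delta>': "\<delta> \<le> 1/4" unfolding \<delta>_def by (rule min.cobounded1)
  have "\<theta> * \<delta> \<le> \<theta> * ((\<kappa> - \<kappa>0) / \<theta>)" using \<theta> by (intro mult_left_mono) (auto simp: \<delta>_def)
  then have "\<theta> * \<delta> \<le> \<kappa> - \<kappa>0" using \<theta> by simp
  moreover have "2 * \<kappa>0 = (a + 1) * \<theta> + 1" by (simp add: \<kappa>0_def)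
  ultimately have "2 * \<kappa> - 1 - \<theta> * (1 + a + \<delta>) > 0" using \<kappa>(1) by (simp add: algebra_simps)
  then show ?thesis using that[of \<kappa> \<delta>] \<kappa> \<kappa>0 \<delta> \<delta>' a by auto
qed

text \<open>The boxes supply, for small \<open>\<epsilon>\<close>, Gaussians for which \<open>integral_wave_lower_bound\<close> and
\<open>pairing_lower_bound_le\<close> give \<open>c \<le> K \<epsilon>\<^sup>\<omega>\<close>, where \<open>\<omega> = 2\<kappa> - 1 - \<theta> (1 + a + \<delta>)\<close>. When \<open>s\<close> exceeds the
critical value, \<open>\<omega>\<close> can be made positive, which is absurd as \<open>\<epsilon> \<rightarrow> 0\<close>.\<close>

lemma averaging_graph_bound_implies_order_le:
  fixes k \<sigma> :: "real ^ 'n \<Rightarrow> real"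
  assumes \<sigma>[measurable]: "\<sigma> \<in> borel_measurable borel" and k: "integrable lborel k"
    and C: "\<And>t. \<bar>k t\<bar> \<le> C" and C1: "C1 > 0" and r: "r > 0"
    and low: "AE t in lborel. (\<forall>i. \<bar>t $ i\<bar> < r) \<longrightarrow> C1 \<le> k t"
    and a: "0 < a" "a \<le> 1/2"
    and boxes: "\<And>\<delta>. \<delta> > 0 \<Longrightarrow> \<exists>L>0. \<exists>\<epsilon>0>0. \<forall>\<epsilon>. 0 < \<epsilon> \<and> \<epsilon> < \<epsilon>0 \<longrightarrow>
       (\<exists>\<beta>. (\<forall>i. 0 < \<beta> $ i \<and> \<beta> $ i < min r 1) \<and> (\<forall>t. (\<forall>i. \<bar>t $ i\<bar> \<le> \<beta> $ i) \<longrightarrow> \<bar>\<sigma> t\<bar> \<le> \<epsilon> / 2) \<and>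
          L * \<epsilon> powr (a + \<delta>) \<le> (\<Prod>i\<in>UNIV. \<beta> $ i))"
    and p: "p > 1" and q: "q > 1"
    and bdd: "bounded_Lp_Sobolev (conv_op (\<lambda>t. (t, \<sigma> t)) k) p q s"
  shows "s \<le> (a + 1) * (1 - 1 / p + 1 / q) - 1"
proof (rule ccontr)
  assume neg: "\<not> ?thesis"
  define \<theta> where "\<theta> = 1 - 1 / p + 1 / q"
  have "0 < 1 / p" "1 / p < 1" "0 < 1 / q" "1 / q < 1" using p q by auto
  then have \<theta>: "0 < \<theta>" "\<theta> < 2" unfolding \<theta>_def by linarith+
  have s: "s > (a + 1) * \<theta> - 1" using neg by (simp add: \<theta>_def)
  obtain \<kappa> \<delta> where \<kappa>: "0 \<le> \<kappa>" "\<kappa> \<le> 2" "\<kappa> < s / 2 + 1"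
    and \<delta>: "\<delta> > 0" "a + \<delta> < 1" and \<omega>: "2 * \<kappa> - 1 - \<theta> * (1 + a + \<delta>) > 0"
    using choose_exponents[OF a \<theta> s] by blast
  define \<omega> where "\<omega> = 2 * \<kappa> - 1 - \<theta> * (1 + a + \<delta>)"
  have "0 < (a + 1) * \<theta>" using a \<theta> by simp
  then have s2: "s > -2" using s by linarith
  have \<gamma>: "(\<lambda>t. (t, \<sigma> t)) \<in> borel_measurable borel" by measurable
  have e: "(0, 1) \<in> (Basis :: ((real ^ 'n) \<times> real) set)" by (simp add: Basis_prod_def)
  obtain A where A: "A \<ge> 0"
    "\<And>w \<delta> c. (\<And>b. b \<in> Basis \<Longrightarrow> w b > 0) \<Longrightarrow> 0 < \<delta> \<Longrightarrow> \<delta> \<le> 1 \<Longrightarrow> 0 \<le> c \<Longrightarrow>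
       (\<And>v. 0 \<le> v \<Longrightarrow> v \<le> \<delta> \<Longrightarrow> c \<le> (LINT t|lborel. k t * wave (0, 1) (\<lambda>b. 2 * (w b + v)) (t, \<sigma> t))) \<Longrightarrow>
       c * \<delta> \<le> A * (\<Prod>b\<in>Basis. w b) powr ((1 / p - 1 / q - 1) / 2) * w (0, 1) powr (\<kappa> - 2)"
    using pairing_lower_bound_le[OF \<gamma> k bdd p q e s2 \<kappa>] by blast
  obtain M c where M: "M \<ge> 1" and c: "c > 0" and lower:
    "\<And>\<beta> \<epsilon> v. (\<And>i. 0 < \<beta> $ i) \<Longrightarrow> (\<And>i. \<beta> $ i < r) \<Longrightarrow> 0 < \<epsilon> \<Longrightarrow> (\<And>i. M * \<epsilon> \<le> \<beta> $ i) \<Longrightarrow>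
       (\<And>t. (\<And>i. \<bar>t $ i\<bar> \<le> \<beta> $ i) \<Longrightarrow> \<bar>\<sigma> t\<bar> \<le> \<epsilon> / 2) \<Longrightarrow> 0 \<le> v \<Longrightarrow> v \<le> \<epsilon>\<^sup>2 \<Longrightarrow>
       c / \<epsilon> ^ 5 \<le> (LINT t|lborel. k t * wave (0, 1) (\<lambda>b. 2 * (box_scales M \<beta> \<epsilon> b + v)) (t, \<sigma> t))"
    using integral_wave_lower_bound[OF \<sigma> k C C1 r low] by blast
  obtain L \<epsilon>0 where L: "L > 0" and \<epsilon>0: "\<epsilon>0 > 0" and box: "\<And>\<epsilon>. 0 < \<epsilon> \<Longrightarrow> \<epsilon> < \<epsilon>0 \<Longrightarrow>
       \<exists>\<beta>. (\<forall>i. 0 < \<beta> $ i \<and> \<beta> $ i < min r 1) \<and> (\<forall>t. (\<forall>i. \<bar>t $ i\<bar> \<le> \<beta> $ i) \<longrightarrow> \<bar>\<sigma> t\<bar> \<le> \<epsilon> / 2) \<and>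
          L * \<epsilon> powr (a + \<delta>) \<le> (\<Prod>i\<in>UNIV. \<beta> $ i)"
    using boxes[OF \<delta>(1)] by blast
  define n where "n = CARD('n)"
  define K where "K = A * (L / M ^ n) powr (- \<theta>)"
  obtain \<epsilon>1 where \<epsilon>1: "\<epsilon>1 > 0" "\<And>\<epsilon>. 0 < \<epsilon> \<Longrightarrow> \<epsilon> < \<epsilon>1 \<Longrightarrow> K * \<epsilon> powr \<omega> < c"
    using ex_small_powr[of \<omega> c K] \<omega> c unfolding \<omega>_def by blast
  obtain \<epsilon>2 where \<epsilon>2: "\<epsilon>2 > 0" "\<And>\<epsilon>. 0 < \<epsilon> \<Longrightarrow> \<epsilon> < \<epsilon>2 \<Longrightarrow> M * \<epsilon> powr (1 - (a + \<delta>)) < L"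
    using ex_small_powr[of "1 - (a + \<delta>)" L M] \<delta>(2) L by auto
  define \<epsilon> where "\<epsilon> = min (min \<epsilon>0 \<epsilon>1) (min \<epsilon>2 1) / 2"
  have \<epsilon>: "0 < \<epsilon>" "\<epsilon> < \<epsilon>0" "\<epsilon> < \<epsilon>1" "\<epsilon> < \<epsilon>2" "\<epsilon> < 1" using \<epsilon>0 \<epsilon>1(1) \<epsilon>2(1) by (auto simp: \<epsilon>_def)
  obtain \<beta> where \<beta>: "\<And>i. 0 < \<beta> $ i" "\<And>i. \<beta> $ i < r" "\<And>i. \<beta> $ i < 1"
    and small: "\<And>t. (\<And>i. \<bar>t $ i\<bar> \<le> \<beta> $ i) \<Longrightarrow> \<bar>\<sigma> t\<bar> \<le> \<epsilon> / 2"
    and vol: "L * \<epsilon> powr (a + \<delta>) \<le> (\<Prod>i\<in>UNIV. \<beta> $ i)"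
    using box[OF \<epsilon>(1,2)] by (auto simp: min_less_iff_conj)
  \<comment> \<open>Each side is at least the volume, because all sides are shorter than \<open>1\<close>; and, as
    \<open>a + \<delta> < 1\<close>, the volume exceeds \<open>M \<epsilon>\<close> for small \<open>\<epsilon>\<close>.\<close>
  have side: "M * \<epsilon> \<le> \<beta> $ i" for i
  proof -
    have "M * \<epsilon> = M * \<epsilon> powr (1 - (a + \<delta>)) * \<epsilon> powr (a + \<delta>)" using \<epsilon>(1) by (simp flip: powr_add)
    also have "\<dots> \<le> L * \<epsilon> powr (a + \<delta>)" using \<epsilon>2(2)[OF \<epsilon>(1,4)] by (intro mult_right_mono) auto
    also note vol
    also have "(\<Prod>i\<in>UNIV. \<beta> $ i) = \<beta> $ i * (\<Prod>j\<in>UNIV - {i}. \<beta> $ j)" by (rule prod.remove) auto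
    also have "\<dots> \<le> \<beta> $ i * 1" using \<beta> by (intro mult_left_mono prod_le_1) (auto intro: less_imp_le)
    finally show ?thesis by simp
  qed
  define w where "w = box_scales M \<beta> \<epsilon>"
  have w_axis: "w (axis i 1, 0) = (\<beta> $ i / M)\<^sup>2" for i by (simp add: w_def box_scales_def inner_axis')
  have w_e: "w (0, 1) = \<epsilon>\<^sup>2" by (simp add: w_def box_scales_def)
  have Mpos: "M > 0" using M by simp
  have w_pos: "w b > 0" if b: "b \<in> Basis" for b
  proof -
    consider i where "b = (axis i 1, 0)" | "b = (0, 1)" using b by (auto simp: Basis_prod_def Basis_vec_def)
    then show ?thesis
    proof cases
      case 1
      have "\<beta> $ i / M > 0" for i using \<beta>(1)[of i] Mpos by simp
      then show ?thesis unfolding 1 w_axis by (metis zero_less_power)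
    qed (use w_e \<epsilon>(1) in auto)
  qed
  define V where "V = \<epsilon> * (\<Prod>i\<in>UNIV. \<beta> $ i) / M ^ n"
  have W: "(\<Prod>b\<in>Basis. w b) = V\<^sup>2"
    unfolding prod_Basis_prod prod_Basis_vec w_axis
    by (simp add: w_e V_def n_def prod_dividef power_divide power_mult_distrib prod_power_distrib[symmetric] power_mult[symmetric] mult.commute)
  have Vlow: "(L / M ^ n) * \<epsilon> powr (1 + a + \<delta>) \<le> V"
  proof -
    have "(L / M ^ n) * \<epsilon> powr (1 + a + \<delta>) = \<epsilon> * (L * \<epsilon> powr (a + \<delta>)) / M ^ n"
      using \<epsilon>(1) by (simp add: powr_add)
    also have "\<dots> \<le> V" unfolding V_def using vol \<epsilon>(1) Mpos by (intro divide_right_mono mult_left_mono) auto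
    finally show ?thesis .
  qed
  have LM: "L / M ^ n > 0" using L Mpos by simp
  have Vpos: "V > 0" using Vlow LM \<epsilon>(1) by (smt (verit) mult_pos_pos powr_gt_zero)
  have "(c / \<epsilon> ^ 5) * \<epsilon>\<^sup>2 \<le> A * (\<Prod>b\<in>Basis. w b) powr ((1 / p - 1 / q - 1) / 2) * w (0, 1) powr (\<kappa> - 2)"
  proof (rule A(2))
    show "c / \<epsilon> ^ 5 \<le> (LINT t|lborel. k t * wave (0, 1) (\<lambda>b. 2 * (w b + v)) (t, \<sigma> t))" if "0 \<le> v" "v \<le> \<epsilon>\<^sup>2" for v
      unfolding w_def using \<beta> \<epsilon>(1) side small that by (intro lower) auto
    show "\<epsilon>\<^sup>2 \<le> 1" using \<epsilon> by (simp add: power_le_one)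
  qed (use w_pos \<epsilon>(1) c in auto)
  also have "(\<Prod>b\<in>Basis. w b) powr ((1 / p - 1 / q - 1) / 2) = V powr (- \<theta>)"
  proof -
    have "(1 / p - 1 / q - 1) / 2 = - \<theta> / 2" by (simp add: \<theta>_def)
    moreover have "(V\<^sup>2) powr x = V powr (2 * x)" for x
      using Vpos by (simp add: powr_powr flip: powr_numeral)
    ultimately show ?thesis unfolding W by simp
  qed
  also have "w (0, 1) powr (\<kappa> - 2) = \<epsilon> powr (2 * \<kappa> - 4)"
  proof -
    have "(\<epsilon>\<^sup>2) powr x = \<epsilon> powr (2 * x)" for x
      using \<epsilon>(1) by (simp add: powr_powr flip: powr_numeral)
    then show ?thesis unfolding w_e by (simp add: right_diff_distrib)
  qed
  also have "A * V powr (- \<theta>) * \<epsilon> powr (2 * \<kappa> - 4) \<le> A * ((L / M ^ n) * \<epsilon> powr (1 + a + \<delta>)) powr (- \<theta>) * \<epsilon> powr (2 * \<kappa> - 4)"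
  proof (intro mult_right_mono mult_left_mono powr_mono2')
    show "0 < (L / M ^ n) * \<epsilon> powr (1 + a + \<delta>)" using LM \<epsilon>(1) by (intro mult_pos_pos) auto
  qed (use A(1) Vlow \<theta> in auto)
  also have "((L / M ^ n) * \<epsilon> powr (1 + a + \<delta>)) powr (- \<theta>) = (L / M ^ n) powr (- \<theta>) * \<epsilon> powr (- \<theta> * (1 + a + \<delta>))"
    by (subst powr_mult) (use LM in \<open>auto simp: powr_powr mult.commute\<close>)
  also have "A * ((L / M ^ n) powr (- \<theta>) * \<epsilon> powr (- \<theta> * (1 + a + \<delta>))) * \<epsilon> powr (2 * \<kappa> - 4)
      = K * (\<epsilon> powr (- \<theta> * (1 + a + \<delta>)) * \<epsilon> powr (2 * \<kappa> - 4))"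
    by (simp add: K_def)
  also have "\<epsilon> powr (- \<theta> * (1 + a + \<delta>)) * \<epsilon> powr (2 * \<kappa> - 4) = \<epsilon> powr \<omega> * \<epsilon> powr (- 3)"
    unfolding powr_add[symmetric] \<omega>_def by (simp add: algebra_simps)
  finally have "(c / \<epsilon> ^ 5) * \<epsilon>\<^sup>2 \<le> K * \<epsilon> powr \<omega> * \<epsilon> powr (- 3)" by simp
  moreover have "(c / \<epsilon> ^ 5) * \<epsilon>\<^sup>2 = c * \<epsilon> powr (- 3)"
  proof -
    have "\<epsilon> ^ 5 = \<epsilon> ^ 3 * \<epsilon>\<^sup>2" by (simp flip: power_add)
    moreover have "c / (x * y) * y = c / x" if "y \<noteq> 0" for x y :: real using that by simp
    ultimately have "(c / \<epsilon> ^ 5) * \<epsilon>\<^sup>2 = c / \<epsilon> ^ 3" using \<epsilon>(1) by (metis less_irrefl zero_less_power)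
    then show ?thesis using \<epsilon>(1) by (simp add: powr_minus powr_numeral divide_inverse)
  qed
  ultimately have "c * \<epsilon> powr (- 3) \<le> K * \<epsilon> powr \<omega> * \<epsilon> powr (- 3)" by simp
  then have "c \<le> K * \<epsilon> powr \<omega>" using \<epsilon>(1) by simp
  then show False using \<epsilon>1(2)[OF \<epsilon>(1,3)] by simp
qed

theorem theorem1p5:
  fixes S K :: "real ^ 'n \<Rightarrow> real"
    and U N0 :: "(real ^ 'n) set"
    and grp :: "'n \<Rightarrow> nat" and m d0 :: nat
    and C C1 a0 g p q s :: real
    and P :: "(real \<times> real \<times> real) set"
  assumes "open U" and "0 \<in> U"
    and "real_analytic_on S U" and "\<exists>t\<in>U. S t \<noteq> 0"
    and "S 0 = 0" and "(S has_derivative (\<lambda>_. 0)) (at 0)"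
    and "range grp = {1..m}"
    and "compact (closure {t. K t \<noteq> 0})" and "closure {t. K t \<noteq> 0} \<subseteq> U"
    and "C1_on K {t\<in>U. \<forall>i. t $ i \<noteq> 0}"
    and "C > 0"
    and "\<And>t. t \<in> U \<Longrightarrow> (\<And>i. t $ i \<noteq> 0) \<Longrightarrow> \<bar>K t\<bar> \<le> C"
    and "\<And>t j. t \<in> U \<Longrightarrow> (\<And>i. t $ i \<noteq> 0) \<Longrightarrow>
           \<bar>partial_deriv (axis j 1) K t\<bar> \<le> C / \<bar>t $ j\<bar>"
    and "sublevel_growth S a0 d0"
    and "g = Min (insert a0 ((\<lambda>i. real (card {j. grp j = i})) ` {1..m}))"
    and "g \<le> 1 / max (real (newton_order S)) 2"
    and "C1 > 0" and "open N0" and "0 \<in> N0" and "\<And>t. t \<in> N0 \<Longrightarrow> K t > C1"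
    and "P = {(x, y, z). (g + 1) * (x - y) + z = g}"
    and "1 < p" and "1 < q"
    and "\<exists>t<s. (1 / p, 1 / q, t) \<in> P"
  shows "\<not> bounded_Lp_Sobolev (averaging_op S K) p q s"
proof
  assume bounded: "bounded_Lp_Sobolev (averaging_op S K) p q s"
  note U = \<open>open U\<close> \<open>0 \<in> U\<close>
  have growth: "sublevel_growth S a0 d0" by fact
  have a0_pos: "a0 > 0" using growth[unfolded sublevel_growth_def] by (rule conjunct1)
  have g_le: "g \<le> 1/2"
  proof -
    have "1 / max (real (newton_order S)) 2 \<le> 1 / 2" by (intro divide_left_mono) auto
    then show ?thesis using \<open>g \<le> 1 / max (real (newton_order S)) 2\<close> by linarith
  qed
  \<comment> \<open>The other numbers in the minimum are group sizes, hence at least \<open>1\<close>.\<close>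
  have g_eq: "g = a0"
  proof -
    let ?C = "(\<lambda>i. real (card {j. grp j = i})) ` {1..m}"
    have "g \<in> insert a0 ?C"
      unfolding \<open>g = Min (insert a0 ?C)\<close> by (intro Min_in) auto
    moreover have "g \<notin> ?C"
    proof
      assume "g \<in> ?C"
      then obtain i where i: "i \<in> range grp" "g = real (card {j. grp j = i})"
        using \<open>range grp = {1..m}\<close> by auto
      then obtain j where "j \<in> {j. grp j = i}" by auto
      then have "card {j. grp j = i} \<noteq> 0" by (metis card_0_eq emptyE finite)
      then have "1 \<le> real (card {j. grp j = i})" by linarith
      then show False using i(2) g_le by linarith
    qed
    ultimately show ?thesis by simp
  qed
  define V where "V = {t \<in> U. \<forall>i. t $ i \<noteq> 0}"
  have V_open: "open V"
  proof -
    have "V = U \<inter> (\<Inter>i. {t. t $ i \<noteq> 0})" by (auto simp: V_def)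
    moreover have "open {t :: real ^ 'n. t $ i \<noteq> 0}" for i
      by (intro open_Collect_neq continuous_intros)
    ultimately show ?thesis using U(1) by (auto intro!: open_Int open_INT)
  qed
  \<comment> \<open>\<open>K\<close> need not be Borel measurable on the coordinate hyperplanes, and \<open>S\<close> is arbitrary outside \<open>U\<close>.
    The Borel functions \<open>k\<close> and \<open>\<sigma>\<close> give the same operator.\<close>
  define k where "k = (\<lambda>t. if t \<in> V then K t else 0)"
  define \<sigma> where "\<sigma> = (\<lambda>t. if t \<in> U then S t else 0)"
  have "continuous_on U S"
  proof (rule continuous_at_imp_continuous_on, intro ballI)
    fix u assume "u \<in> U"
    then obtain c where "has_power_series_at S u c"
      using \<open>real_analytic_on S U\<close> unfolding real_analytic_on_def by blast
    then show "isCont S u" by (rule has_power_series_at_imp_continuous)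
  qed
  then have \<sigma>_meas: "\<sigma> \<in> borel_measurable borel"
    unfolding \<sigma>_def using U(1) by (intro borel_measurable_continuous_on_if borel_open) auto
  have "continuous_on V K"
  proof (rule continuous_at_imp_continuous_on, intro ballI)
    fix t assume "t \<in> V"
    then have "K differentiable (at t)"
      using \<open>C1_on K {t \<in> U. \<forall>i. t $ i \<noteq> 0}\<close> unfolding C1_on_def V_def by blast
    then show "isCont K t" by (rule differentiable_imp_continuous_within)
  qed
  then have k_meas: "k \<in> borel_measurable borel"
    unfolding k_def using V_open by (intro borel_measurable_continuous_on_if borel_open) auto
  have k_bound: "\<bar>k t\<bar> \<le> C" for t
    using \<open>\<And>t. t \<in> U \<Longrightarrow> (\<And>i. t $ i \<noteq> 0) \<Longrightarrow> \<bar>K t\<bar> \<le> C\<close>[of t] \<open>C > 0\<close> by (auto simp: k_def V_def)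
  have k_int: "integrable lborel k"
  proof (rule Bochner_Integration.integrable_bound)
    define X where "X = closure {t. K t \<noteq> 0}"
    have X: "compact X" "{t. K t \<noteq> 0} \<subseteq> X"
      using \<open>compact (closure {t. K t \<noteq> 0})\<close> by (auto simp: X_def closure_subset[THEN subsetD])
    show "integrable lborel (\<lambda>t. C * indicator X t)"
      using emeasure_compact_finite[OF X(1)] X(1)
      by (intro integrable_mult_right) (simp add: integrable_indicator_iff borel_compact infinity_ennreal_def)
    show "AE t in lborel. norm (k t) \<le> norm (C * indicator X t)"
    proof (intro AE_I2)
      fix t
      show "norm (k t) \<le> norm (C * indicator X t)"
        using k_bound[of t] X(2) \<open>C > 0\<close> by (cases "t \<in> X") (auto simp: k_def)
    qed
  qed (use k_meas in simp)
  let ?N = "{t :: real ^ 'n. \<exists>i. t $ i = 0}"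
  have K_supp: "K t = 0" if "t \<notin> U" for t
    using \<open>closure {t. K t \<noteq> 0} \<subseteq> U\<close> closure_subset[of "{t. K t \<noteq> 0}"] that by auto
  have conv_eq: "averaging_op S K f = conv_op (\<lambda>t. (t, \<sigma> t)) k f" if f: "schwartz f" for f
  proof
    fix z :: "(real ^ 'n) \<times> real"
    have "f differentiable (at x)" for x
      using f unfolding schwartz_def by (metis iter_partial.simps(1) lists.Nil)
    then have "continuous_on UNIV f"
      by (auto intro!: continuous_at_imp_continuous_on differentiable_imp_continuous_within)
    then have f_meas: "f \<in> borel_measurable borel" by (rule borel_measurable_continuous_onI)
    obtain x y where z: "z = (x, y)" by (cases z) auto
    have "(LINT t|lebesgue. f (x - t, y - S t) * of_real (K t)) = (LINT t|lborel. f (x - t, y - \<sigma> t) * of_real (k t))"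
    proof (rule lebesgue_integral_eq_off_null)
      show "(\<lambda>t. f (x - t, y - \<sigma> t) * of_real (k t)) \<in> borel_measurable borel"
        using f_meas \<sigma>_meas k_meas by measurable
      show "?N \<in> null_sets lebesgue" by (rule null_sets_completionI[OF null_coordinate_hyperplanes])
      show "f (x - t, y - S t) * of_real (K t) = f (x - t, y - \<sigma> t) * of_real (k t)" if "t \<notin> ?N" for t
        using that K_supp[of t] by (auto simp: \<sigma>_def k_def V_def)
    qed
    then show "averaging_op S K f z = conv_op (\<lambda>t. (t, \<sigma> t)) k f z"
      by (simp add: averaging_op_def conv_op_def z)
  qed
  have bdd: "bounded_Lp_Sobolev (conv_op (\<lambda>t. (t, \<sigma> t)) k) p q s"
    using bounded unfolding bounded_Lp_Sobolev_def by (simp add: conv_eq cong: imp_cong)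
  obtain c where c: "has_power_series_at S 0 c"
    using \<open>real_analytic_on S U\<close> U(2) unfolding real_analytic_on_def by blast
  obtain \<rho> D where \<rho>: "\<rho> > 0" and D: "D > 0" and S_le:
    "\<And>\<beta> t. (\<And>i. 0 < \<beta> $ i) \<Longrightarrow> (\<And>i. \<beta> $ i < \<rho>) \<Longrightarrow> (\<And>i. \<bar>t $ i\<bar> \<le> \<beta> $ i) \<Longrightarrow> \<bar>S t\<bar> \<le> D * newton_star S \<beta>"
    using abs_le_newton_star[OF c] by blast
  obtain r0 where r0: "r0 > 0" "ball 0 r0 \<subseteq> U \<inter> N0"
    using openE[of "U \<inter> N0" 0] U \<open>open N0\<close> \<open>0 \<in> N0\<close> by auto
  define r where "r = min \<rho> (r0 / real CARD('n))"
  have r: "r > 0" "r \<le> \<rho>" using \<rho> r0(1) by (auto simp: r_def)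
  have in_ball: "t \<in> U" "t \<in> N0" if t: "\<And>i. \<bar>t $ i\<bar> < r" for t
  proof -
    have "norm t \<le> (\<Sum>i\<in>UNIV. \<bar>t $ i\<bar>)" by (rule norm_le_l1_cart)
    also have "\<dots> < (\<Sum>i\<in>(UNIV :: 'n set). r)" using t by (intro sum_strict_mono) auto
    also have "\<dots> = real CARD('n) * r" by simp
    also have "\<dots> \<le> real CARD('n) * (r0 / real CARD('n))" unfolding r_def by (intro mult_left_mono) auto
    finally have "t \<in> ball 0 r0" by simp
    then show "t \<in> U" "t \<in> N0" using r0(2) by auto
  qed
  have low: "AE t in lborel. (\<forall>i. \<bar>t $ i\<bar> < r) \<longrightarrow> C1 \<le> k t"
  proof (rule AE_I'[OF null_coordinate_hyperplanes])
    show "{t \<in> space lborel. \<not> ((\<forall>i. \<bar>t $ i\<bar> < r) \<longrightarrow> C1 \<le> k t)} \<subseteq> ?N"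
    proof
      fix t :: "real ^ 'n" assume "t \<in> {t \<in> space lborel. \<not> ((\<forall>i. \<bar>t $ i\<bar> < r) \<longrightarrow> C1 \<le> k t)}"
      then have t: "\<And>i. \<bar>t $ i\<bar> < r" "k t < C1" by auto
      then have "K t > C1" "t \<in> U" using in_ball[of t] \<open>\<And>t. t \<in> N0 \<Longrightarrow> K t > C1\<close>[of t] by auto
      then show "t \<in> ?N" using t(2) by (auto simp: k_def V_def split: if_splits)
    qed
  qed
  have boxes: "\<exists>L>0. \<exists>\<epsilon>0>0. \<forall>\<epsilon>. 0 < \<epsilon> \<and> \<epsilon> < \<epsilon>0 \<longrightarrow>
       (\<exists>\<beta>. (\<forall>i. 0 < \<beta> $ i \<and> \<beta> $ i < min r 1) \<and> (\<forall>t. (\<forall>i. \<bar>t $ i\<bar> \<le> \<beta> $ i) \<longrightarrow> \<bar>\<sigma> t\<bar> \<le> \<epsilon> / 2) \<and>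
          L * \<epsilon> powr (a0 + \<delta>) \<le> (\<Prod>i\<in>UNIV. \<beta> $ i))" if \<delta>: "\<delta> > 0" for \<delta> :: real
  proof -
    have "min r 1 > 0" using r by simp
    from sublevel_growth_box[OF growth \<delta> this]
    obtain \<epsilon>0 where \<epsilon>0: "\<epsilon>0 > 0" "\<And>\<epsilon>. 0 < \<epsilon> \<Longrightarrow> \<epsilon> < \<epsilon>0 \<Longrightarrow>
       \<exists>\<beta>. (\<forall>i. 0 < \<beta> $ i \<and> \<beta> $ i < min r 1) \<and> newton_star S \<beta> < \<epsilon> \<and> \<epsilon> powr (a0 + \<delta>) \<le> (\<Prod>i\<in>UNIV. \<beta> $ i)"
      by blast
    define \<eta> where "\<eta> = 1 / (2 * D)"
    have \<eta>: "\<eta> > 0" "D * \<eta> = 1 / 2" using D by (auto simp: \<eta>_def)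
    have "\<exists>\<beta>. (\<forall>i. 0 < \<beta> $ i \<and> \<beta> $ i < min r 1) \<and> (\<forall>t. (\<forall>i. \<bar>t $ i\<bar> \<le> \<beta> $ i) \<longrightarrow> \<bar>\<sigma> t\<bar> \<le> \<epsilon> / 2) \<and>
          \<eta> powr (a0 + \<delta>) * \<epsilon> powr (a0 + \<delta>) \<le> (\<Prod>i\<in>UNIV. \<beta> $ i)" if \<epsilon>: "0 < \<epsilon> \<and> \<epsilon> < \<epsilon>0 / \<eta>" for \<epsilon>
    proof -
      have "0 < \<epsilon>" "\<epsilon> < \<epsilon>0 / \<eta>" using \<epsilon> by auto
      then have "0 < \<eta> * \<epsilon>" "\<eta> * \<epsilon> < \<epsilon>0" using \<eta>(1) by (auto simp: field_simps)
      from \<epsilon>0(2)[OF this] obtain \<beta> where \<beta>: "\<And>i. 0 < \<beta> $ i" "\<And>i. \<beta> $ i < min r 1"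
        "newton_star S \<beta> < \<eta> * \<epsilon>" "(\<eta> * \<epsilon>) powr (a0 + \<delta>) \<le> (\<Prod>i\<in>UNIV. \<beta> $ i)" by blast
      have \<beta>r: "\<beta> $ i < r" "\<beta> $ i < \<rho>" for i using \<beta>(2)[of i] r(2) by auto
      have "\<bar>\<sigma> t\<bar> \<le> \<epsilon> / 2" if t: "\<forall>i. \<bar>t $ i\<bar> \<le> \<beta> $ i" for t
      proof -
        have "\<bar>t $ i\<bar> < r" for i using t \<beta>r(1)[of i] by (meson le_less_trans)
        then have "\<bar>\<sigma> t\<bar> = \<bar>S t\<bar>" using in_ball(1)[of t] by (simp add: \<sigma>_def)
        also have "\<dots> \<le> D * newton_star S \<beta>" using t \<beta>(1) \<beta>r(2) by (intro S_le) auto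
        also have "\<dots> \<le> D * (\<eta> * \<epsilon>)" using \<beta>(3) D by (intro mult_left_mono) auto
        also have "\<dots> = \<epsilon> / 2" using \<eta>(2) by (simp flip: mult.assoc)
        finally show ?thesis .
      qed
      moreover have "\<eta> powr (a0 + \<delta>) * \<epsilon> powr (a0 + \<delta>) \<le> (\<Prod>i\<in>UNIV. \<beta> $ i)"
        using \<beta>(4) \<eta>(1) \<epsilon> by (simp add: powr_mult)
      ultimately show "\<exists>\<beta>. (\<forall>i. 0 < \<beta> $ i \<and> \<beta> $ i < min r 1) \<and> (\<forall>t. (\<forall>i. \<bar>t $ i\<bar> \<le> \<beta> $ i) \<longrightarrow> \<bar>\<sigma> t\<bar> \<le> \<epsilon> / 2) \<and>
          \<eta> powr (a0 + \<delta>) * \<epsilon> powr (a0 + \<delta>) \<le> (\<Prod>i\<in>UNIV. \<beta> $ i)"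
        using \<beta>(1,2) by blast
    qed
    moreover have "\<eta> powr (a0 + \<delta>) > 0" "\<epsilon>0 / \<eta> > 0" using \<eta> \<epsilon>0(1) by simp_all
    ultimately show ?thesis by blast
  qed
  have "s \<le> (a0 + 1) * (1 - 1 / p + 1 / q) - 1"
    by (rule averaging_graph_bound_implies_order_le[OF \<sigma>_meas k_int k_bound \<open>C1 > 0\<close> r(1) low a0_pos _ boxes \<open>1 < p\<close> \<open>1 < q\<close> bdd])
       (use g_le g_eq in simp)
  moreover obtain t where "t < s" "(a0 + 1) * (1 / p - 1 / q) + t = a0"
    using \<open>\<exists>t<s. (1 / p, 1 / q, t) \<in> P\<close> \<open>P = {(x, y, z). (g + 1) * (x - y) + z = g}\<close> g_eq by auto
  ultimately show False by (simp add: algebra_simps)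
qed

end
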